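(* Let $\Lambda$ be a mild (finite dimensional, associative) algebra over an algebraically closed field $\mathbf{k}$. Let $S$ be a simple $\Lambda$-module. If the projective dimension of $S$ is finite, then $\mathrm{Ext}^1_{\Lambda}(S,S)=0$.
   Context: Modules are finite dimensional right modules. An algebra $\Lambda$ is distributive if its lattice of two-sided ideals is distributive. It is mild if it is distributive and every proper quotient $\Lambda/J$ (with $J$ a nonzero two-sided ideal) is representation-finite. *)

theory Defs
  imports
    "Jordan_Normal_Form.Missing_VectorSpace"
    "HOL-Algebra.Algebraic_Closure"
    "HOL-Algebra.Elementary_Groups"
    "HOL-Algebra.QuotRing"
    "HOL-Library.Extended_Nat"
begin

hide_const (open) Multiset.mult

section \<open>Finite-dimensional associative algebras\<close>

text \<open>
  The library locale \<^locale>\<open>algebra\<close> only covers commutative algebras.  An algebra over \<open>K\<close> is a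
  ring with one that carries a compatible \<open>K\<close>-module structure in its \<^const>\<open>smult\<close> field.
\<close>

locale fd_algebra = space: vectorspace K A + ring A
  for K (structure) and A (structure) +
  assumes finite_dimensional: "vectorspace.fin_dim K A"
    and smult_mult_left:
      "\<lbrakk>c \<in> carrier K; x \<in> carrier A; y \<in> carrier A\<rbrakk>
        \<Longrightarrow> (c \<odot>\<^bsub>A\<^esub> x) \<otimes>\<^bsub>A\<^esub> y = c \<odot>\<^bsub>A\<^esub> (x \<otimes>\<^bsub>A\<^esub> y)"
    and smult_mult_right:
      "\<lbrakk>c \<in> carrier K; x \<in> carrier A; y \<in> carrier A\<rbrakk>
        \<Longrightarrow> x \<otimes>\<^bsub>A\<^esub> (c \<odot>\<^bsub>A\<^esub> y) = c \<odot>\<^bsub>A\<^esub> (x \<otimes>\<^bsub>A\<^esub> y)"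

text \<open>
  Two-sided ideals of an algebra with one are automatically \<open>K\<close>-subspaces, so \<^locale>\<open>ideal\<close> is the
  right notion; the quotient ring is equipped with the induced scalar multiplication
  \<open>c \<odot> (J +> x) = J +> (c \<odot> x)\<close>.
\<close>

definition quotient_algebra ::
    "('k, 'a, 'm) module_scheme \<Rightarrow> 'a set \<Rightarrow> ('k, 'a set) module" where
  "quotient_algebra A J =
     \<lparr>carrier = carrier (A Quot J), mult = mult (A Quot J), one = one (A Quot J),
      zero = zero (A Quot J), add = add (A Quot J),
      smult = (\<lambda>c C. \<Union>x\<in>C. J +>\<^bsub>A\<^esub> (c \<odot>\<^bsub>A\<^esub> x))\<rparr>"

text \<open>In the lattice of two-sided ideals meets are intersections and joins are sums.\<close>

definition distributive_algebra :: "('k, 'a, 'm) module_scheme \<Rightarrow> bool" where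
  "distributive_algebra A \<longleftrightarrow>
     (\<forall>I J L. ideal I A \<and> ideal J A \<and> ideal L A \<longrightarrow>
        I \<inter> (J <+>\<^bsub>A\<^esub> L) = (I \<inter> J) <+>\<^bsub>A\<^esub> (I \<inter> L))"


section \<open>Finite-dimensional right modules\<close>

text \<open>As in the library's \<^typ>\<open>('a, 'b) module\<close>, the ring fields \<open>mult\<close> and \<open>one\<close> play no role.\<close>

record ('a, 'b) rmodule = "'b ring" +
  ract :: "'b \<Rightarrow> 'a \<Rightarrow> 'b" (infixl \<open>\<lhd>\<index>\<close> 70)

locale right_module = A?: ring A + M?: abelian_group M
  for A :: "('a, 'm) ring_scheme" (structure) and M :: "('a, 'b, 'r) rmodule_scheme" (structure) +
  assumes ract_closed:
      "\<lbrakk>x \<in> carrier M; a \<in> carrier A\<rbrakk> \<Longrightarrow> x \<lhd>\<^bsub>M\<^esub> a \<in> carrier M"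
    and ract_add:
      "\<lbrakk>x \<in> carrier M; a \<in> carrier A; b \<in> carrier A\<rbrakk>
        \<Longrightarrow> x \<lhd>\<^bsub>M\<^esub> (a \<oplus>\<^bsub>A\<^esub> b) = (x \<lhd>\<^bsub>M\<^esub> a) \<oplus>\<^bsub>M\<^esub> (x \<lhd>\<^bsub>M\<^esub> b)"
    and add_ract:
      "\<lbrakk>x \<in> carrier M; y \<in> carrier M; a \<in> carrier A\<rbrakk>
        \<Longrightarrow> (x \<oplus>\<^bsub>M\<^esub> y) \<lhd>\<^bsub>M\<^esub> a = (x \<lhd>\<^bsub>M\<^esub> a) \<oplus>\<^bsub>M\<^esub> (y \<lhd>\<^bsub>M\<^esub> a)"
    and ract_mult:
      "\<lbrakk>x \<in> carrier M; a \<in> carrier A; b \<in> carrier A\<rbrakk>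
        \<Longrightarrow> x \<lhd>\<^bsub>M\<^esub> (a \<otimes>\<^bsub>A\<^esub> b) = (x \<lhd>\<^bsub>M\<^esub> a) \<lhd>\<^bsub>M\<^esub> b"
    and ract_one: "x \<in> carrier M \<Longrightarrow> x \<lhd>\<^bsub>M\<^esub> \<one>\<^bsub>A\<^esub> = x"

text \<open>A right module over a \<open>K\<close>-algebra is a \<open>K\<close>-vector space through \<open>c \<odot> x = x \<lhd> (c \<odot> \<one>)\<close>.\<close>

definition underlying_space ::
    "('k, 'a, 'm) module_scheme \<Rightarrow> ('a, 'b, 'r) rmodule_scheme \<Rightarrow> ('k, 'b) module" where
  "underlying_space A M =
     \<lparr>carrier = carrier M, mult = mult M, one = one M, zero = zero M, add = add M,
      smult = (\<lambda>c x. x \<lhd>\<^bsub>M\<^esub> (c \<odot>\<^bsub>A\<^esub> \<one>\<^bsub>A\<^esub>))\<rparr>"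

definition fd_right_module ::
    "('k, 'n) ring_scheme \<Rightarrow> ('k, 'a, 'm) module_scheme \<Rightarrow> ('a, 'b, 'r) rmodule_scheme \<Rightarrow> bool" where
  "fd_right_module K A M \<longleftrightarrow>
     right_module A M \<and> vectorspace.fin_dim K (underlying_space A M)"

definition rsubmodule ::
    "('k, 'a, 'm) module_scheme \<Rightarrow> ('a, 'b, 'r) rmodule_scheme \<Rightarrow> 'b set \<Rightarrow> bool" where
  "rsubmodule A M N \<longleftrightarrow>
     additive_subgroup N M \<and> (\<forall>x\<in>N. \<forall>a\<in>carrier A. x \<lhd>\<^bsub>M\<^esub> a \<in> N)"

definition simple_rmodule ::
    "('k, 'a, 'm) module_scheme \<Rightarrow> ('a, 'b, 'r) rmodule_scheme \<Rightarrow> bool" where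
  "simple_rmodule A M \<longleftrightarrow>
     carrier M \<noteq> {\<zero>\<^bsub>M\<^esub>} \<and>
     (\<forall>N. rsubmodule A M N \<longrightarrow> N = {\<zero>\<^bsub>M\<^esub>} \<or> N = carrier M)"

definition indecomposable_rmodule ::
    "('k, 'a, 'm) module_scheme \<Rightarrow> ('a, 'b, 'r) rmodule_scheme \<Rightarrow> bool" where
  "indecomposable_rmodule A M \<longleftrightarrow>
     carrier M \<noteq> {\<zero>\<^bsub>M\<^esub>} \<and>
     (\<forall>N L. rsubmodule A M N \<and> rsubmodule A M L \<and>
            N \<inter> L = {\<zero>\<^bsub>M\<^esub>} \<and> N <+>\<^bsub>M\<^esub> L = carrier M \<longrightarrow>
            N = {\<zero>\<^bsub>M\<^esub>} \<or> L = {\<zero>\<^bsub>M\<^esub>})"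

text \<open>Homomorphisms are extensional, so that equality of homomorphisms is equality of functions.\<close>

definition rmod_hom ::
    "('k, 'a, 'm) module_scheme \<Rightarrow> ('a, 'b, 'r) rmodule_scheme \<Rightarrow> ('a, 'c, 's) rmodule_scheme
      \<Rightarrow> ('b \<Rightarrow> 'c) set" where
  "rmod_hom A M N =
     {f \<in> hom (add_monoid M) (add_monoid N) \<inter> extensional (carrier M).
        \<forall>x\<in>carrier M. \<forall>a\<in>carrier A. f (x \<lhd>\<^bsub>M\<^esub> a) = f x \<lhd>\<^bsub>N\<^esub> a}"

definition rmod_isomorphic ::
    "('k, 'a, 'm) module_scheme \<Rightarrow> ('a, 'b, 'r) rmodule_scheme \<Rightarrow> ('a, 'c, 's) rmodule_scheme
      \<Rightarrow> bool" where
  "rmod_isomorphic A M N \<longleftrightarrow> (\<exists>f\<in>rmod_hom A M N. bij_betw f (carrier M) (carrier N))"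


section \<open>Representation-finite and mild algebras\<close>

text \<open>
  HOL cannot quantify over types inside a formula.  Wherever a notion ranges over all
  finite-dimensional modules, the underlying sets are taken inside the type \<^typ>\<open>'k list\<close>, where
  \<^typ>\<open>'k\<close> is the type of the scalars: a module of dimension \<open>n\<close> is isomorphic to one with
  underlying set \<open>K\<^sup>n\<close>, realised as the lists of length \<open>n\<close> over \<open>carrier K\<close>.  Hence these modules
  represent all isomorphism classes and nothing is lost.
\<close>

definition indecomposables ::
    "('k, 'n) ring_scheme \<Rightarrow> ('k, 'a, 'm) module_scheme \<Rightarrow> ('a, 'k list) rmodule set" where
  "indecomposables K A = {M. fd_right_module K A M \<and> indecomposable_rmodule A M}"

definition representation_finite ::
    "('k, 'n) ring_scheme \<Rightarrow> ('k, 'a, 'm) module_scheme \<Rightarrow> bool" where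
  "representation_finite K A \<longleftrightarrow>
     finite (indecomposables K A //
       {(M, N) \<in> indecomposables K A \<times> indecomposables K A. rmod_isomorphic A M N})"

definition mild_algebra ::
    "('k, 'n) ring_scheme \<Rightarrow> ('k, 'a, 'm) module_scheme \<Rightarrow> bool" where
  "mild_algebra K A \<longleftrightarrow>
     distributive_algebra A \<and>
     (\<forall>J. ideal J A \<and> J \<noteq> {\<zero>\<^bsub>A\<^esub>} \<longrightarrow> representation_finite K (quotient_algebra A J))"


section \<open>Projective resolutions, projective dimension and Ext\<close>

definition projective_rmodule ::
    "('k, 'n) ring_scheme \<Rightarrow> ('k, 'a, 'm) module_scheme \<Rightarrow> ('a, 'b, 'r) rmodule_scheme \<Rightarrow> bool" where
  "projective_rmodule K A P \<longleftrightarrow>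
     fd_right_module K A P \<and>
     (\<forall>(U :: ('a, 'k list) rmodule) (V :: ('a, 'k list) rmodule).
        fd_right_module K A U \<and> fd_right_module K A V \<longrightarrow>
        (\<forall>g\<in>rmod_hom A U V. \<forall>f\<in>rmod_hom A P V.
           g ` carrier U = carrier V \<longrightarrow>
           (\<exists>h\<in>rmod_hom A P U. compose (carrier P) g h = f)))"

text \<open>
  A resolution \<open>\<dots> \<rightarrow> P 2 \<rightarrow> P 1 \<rightarrow> P 0 \<rightarrow> M \<rightarrow> 0\<close> has differentials \<open>d i : P (i + 1) \<rightarrow> P i\<close> and
  augmentation \<open>e : P 0 \<rightarrow> M\<close>.
\<close>

type_synonym ('k, 'a, 'b) resolution =
  "(nat \<Rightarrow> ('a, 'k list) rmodule) \<times> (nat \<Rightarrow> 'k list \<Rightarrow> 'k list) \<times> ('k list \<Rightarrow> 'b)"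

definition projective_resolution ::
    "('k, 'n) ring_scheme \<Rightarrow> ('k, 'a, 'm) module_scheme \<Rightarrow> ('a, 'b, 'r) rmodule_scheme
      \<Rightarrow> ('k, 'a, 'b) resolution \<Rightarrow> bool" where
  "projective_resolution K A M = (\<lambda>(P, d, e).
     (\<forall>i. projective_rmodule K A (P i)) \<and>
     (\<forall>i. d i \<in> rmod_hom A (P (Suc i)) (P i)) \<and>
     e \<in> rmod_hom A (P 0) M \<and>
     e ` carrier (P 0) = carrier M \<and>
     d 0 ` carrier (P (Suc 0)) = a_kernel (P 0) M e \<and>
     (\<forall>i. d (Suc i) ` carrier (P (Suc (Suc i))) = a_kernel (P (Suc i)) (P i) (d i)))"

text \<open>
  The least length of a projective resolution.  It is \<open>\<infinity>\<close>, the infimum of the empty set, if there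
  is no resolution of finite length.
\<close>

definition projective_dimension ::
    "('k, 'n) ring_scheme \<Rightarrow> ('k, 'a, 'm) module_scheme \<Rightarrow> ('a, 'b, 'r) rmodule_scheme
      \<Rightarrow> enat" where
  "projective_dimension K A M =
     Inf {enat n |n. \<exists>P d e. projective_resolution K A M (P, d, e) \<and>
                             (\<forall>i>n. carrier (P i) = {\<zero>\<^bsub>P i\<^esub>})}"

definition hom_group ::
    "('k, 'a, 'm) module_scheme \<Rightarrow> ('a, 'b, 'r) rmodule_scheme \<Rightarrow> ('a, 'c, 's) rmodule_scheme
      \<Rightarrow> ('b \<Rightarrow> 'c) monoid" where
  "hom_group A M N =
     \<lparr>carrier = rmod_hom A M N,
      mult = (\<lambda>f g. \<lambda>x\<in>carrier M. f x \<oplus>\<^bsub>N\<^esub> g x),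
      one = (\<lambda>x\<in>carrier M. \<zero>\<^bsub>N\<^esub>)\<rparr>"

definition cocycles ::
    "('k, 'a, 'm) module_scheme \<Rightarrow> ('k, 'a, 'b) resolution \<Rightarrow> ('a, 'c, 's) rmodule_scheme \<Rightarrow> nat
      \<Rightarrow> ('k list \<Rightarrow> 'c) set" where
  "cocycles A = (\<lambda>(P, d, e) N n.
     {f \<in> rmod_hom A (P n) N. compose (carrier (P (Suc n))) f (d n) = \<one>\<^bsub>hom_group A (P (Suc n)) N\<^esub>})"

definition coboundaries ::
    "('k, 'a, 'm) module_scheme \<Rightarrow> ('k, 'a, 'b) resolution \<Rightarrow> ('a, 'c, 's) rmodule_scheme \<Rightarrow> nat
      \<Rightarrow> ('k list \<Rightarrow> 'c) set" where
  "coboundaries A = (\<lambda>(P, d, e) N n.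
     case n of
       0 \<Rightarrow> {\<one>\<^bsub>hom_group A (P 0) N\<^esub>}
     | Suc m \<Rightarrow> (\<lambda>g. compose (carrier (P (Suc m))) g (d m)) ` rmod_hom A (P m) N)"

text \<open>
  \<open>Ext\<^sup>n(M, N)\<close> is the \<open>n\<close>-th cohomology group of the complex \<open>Hom(P, N)\<close>, for some chosen
  projective resolution \<open>P\<close> of \<open>M\<close>; a different choice gives an isomorphic group.
\<close>

definition cohomology_group ::
    "('k, 'a, 'm) module_scheme \<Rightarrow> ('k, 'a, 'b) resolution \<Rightarrow> ('a, 'c, 's) rmodule_scheme \<Rightarrow> nat
      \<Rightarrow> ('k list \<Rightarrow> 'c) set monoid" where
  "cohomology_group A R N n =
     (hom_group A (fst R n) N)\<lparr>carrier := cocycles A R N n\<rparr> Mod coboundaries A R N n"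

definition Ext ::
    "('k, 'n) ring_scheme \<Rightarrow> ('k, 'a, 'm) module_scheme \<Rightarrow> nat \<Rightarrow>
      ('a, 'b, 'r) rmodule_scheme \<Rightarrow> ('a, 'c, 's) rmodule_scheme \<Rightarrow> ('k list \<Rightarrow> 'c) set monoid" where
  "Ext K A n M N = cohomology_group A (SOME R. projective_resolution K A M R) N n"

end

(*
  Let D be a K-linear derivation M x A -> M, i.e. an element of Z^1(A, End_K M); it encodes a
  self-extension of M.  If M has a finite projective resolution, then every D(-, a) has trace zero:
  given 0 -> N -> P -> M -> 0 with P projective, lifting P -> M along the extension E -> M encoded
  by D yields an inner derivation of P, whose values are commutators and hence traceless, that
  restricts to a derivation of N and induces D; so the claim for N implies the claim for M.
  (In other words, the character of a module of finite projective dimension does not change under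
  infinitesimal deformation.)

  If S is simple, A acts on S through the full matrix algebra, by Schur and density.  The image
  under D of the annihilator of S is a bimodule over this algebra, so if it were nonzero it would
  contain rank one idempotents, which have trace one.  Hence a traceless D factors through the
  matrix algebra and is therefore inner, which means that the self-extension splits.
*)
theory Submission
  imports Defs
begin

text \<open>Traces have to be computed on syzygies, on extensions and on transported copies of a
  module. A basis does not restrict to a kernel, so traces are taken along a finite family of
  vectors and linear forms that represents the identity; such a family can be pushed through any
  linear retraction. The induction runs along syzygies for the following reason: \<open>D\<close>
  need not be inner on M, but the derivation of P lying over it is, and commutators have trace zero
  in every characteristic. Additivity along 0 -> N -> P -> M -> 0 then makes the trace on M the
  negative of the trace on N. A rank one idempotent is used at the end, and not the identity of S,
  because the trace of the identity is dim S, which may vanish in \<open>K\<close>, while the trace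
  of a rank one idempotent is always one. Algebraic closure enters through eigenvalues: they make
  the endomorphisms of S scalar, so that the image of \<open>A\<close> is the full matrix algebra
  and contains y \<mapsto> l(y) x for suitable forms l and all x.\<close>

section \<open>Sums over lists\<close>

text \<open>Lists rather than \<open>finsum\<close> over sets: the vectors of a dual system may
  repeat, and a fold can be rewritten by \<open>lsum_cong\<close> without any membership in the
  carrier.\<close>

definition lsum :: "('g, 'r) ring_scheme \<Rightarrow> ('i \<Rightarrow> 'g) \<Rightarrow> 'i list \<Rightarrow> 'g" where
  "lsum G f xs = foldr (\<lambda>x s. f x \<oplus>\<^bsub>G\<^esub> s) xs \<zero>\<^bsub>G\<^esub>"

lemma lsum_Nil [simp]: "lsum G f [] = \<zero>\<^bsub>G\<^esub>"
  and lsum_Cons [simp]: "lsum G f (x # xs) = f x \<oplus>\<^bsub>G\<^esub> lsum G f xs"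
  by (simp_all add: lsum_def)

lemma lsum_map [simp]: "lsum G f (map g xs) = lsum G (f \<circ> g) xs"
  by (induction xs) auto

lemma lsum_cong:
  assumes "\<And>x. x \<in> set xs \<Longrightarrow> f x = g x"
  shows "lsum G f xs = lsum G g xs"
  using assms by (induction xs) auto

lemma lsum_update_carrier [simp]: "lsum (G\<lparr>carrier := N\<rparr>) f xs = lsum G f xs"
  by (induction xs) auto

context abelian_monoid
begin

lemma lsum_closed:
  assumes "\<And>x. x \<in> set xs \<Longrightarrow> f x \<in> carrier G"
  shows "lsum G f xs \<in> carrier G"
  using assms by (induction xs) auto

lemma lsum_append:
  assumes "\<And>x. x \<in> set xs \<union> set ys \<Longrightarrow> f x \<in> carrier G"
  shows "lsum G f (xs @ ys) = lsum G f xs \<oplus> lsum G f ys"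
  using assms by (induction xs) (auto simp: a_assoc lsum_closed)

lemma lsum_zero:
  assumes "\<And>x. x \<in> set xs \<Longrightarrow> f x = \<zero>"
  shows "lsum G f xs = \<zero>"
  using assms by (induction xs) auto

lemma lsum_add:
  assumes "\<And>x. x \<in> set xs \<Longrightarrow> f x \<in> carrier G" "\<And>x. x \<in> set xs \<Longrightarrow> g x \<in> carrier G"
  shows "lsum G (\<lambda>x. f x \<oplus> g x) xs = lsum G f xs \<oplus> lsum G g xs"
  using assms
proof (induction xs)
  case (Cons x xs)
  then have "f x \<in> carrier G" "g x \<in> carrier G" "lsum G f xs \<in> carrier G" "lsum G g xs \<in> carrier G"
    by (auto simp: lsum_closed)
  with Cons show ?case
    by (simp add: a_ac)
qed simp

lemma lsum_swap:
  assumes "\<And>x y. x \<in> set xs \<Longrightarrow> y \<in> set ys \<Longrightarrow> F x y \<in> carrier G"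
  shows "lsum G (\<lambda>x. lsum G (F x) ys) xs = lsum G (\<lambda>y. lsum G (\<lambda>x. F x y) xs) ys"
  using assms
proof (induction xs)
  case Nil
  show ?case by (simp add: lsum_zero)
next
  case (Cons x xs)
  have "lsum G (\<lambda>y. F x y \<oplus> lsum G (\<lambda>x. F x y) xs) ys
      = lsum G (F x) ys \<oplus> lsum G (\<lambda>y. lsum G (\<lambda>x. F x y) xs) ys"
    using Cons.prems by (intro lsum_add) (auto intro!: lsum_closed)
  with Cons show ?case by simp
qed

lemma finsum_set_eq_lsum:
  assumes "distinct xs" "\<And>x. x \<in> set xs \<Longrightarrow> f x \<in> carrier G"
  shows "finsum G f (set xs) = lsum G f xs"
  using assms by (induction xs) (auto simp: finsum_insert Pi_def)

end

lemma additive_lsum: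
  assumes "abelian_monoid G"
    and "h \<zero>\<^bsub>G\<^esub> = \<zero>\<^bsub>H\<^esub>"
    and "\<And>x y. x \<in> carrier G \<Longrightarrow> y \<in> carrier G \<Longrightarrow> h (x \<oplus>\<^bsub>G\<^esub> y) = h x \<oplus>\<^bsub>H\<^esub> h y"
    and "\<And>x. x \<in> set xs \<Longrightarrow> f x \<in> carrier G"
  shows "h (lsum G f xs) = lsum H (\<lambda>x. h (f x)) xs"
  using assms(4) by (induction xs) (auto simp: assms abelian_monoid.lsum_closed)

section \<open>Linear maps between right modules\<close>

text \<open>The \<open>smult\<close> of \<open>underlying_space A M\<close> as a function of the
  module. Since scalars act through elements of \<open>A\<close>, every homomorphism of right
  modules is linear.\<close>

definition scal ::
    "('k, 'a, 'm) module_scheme \<Rightarrow> ('a, 'b, 'r) rmodule_scheme \<Rightarrow> 'k \<Rightarrow> 'b \<Rightarrow> 'b" where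
  "scal A M c x = x \<lhd>\<^bsub>M\<^esub> (c \<odot>\<^bsub>A\<^esub> \<one>\<^bsub>A\<^esub>)"

text \<open>Unlike \<open>rmod_hom\<close>, not extensional: composites and differences can then be
  written as plain lambda terms.\<close>

definition linear_maps ::
    "('k, 'n) ring_scheme \<Rightarrow> ('k, 'a, 'm) module_scheme \<Rightarrow> ('a, 'b, 'r) rmodule_scheme
      \<Rightarrow> ('a, 'c, 's) rmodule_scheme \<Rightarrow> ('b \<Rightarrow> 'c) set" where
  "linear_maps K A M N =
     {f \<in> carrier M \<rightarrow> carrier N.
        (\<forall>x\<in>carrier M. \<forall>y\<in>carrier M. f (x \<oplus>\<^bsub>M\<^esub> y) = f x \<oplus>\<^bsub>N\<^esub> f y) \<and>
        (\<forall>c\<in>carrier K. \<forall>x\<in>carrier M. f (scal A M c x) = scal A N c (f x))}"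

definition linear_forms ::
    "('k, 'n) ring_scheme \<Rightarrow> ('k, 'a, 'm) module_scheme \<Rightarrow> ('a, 'b, 'r) rmodule_scheme
      \<Rightarrow> ('b \<Rightarrow> 'k) set" where
  "linear_forms K A M =
     {l \<in> carrier M \<rightarrow> carrier K.
        (\<forall>x\<in>carrier M. \<forall>y\<in>carrier M. l (x \<oplus>\<^bsub>M\<^esub> y) = l x \<oplus>\<^bsub>K\<^esub> l y) \<and>
        (\<forall>c\<in>carrier K. \<forall>x\<in>carrier M. l (scal A M c x) = c \<otimes>\<^bsub>K\<^esub> l x)}"

lemma linear_mapsI:
  assumes "\<And>x. x \<in> carrier M \<Longrightarrow> f x \<in> carrier N"
    and "\<And>x y. x \<in> carrier M \<Longrightarrow> y \<in> carrier M \<Longrightarrow> f (x \<oplus>\<^bsub>M\<^esub> y) = f x \<oplus>\<^bsub>N\<^esub> f y"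
    and "\<And>c x. c \<in> carrier K \<Longrightarrow> x \<in> carrier M \<Longrightarrow> f (scal A M c x) = scal A N c (f x)"
  shows "f \<in> linear_maps K A M N"
  using assms by (auto simp: linear_maps_def)

lemma linear_mapsD:
  assumes "f \<in> linear_maps K A M N"
  shows "\<And>x. x \<in> carrier M \<Longrightarrow> f x \<in> carrier N"
    and "\<And>x y. x \<in> carrier M \<Longrightarrow> y \<in> carrier M \<Longrightarrow> f (x \<oplus>\<^bsub>M\<^esub> y) = f x \<oplus>\<^bsub>N\<^esub> f y"
    and "\<And>c x. c \<in> carrier K \<Longrightarrow> x \<in> carrier M \<Longrightarrow> f (scal A M c x) = scal A N c (f x)"
  using assms by (auto simp: linear_maps_def)

lemma linear_formsI:
  assumes "\<And>x. x \<in> carrier M \<Longrightarrow> l x \<in> carrier K"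
    and "\<And>x y. x \<in> carrier M \<Longrightarrow> y \<in> carrier M \<Longrightarrow> l (x \<oplus>\<^bsub>M\<^esub> y) = l x \<oplus>\<^bsub>K\<^esub> l y"
    and "\<And>c x. c \<in> carrier K \<Longrightarrow> x \<in> carrier M \<Longrightarrow> l (scal A M c x) = c \<otimes>\<^bsub>K\<^esub> l x"
  shows "l \<in> linear_forms K A M"
  using assms by (auto simp: linear_forms_def)

lemma linear_formsD:
  assumes "l \<in> linear_forms K A M"
  shows "\<And>x. x \<in> carrier M \<Longrightarrow> l x \<in> carrier K"
    and "\<And>x y. x \<in> carrier M \<Longrightarrow> y \<in> carrier M \<Longrightarrow> l (x \<oplus>\<^bsub>M\<^esub> y) = l x \<oplus>\<^bsub>K\<^esub> l y"
    and "\<And>c x. c \<in> carrier K \<Longrightarrow> x \<in> carrier M \<Longrightarrow> l (scal A M c x) = c \<otimes>\<^bsub>K\<^esub> l x"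
  using assms by (auto simp: linear_forms_def)

lemma additive_zero:
  assumes "abelian_group M" "abelian_group N" "h \<in> carrier M \<rightarrow> carrier N"
    and "\<And>x y. x \<in> carrier M \<Longrightarrow> y \<in> carrier M \<Longrightarrow> h (x \<oplus>\<^bsub>M\<^esub> y) = h x \<oplus>\<^bsub>N\<^esub> h y"
  shows "h \<zero>\<^bsub>M\<^esub> = \<zero>\<^bsub>N\<^esub>"
proof -
  interpret M: abelian_group M by fact
  interpret N: abelian_group N by fact
  have z: "h \<zero>\<^bsub>M\<^esub> \<in> carrier N" using assms(3) by auto
  have "h \<zero>\<^bsub>M\<^esub> \<oplus>\<^bsub>N\<^esub> h \<zero>\<^bsub>M\<^esub> = h \<zero>\<^bsub>M\<^esub>"
    using assms(4)[of "\<zero>\<^bsub>M\<^esub>" "\<zero>\<^bsub>M\<^esub>"] by simp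
  with z show ?thesis by simp
qed

lemma additive_minus:
  assumes "abelian_group M" "abelian_group N" "h \<in> carrier M \<rightarrow> carrier N"
    and "\<And>x y. x \<in> carrier M \<Longrightarrow> y \<in> carrier M \<Longrightarrow> h (x \<oplus>\<^bsub>M\<^esub> y) = h x \<oplus>\<^bsub>N\<^esub> h y"
    and "x \<in> carrier M" "y \<in> carrier M"
  shows "h (x \<ominus>\<^bsub>M\<^esub> y) = h x \<ominus>\<^bsub>N\<^esub> h y"
proof -
  interpret M: abelian_group M by fact
  interpret N: abelian_group N by fact
  have hxy: "h x \<in> carrier N" "h y \<in> carrier N" "h (\<ominus>\<^bsub>M\<^esub> y) \<in> carrier N" using assms by auto
  have "h (\<ominus>\<^bsub>M\<^esub> y) \<oplus>\<^bsub>N\<^esub> h y = \<zero>\<^bsub>N\<^esub>"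
    using assms(4)[of "\<ominus>\<^bsub>M\<^esub> y" y] assms(6) additive_zero[OF assms(1-4)] by (simp add: M.l_neg)
  then have "h (\<ominus>\<^bsub>M\<^esub> y) = \<ominus>\<^bsub>N\<^esub> h y"
    using hxy by (simp add: N.minus_equality)
  then show ?thesis
    using assms(4)[of x "\<ominus>\<^bsub>M\<^esub> y"] assms(5,6) by (simp add: a_minus_def)
qed

lemma (in right_module) zero_ract: 
  assumes "a \<in> carrier A" shows "\<zero>\<^bsub>M\<^esub> \<lhd>\<^bsub>M\<^esub> a = \<zero>\<^bsub>M\<^esub>"
  using additive_zero[OF M.abelian_group_axioms M.abelian_group_axioms, of "\<lambda>x. x \<lhd>\<^bsub>M\<^esub> a"] assms
  by (simp add: add_ract ract_closed Pi_def)

lemma (in right_module) minus_ract: 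
  assumes "x \<in> carrier M" "y \<in> carrier M" "a \<in> carrier A" 
  shows "(x \<ominus>\<^bsub>M\<^esub> y) \<lhd>\<^bsub>M\<^esub> a = (x \<lhd>\<^bsub>M\<^esub> a) \<ominus>\<^bsub>M\<^esub> (y \<lhd>\<^bsub>M\<^esub> a)"
  using additive_minus[OF M.abelian_group_axioms M.abelian_group_axioms, of "\<lambda>x. x \<lhd>\<^bsub>M\<^esub> a"] assms
  by (simp add: add_ract ract_closed Pi_def)

context fd_algebra
begin

lemma smult_one_commute:
  assumes "c \<in> carrier K" "a \<in> carrier A"
  shows "(c \<odot>\<^bsub>A\<^esub> \<one>\<^bsub>A\<^esub>) \<otimes>\<^bsub>A\<^esub> a = a \<otimes>\<^bsub>A\<^esub> (c \<odot>\<^bsub>A\<^esub> \<one>\<^bsub>A\<^esub>)"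
  using assms by (simp add: smult_mult_left smult_mult_right)

context
  fixes M :: "('c, 'e, 'r) rmodule_scheme"
  assumes M: "right_module A M"
begin

interpretation M: right_module A M by (fact M)

lemma scal_closed: "c \<in> carrier K \<Longrightarrow> x \<in> carrier M \<Longrightarrow> scal A M c x \<in> carrier M"
  by (simp add: scal_def M.ract_closed)

lemma scal_add:
  "c \<in> carrier K \<Longrightarrow> x \<in> carrier M \<Longrightarrow> y \<in> carrier M
    \<Longrightarrow> scal A M c (x \<oplus>\<^bsub>M\<^esub> y) = scal A M c x \<oplus>\<^bsub>M\<^esub> scal A M c y"
  by (simp add: scal_def M.add_ract)

lemma add_scal:
  "c \<in> carrier K \<Longrightarrow> d \<in> carrier K \<Longrightarrow> x \<in> carrier M
    \<Longrightarrow> scal A M (c \<oplus>\<^bsub>K\<^esub> d) x = scal A M c x \<oplus>\<^bsub>M\<^esub> scal A M d x"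
  by (simp add: scal_def M.ract_add space.smult_l_distr)

lemma scal_mult:
  assumes "c \<in> carrier K" "d \<in> carrier K" "x \<in> carrier M"
  shows "scal A M (c \<otimes>\<^bsub>K\<^esub> d) x = scal A M c (scal A M d x)"
proof -
  \<comment> \<open>Acting on the right by d and then by c multiplies in the order d, c;
    commutativity of \<open>K\<close> restores the order c, d.\<close>
  have "(d \<odot>\<^bsub>A\<^esub> \<one>\<^bsub>A\<^esub>) \<otimes>\<^bsub>A\<^esub> (c \<odot>\<^bsub>A\<^esub> \<one>\<^bsub>A\<^esub>) = (d \<otimes>\<^bsub>K\<^esub> c) \<odot>\<^bsub>A\<^esub> \<one>\<^bsub>A\<^esub>"
    using assms by (simp add: smult_mult_left space.smult_assoc1)
  then show ?thesis
    using assms by (simp add: scal_def space.m_comm flip: M.ract_mult)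
qed

lemma scal_one: "x \<in> carrier M \<Longrightarrow> scal A M \<one>\<^bsub>K\<^esub> x = x"
  by (simp add: scal_def M.ract_one)

lemma scal_zero: "x \<in> carrier M \<Longrightarrow> scal A M \<zero>\<^bsub>K\<^esub> x = \<zero>\<^bsub>M\<^esub>"
  using additive_zero[OF space.R.abelian_group_axioms M.M.abelian_group_axioms, of "\<lambda>c. scal A M c x"]
  by (simp add: add_scal scal_closed Pi_def)

lemma scal_zero_right: "c \<in> carrier K \<Longrightarrow> scal A M c \<zero>\<^bsub>M\<^esub> = \<zero>\<^bsub>M\<^esub>"
  by (simp add: scal_def M.zero_ract)

text \<open>Scalar multiples of the one are central in \<open>A\<close>.\<close>

lemma scal_ract:
  assumes "c \<in> carrier K" "a \<in> carrier A" "x \<in> carrier M"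
  shows "scal A M c x \<lhd>\<^bsub>M\<^esub> a = scal A M c (x \<lhd>\<^bsub>M\<^esub> a)"
  using assms smult_one_commute[of c a] by (simp add: scal_def flip: M.ract_mult)

lemma ract_linear: "a \<in> carrier A \<Longrightarrow> (\<lambda>x. x \<lhd>\<^bsub>M\<^esub> a) \<in> linear_maps K A M M"
  by (intro linear_mapsI) (simp_all add: M.ract_closed M.add_ract scal_ract)

end

lemma linear_maps_zero:
  assumes "right_module A M" "right_module A N" "f \<in> linear_maps K A M N"
  shows "f \<zero>\<^bsub>M\<^esub> = \<zero>\<^bsub>N\<^esub>"
proof -
  interpret M: right_module A M by fact
  interpret N: right_module A N by fact
  show ?thesis
    using linear_mapsD[OF assms(3)]
    by (intro additive_zero[OF M.M.abelian_group_axioms N.M.abelian_group_axioms]) auto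
qed

lemma linear_forms_zero:
  assumes "right_module A M" "l \<in> linear_forms K A M"
  shows "l \<zero>\<^bsub>M\<^esub> = \<zero>\<^bsub>K\<^esub>"
proof -
  interpret M: right_module A M by fact
  show ?thesis
    using linear_formsD[OF assms(2)]
    by (intro additive_zero[OF M.M.abelian_group_axioms space.R.abelian_group_axioms]) auto
qed

lemma linear_forms_comp:
  "f \<in> linear_maps K A M N \<Longrightarrow> l \<in> linear_forms K A N \<Longrightarrow> (\<lambda>x. l (f x)) \<in> linear_forms K A M"
  by (intro linear_formsI) (simp_all add: linear_mapsD linear_formsD)

lemma linear_maps_comp:
  "f \<in> linear_maps K A M N \<Longrightarrow> g \<in> linear_maps K A N L \<Longrightarrow> (\<lambda>x. g (f x)) \<in> linear_maps K A M L"
  by (intro linear_mapsI) (simp_all add: linear_mapsD)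

section \<open>Dual systems and traces\<close>

text \<open>The vectors of a dual system need not be linearly independent.\<close>

definition dual_system :: "('c, 'e, 'r) rmodule_scheme \<Rightarrow> ('e \<times> ('e \<Rightarrow> 'a)) list \<Rightarrow> bool" where
  "dual_system M \<beta> \<longleftrightarrow>
     (\<forall>p\<in>set \<beta>. fst p \<in> carrier M \<and> snd p \<in> linear_forms K A M) \<and>
     (\<forall>x\<in>carrier M. lsum M (\<lambda>p. scal A M (snd p x) (fst p)) \<beta> = x)"

text \<open>The vectors and forms of \<beta> sum up to the identity in the tensor product of the
  dual space with M; applying \<open>T\<close> to the vectors and evaluating the forms gives the
  trace of \<open>T\<close>.\<close>

definition dual_trace :: "('e \<times> ('e \<Rightarrow> 'a)) list \<Rightarrow> ('e \<Rightarrow> 'e) \<Rightarrow> 'a" where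
  "dual_trace \<beta> T = lsum K (\<lambda>p. snd p (T (fst p))) \<beta>"

lemma dual_systemD:
  assumes "dual_system M \<beta>"
  shows "\<And>p. p \<in> set \<beta> \<Longrightarrow> fst p \<in> carrier M"
    and "\<And>p. p \<in> set \<beta> \<Longrightarrow> snd p \<in> linear_forms K A M"
    and "\<And>p x. p \<in> set \<beta> \<Longrightarrow> x \<in> carrier M \<Longrightarrow> snd p x \<in> carrier K"
    and "\<And>x. x \<in> carrier M \<Longrightarrow> lsum M (\<lambda>p. scal A M (snd p x) (fst p)) \<beta> = x"
  using assms by (auto simp: dual_system_def intro: linear_formsD)

lemma linear_form_expand:
  assumes M: "right_module A M" and \<beta>: "dual_system M \<beta>" and l: "l \<in> linear_forms K A M"
    and x: "x \<in> carrier M"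
  shows "l x = lsum K (\<lambda>p. snd p x \<otimes>\<^bsub>K\<^esub> l (fst p)) \<beta>"
proof -
  interpret M: right_module A M by fact
  have "l x = l (lsum M (\<lambda>p. scal A M (snd p x) (fst p)) \<beta>)"
    using \<beta> x by (simp add: dual_systemD)
  also have "\<dots> = lsum K (\<lambda>p. l (scal A M (snd p x) (fst p))) \<beta>"
    using \<beta> x
    by (intro additive_lsum)
       (auto simp: linear_forms_zero[OF M l] linear_formsD[OF l] scal_closed[OF M] dual_systemD
         intro: M.M.abelian_monoid_axioms)
  also have "\<dots> = lsum K (\<lambda>p. snd p x \<otimes>\<^bsub>K\<^esub> l (fst p)) \<beta>"
    using \<beta> x by (intro lsum_cong) (auto simp: linear_formsD[OF l] dual_systemD)
  finally show ?thesis .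
qed

lemma linear_map_expand:
  assumes M: "right_module A M" and N: "right_module A N" and \<beta>: "dual_system M \<beta>"
    and f: "f \<in> linear_maps K A M N" and x: "x \<in> carrier M"
  shows "f x = lsum N (\<lambda>p. scal A N (snd p x) (f (fst p))) \<beta>"
proof -
  interpret M: right_module A M by fact
  have "f x = f (lsum M (\<lambda>p. scal A M (snd p x) (fst p)) \<beta>)"
    using \<beta> x by (simp add: dual_systemD)
  also have "\<dots> = lsum N (\<lambda>p. f (scal A M (snd p x) (fst p))) \<beta>"
    using \<beta> x
    by (intro additive_lsum)
       (auto simp: linear_maps_zero[OF M N f] linear_mapsD[OF f] scal_closed[OF M] dual_systemD
         intro: M.M.abelian_monoid_axioms)
  also have "\<dots> = lsum N (\<lambda>p. scal A N (snd p x) (f (fst p))) \<beta>"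
    using \<beta> x by (intro lsum_cong) (auto simp: linear_mapsD[OF f] dual_systemD)
  finally show ?thesis .
qed

text \<open>Expanding each form of \<beta> composed with \<open>S\<close> along \<gamma> gives a
  double sum that is symmetric up to the order of summation and of factors. With N = M and
  \<open>S\<close> the identity this yields independence of the dual system; with \<beta> = \<gamma>
  it says that commutators have trace zero.\<close>

lemma dual_trace_cyclic:
  assumes M: "right_module A M" and N: "right_module A N"
    and \<beta>: "dual_system M \<beta>" and \<gamma>: "dual_system N \<gamma>"
    and S: "S \<in> linear_maps K A N M" and T: "T \<in> linear_maps K A M N"
  shows "dual_trace \<beta> (\<lambda>x. S (T x)) = dual_trace \<gamma> (\<lambda>y. T (S y))"
proof -
  have "dual_trace \<beta> (\<lambda>x. S (T x))
      = lsum K (\<lambda>p. lsum K (\<lambda>q. snd q (T (fst p)) \<otimes>\<^bsub>K\<^esub> snd p (S (fst q))) \<gamma>) \<beta>"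
    unfolding dual_trace_def
    using \<beta> T by (intro lsum_cong linear_form_expand[OF N \<gamma>] linear_forms_comp[OF S])
      (auto simp: dual_systemD linear_mapsD)
  also have "\<dots> = lsum K (\<lambda>q. lsum K (\<lambda>p. snd q (T (fst p)) \<otimes>\<^bsub>K\<^esub> snd p (S (fst q))) \<beta>) \<gamma>"
    using \<beta> \<gamma> S T by (intro space.R.lsum_swap) (auto simp: dual_systemD linear_mapsD)
  also have "\<dots> = lsum K (\<lambda>q. lsum K (\<lambda>p. snd p (S (fst q)) \<otimes>\<^bsub>K\<^esub> snd q (T (fst p))) \<beta>) \<gamma>"
    using \<beta> \<gamma> S T by (intro lsum_cong space.R.m_comm) (auto simp: dual_systemD linear_mapsD)
  also have "\<dots> = dual_trace \<gamma> (\<lambda>y. T (S y))"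
    unfolding dual_trace_def
    using \<gamma> S by (intro lsum_cong linear_form_expand[OF M \<beta>, symmetric] linear_forms_comp[OF T])
      (auto simp: dual_systemD linear_mapsD)
  finally show ?thesis .
qed

end

section \<open>Dual systems and finite dimension\<close>

lemma (in abelian_group) abelian_group_same_structure:
  assumes "carrier H = carrier G" "add H = add G" "zero H = zero G"
  shows "abelian_group H"
proof (rule abelian_groupI)
  show "\<exists>y\<in>carrier H. y \<oplus>\<^bsub>H\<^esub> x = \<zero>\<^bsub>H\<^esub>" if "x \<in> carrier H" for x
    using that assms by (intro bexI[of _ "\<ominus> x"]) (auto simp: l_neg)
qed (use assms in \<open>auto simp: a_ac\<close>)

lemma lsum_same_structure:
  assumes "add H = add G" "zero H = zero G"
  shows "lsum H f xs = lsum G f xs"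
  using assms by (induction xs) auto

context fd_algebra
begin

lemma vectorspace_underlying_space:
  assumes M: "right_module A M"
  shows "vectorspace K (underlying_space A M)"
proof -
  interpret M: right_module A M by fact
  have "abelian_group (underlying_space A M)"
    by (rule M.M.abelian_group_same_structure) (simp_all add: underlying_space_def)
  moreover have sc: "c \<odot>\<^bsub>underlying_space A M\<^esub> x = scal A M c x" for c x
    by (simp add: underlying_space_def scal_def)
  have "module_axioms K (underlying_space A M)"
    unfolding module_axioms_def sc
    by (auto simp: underlying_space_def scal_closed[OF M] scal_add[OF M] add_scal[OF M]
        scal_mult[OF M] scal_one[OF M])
  ultimately show ?thesis
    by (intro vectorspace.intro Module.module.intro space.R.cring_axioms space.field_axioms)
qed

lemma underlying_space_sel [simp]:
  "carrier (underlying_space A M) = carrier M"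
  "add (underlying_space A M) = add M"
  "zero (underlying_space A M) = zero M"
  "c \<odot>\<^bsub>underlying_space A M\<^esub> x = scal A M c x"
  by (simp_all add: underlying_space_def scal_def)

lemma lsum_underlying_space [simp]: "lsum (underlying_space A M) f xs = lsum M f xs"
  by (rule lsum_same_structure) simp_all

text \<open>A basis together with its coordinate functions, whose linearity follows from the
  uniqueness of coordinates.\<close>

lemma dual_system_exists:
  assumes "fd_right_module K A M"
  shows "\<exists>\<beta>. dual_system M \<beta>"
proof -
  have M: "right_module A M" and fin: "vectorspace.fin_dim K (underlying_space A M)"
    using assms by (auto simp: fd_right_module_def)
  interpret M: right_module A M by fact
  interpret V: vectorspace K "underlying_space A M" by (rule vectorspace_underlying_space[OF M])
  obtain B where B: "finite B" "V.basis B" using V.finite_basis_exists[OF fin] by blast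
  have BM: "B \<subseteq> carrier M" using B by (auto simp: V.basis_def)
  obtain xs where xs: "set xs = B" "distinct xs" using B(1) finite_distinct_list by blast
  have "\<forall>v\<in>carrier M. \<exists>!a. a \<in> B \<rightarrow>\<^sub>E carrier K \<and> V.lincomb a B = v"
    using V.basis_criterion[OF B(1)] B(2) BM by simp
  then obtain a where a: "\<And>v. v \<in> carrier M \<Longrightarrow> a v \<in> B \<rightarrow>\<^sub>E carrier K \<and> V.lincomb (a v) B = v"
    and uniq: "\<And>v c. v \<in> carrier M \<Longrightarrow> c \<in> B \<rightarrow>\<^sub>E carrier K \<Longrightarrow> V.lincomb c B = v \<Longrightarrow> c = a v"
    by metis
  have lc: "V.lincomb c B = lsum M (\<lambda>b. scal A M (c b) b) xs" if "c \<in> B \<rightarrow> carrier K" for c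
    using that BM xs V.finsum_set_eq_lsum[of xs "\<lambda>b. scal A M (c b) b"]
    by (auto simp: V.lincomb_def intro: scal_closed[OF M])
  have av: "a v b \<in> carrier K" if "v \<in> carrier M" "b \<in> B" for v b
    using a[OF that(1)] that(2) by auto
  have expand: "lsum M (\<lambda>b. scal A M (a v b) b) xs = v" if "v \<in> carrier M" for v
    using a[OF that] lc[of "a v"] by (auto simp: PiE_iff)
  \<comment> \<open>\<open>uniq\<close> speaks of extensional functions only; restricting
    \<open>c\<close> to \<open>B\<close> extends uniqueness to all coefficient functions.\<close>
  have coord: "c b = a v b"
    if "v \<in> carrier M" "\<And>b. b \<in> B \<Longrightarrow> c b \<in> carrier K" "b \<in> B"
       "lsum M (\<lambda>b. scal A M (c b) b) xs = v" for v c b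
  proof -
    have "lsum M (\<lambda>b. scal A M (restrict c B b) b) xs = v"
      using that(4) xs(1) by (subst lsum_cong[where g = "\<lambda>b. scal A M (c b) b"]) auto
    then have "restrict c B = a v"
      using that by (intro uniq) (auto simp: lc)
    then show ?thesis using that(3) by (metis restrict_apply')
  qed
  have "(\<lambda>v. a v b) \<in> linear_forms K A M" if b: "b \<in> B" for b
  proof (rule linear_formsI)
    fix x y assume xy: "x \<in> carrier M" "y \<in> carrier M"
    have "lsum M (\<lambda>b. scal A M (a x b \<oplus>\<^bsub>K\<^esub> a y b) b) xs
        = lsum M (\<lambda>b. scal A M (a x b) b \<oplus>\<^bsub>M\<^esub> scal A M (a y b) b) xs"
      using xy BM xs by (intro lsum_cong) (auto simp: add_scal[OF M] av)
    also have "\<dots> = x \<oplus>\<^bsub>M\<^esub> y"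
      using xy BM xs by (subst M.M.lsum_add) (auto simp: expand intro!: scal_closed[OF M] av)
    finally show "a (x \<oplus>\<^bsub>M\<^esub> y) b = a x b \<oplus>\<^bsub>K\<^esub> a y b"
      using xy b by (intro coord[symmetric]) (auto simp: av)
  next
    fix c x assume c: "c \<in> carrier K" and x: "x \<in> carrier M"
    have "lsum M (\<lambda>b. scal A M (c \<otimes>\<^bsub>K\<^esub> a x b) b) xs = lsum M (\<lambda>b. scal A M c (scal A M (a x b) b)) xs"
      using c x BM xs by (intro lsum_cong) (auto simp: scal_mult[OF M] av)
    also have "\<dots> = scal A M c (lsum M (\<lambda>b. scal A M (a x b) b) xs)"
      using c x BM xs
      by (intro additive_lsum[symmetric])
         (auto simp: scal_zero_right[OF M] scal_add[OF M] intro: M.M.abelian_monoid_axioms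
           intro!: scal_closed[OF M] av)
    finally show "a (scal A M c x) b = c \<otimes>\<^bsub>K\<^esub> a x b"
      using c x b by (intro coord[symmetric]) (auto simp: av expand scal_closed[OF M])
  qed (use b av in auto)
  then have "dual_system M (map (\<lambda>b. (b, \<lambda>v. a v b)) xs)"
    using BM xs by (auto simp: dual_system_def comp_def expand)
  then show ?thesis by blast
qed

text \<open>The vectors of a dual system span. This is how transported modules are seen to be finite
  dimensional, as the definition of projectivity demands of its test modules.\<close>

lemma dual_system_imp_fd:
  assumes M: "right_module A M" and \<beta>: "dual_system M \<beta>"
  shows "fd_right_module K A M"
proof -
  interpret M: right_module A M by fact
  interpret V: vectorspace K "underlying_space A M" by (rule vectorspace_underlying_space[OF M])
  let ?B = "fst ` set \<beta>"
  have B: "?B \<subseteq> carrier M" using dual_systemD(1)[OF \<beta>] by blast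
  interpret sp: submodule K "V.span ?B" "underlying_space A M"
    using B by (intro V.span_is_submodule) simp
  have inB: "fst p \<in> V.span ?B" if "p \<in> set \<beta>" for p
    using V.in_own_span[of ?B] B that by auto
  have "lsum M (\<lambda>p. scal A M (snd p x) (fst p)) ps \<in> V.span ?B"
    if "x \<in> carrier M" "set ps \<subseteq> set \<beta>" for x ps
    using that(2)
  proof (induction ps)
    case Nil
    show ?case using sp.zero_closed by simp
  next
    case (Cons p ps)
    have "scal A M (snd p x) (fst p) \<in> V.span ?B"
      using sp.smult_closed[of "snd p x" "fst p"] Cons.prems inB dual_systemD(3)[OF \<beta> _ that(1)] by auto
    then show ?case
      using Cons sp.m_closed by simp
  qed
  from this[OF _ order_refl] have "carrier M \<subseteq> V.span ?B"
    using dual_systemD(4)[OF \<beta>] by auto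
  then have "V.fin_dim"
    unfolding V.fin_dim_def using B sp.subset by (intro exI[of _ ?B]) auto
  with M show ?thesis by (simp add: fd_right_module_def)
qed

end

section \<open>Lifting along surjections of modules on arbitrary types\<close>

lemma rmod_homI:
  assumes "f \<in> extensional (carrier M)"
    and "\<And>x. x \<in> carrier M \<Longrightarrow> f x \<in> carrier N"
    and "\<And>x y. x \<in> carrier M \<Longrightarrow> y \<in> carrier M \<Longrightarrow> f (x \<oplus>\<^bsub>M\<^esub> y) = f x \<oplus>\<^bsub>N\<^esub> f y"
    and "\<And>x a. x \<in> carrier M \<Longrightarrow> a \<in> carrier A \<Longrightarrow> f (x \<lhd>\<^bsub>M\<^esub> a) = f x \<lhd>\<^bsub>N\<^esub> a"
  shows "f \<in> rmod_hom A M N"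
  using assms by (auto simp: rmod_hom_def hom_def)

lemma rmod_homD:
  assumes "f \<in> rmod_hom A M N"
  shows "f \<in> extensional (carrier M)"
    and "\<And>x. x \<in> carrier M \<Longrightarrow> f x \<in> carrier N"
    and "\<And>x y. x \<in> carrier M \<Longrightarrow> y \<in> carrier M \<Longrightarrow> f (x \<oplus>\<^bsub>M\<^esub> y) = f x \<oplus>\<^bsub>N\<^esub> f y"
    and "\<And>x a. x \<in> carrier M \<Longrightarrow> a \<in> carrier A \<Longrightarrow> f (x \<lhd>\<^bsub>M\<^esub> a) = f x \<lhd>\<^bsub>N\<^esub> a"
  using assms by (auto simp: rmod_hom_def hom_def)

text \<open>Transport of structure along a map that is meant to be injective on the carrier; it
  moves a module on any type to one on lists of scalars.\<close>

definition image_rmodule :: "('a, 'b, 'r) rmodule_scheme \<Rightarrow> ('b \<Rightarrow> 'c) \<Rightarrow> ('a, 'c) rmodule" where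
  "image_rmodule M \<phi> =
     (let \<psi> = inv_into (carrier M) \<phi> in
      \<lparr>carrier = \<phi> ` carrier M, mult = (\<lambda>u v. undefined), one = undefined, zero = \<phi> \<zero>\<^bsub>M\<^esub>,
       add = (\<lambda>u v. \<phi> (\<psi> u \<oplus>\<^bsub>M\<^esub> \<psi> v)), ract = (\<lambda>u a. \<phi> (\<psi> u \<lhd>\<^bsub>M\<^esub> a))\<rparr>)"

lemma image_rmodule_sel [simp]:
  "carrier (image_rmodule M \<phi>) = \<phi> ` carrier M"
  "\<zero>\<^bsub>image_rmodule M \<phi>\<^esub> = \<phi> \<zero>\<^bsub>M\<^esub>"
  "u \<oplus>\<^bsub>image_rmodule M \<phi>\<^esub> v = \<phi> (inv_into (carrier M) \<phi> u \<oplus>\<^bsub>M\<^esub> inv_into (carrier M) \<phi> v)"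
  "u \<lhd>\<^bsub>image_rmodule M \<phi>\<^esub> a = \<phi> (inv_into (carrier M) \<phi> u \<lhd>\<^bsub>M\<^esub> a)"
  by (simp_all add: image_rmodule_def Let_def)

lemma right_module_image_rmodule:
  assumes "right_module A M" and [simp]: "inj_on \<phi> (carrier M)"
  shows "right_module A (image_rmodule M \<phi>)"
proof -
  interpret M: right_module A M by fact
  have "abelian_group (image_rmodule M \<phi>)"
  proof (rule abelian_groupI)
    fix u assume "u \<in> carrier (image_rmodule M \<phi>)"
    then obtain x where "x \<in> carrier M" "u = \<phi> x" by auto
    then show "\<exists>v\<in>carrier (image_rmodule M \<phi>). v \<oplus>\<^bsub>image_rmodule M \<phi>\<^esub> u = \<zero>\<^bsub>image_rmodule M \<phi>\<^esub>"
      by (intro bexI[of _ "\<phi> (\<ominus>\<^bsub>M\<^esub> x)"]) (auto simp: M.M.l_neg)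
  qed (auto simp: M.M.a_ac)
  moreover have "right_module_axioms A (image_rmodule M \<phi>)"
    by (auto simp: right_module_axioms_def M.ract_closed M.ract_add M.add_ract M.ract_mult M.ract_one)
  ultimately show ?thesis
    by (intro right_module.intro M.A.ring_axioms)
qed

context fd_algebra
begin

lemma dual_system_image_rmodule:
  assumes M: "right_module A M" and \<beta>: "dual_system M \<beta>" and inj [simp]: "inj_on \<phi> (carrier M)"
  shows "dual_system (image_rmodule M \<phi>)
    (map (\<lambda>p. (\<phi> (fst p), \<lambda>u. snd p (inv_into (carrier M) \<phi> u))) \<beta>)"
proof -
  interpret M: right_module A M by fact
  let ?N = "image_rmodule M \<phi>"
  have N: "right_module A ?N" by (rule right_module_image_rmodule[OF M inj])
  have \<phi>: "\<phi> \<in> linear_maps K A M ?N" 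
    by (intro linear_mapsI) (auto simp: scal_def)
  have \<psi>: "inv_into (carrier M) \<phi> \<in> linear_maps K A ?N M"
    by (intro linear_mapsI) (auto simp: scal_def M.ract_closed)
  have "lsum ?N (\<lambda>p. scal A ?N (snd p x) (\<phi> (fst p))) \<beta> = \<phi> x" if "x \<in> carrier M" for x
    using linear_map_expand[OF M N \<beta> \<phi> that] by simp
  then show ?thesis
    using \<beta> linear_forms_comp[OF \<psi>] by (auto simp: dual_system_def comp_def)
qed

text \<open>The coordinates of x determine x by the expansion. The image may be a proper subspace of
  the space of all lists of that length, because \<beta> need not be a basis.\<close>

lemma dual_system_coordinates_inj:
  assumes "dual_system M \<beta>"
  shows "inj_on (\<lambda>x. map (\<lambda>p. snd p x) \<beta>) (carrier M)"
proof (rule inj_onI)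
  fix x y assume xy: "x \<in> carrier M" "y \<in> carrier M" "map (\<lambda>p. snd p x) \<beta> = map (\<lambda>p. snd p y) \<beta>"
  then have "lsum M (\<lambda>p. scal A M (snd p x) (fst p)) \<beta> = lsum M (\<lambda>p. scal A M (snd p y) (fst p)) \<beta>"
    by (intro lsum_cong) auto
  then show "x = y" using xy dual_systemD(4)[OF assms] by simp
qed

text \<open>
  \<^const>\<open>projective_rmodule\<close> only provides lifts for modules on lists of scalars; a module with a
  dual system is moved there by its coordinates.
\<close>

lemma projective_lift:
  assumes P: "projective_rmodule K A P"
    and U: "right_module A U" "dual_system U \<beta>" and V: "right_module A V" "dual_system V \<gamma>"
    and g: "g \<in> rmod_hom A U V" "g ` carrier U = carrier V" and f: "f \<in> rmod_hom A P V"
  shows "\<exists>h\<in>rmod_hom A P U. \<forall>x\<in>carrier P. g (h x) = f x"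
proof -
  interpret U: right_module A U by fact
  interpret V: right_module A V by fact
  interpret P: right_module A P using P by (simp add: projective_rmodule_def fd_right_module_def)
  define \<phi> where "\<phi> = (\<lambda>x. map (\<lambda>p. snd p x) \<beta>)"
  define \<chi> where "\<chi> = (\<lambda>x. map (\<lambda>p. snd p x) \<gamma>)"
  have inj [simp]: "inj_on \<phi> (carrier U)" "inj_on \<chi> (carrier V)"
    unfolding \<phi>_def \<chi>_def by (rule dual_system_coordinates_inj[OF U(2)] dual_system_coordinates_inj[OF V(2)])+
  define \<psi> where "\<psi> = inv_into (carrier U) \<phi>"
  let ?U = "image_rmodule U \<phi>" and ?V = "image_rmodule V \<chi>"
  have \<psi>: "\<psi> (\<phi> x) = x" if "x \<in> carrier U" for x using that by (simp add: \<psi>_def)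
  have fd: "fd_right_module K A ?U" "fd_right_module K A ?V"
    using dual_system_imp_fd[OF right_module_image_rmodule[OF U(1) inj(1)] dual_system_image_rmodule[OF U inj(1)]]
      dual_system_imp_fd[OF right_module_image_rmodule[OF V(1) inj(2)] dual_system_image_rmodule[OF V inj(2)]]
    by blast+
  let ?g = "restrict (\<lambda>u. \<chi> (g (\<psi> u))) (carrier ?U)"
  let ?f = "restrict (\<lambda>x. \<chi> (f x)) (carrier P)"
  have g': "?g \<in> rmod_hom A ?U ?V"
    by (intro rmod_homI) (auto simp: \<psi> inj_on_eq_iff[OF inj(1)] rmod_homD[OF g(1)] U.ract_closed simp flip: \<psi>_def)
  have f': "?f \<in> rmod_hom A P ?V"
    by (intro rmod_homI) (auto simp: rmod_homD[OF f] P.ract_closed)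
  have "?g ` carrier ?U = carrier ?V"
    using \<psi> by (simp add: image_image image_restrict_eq flip: g(2))
  \<comment> \<open>A lift for the transported problem; following it by the inverse
    \<open>\<psi>\<close> of the coordinate map gives a lift into \<open>U\<close>.\<close>
  then obtain h where h: "h \<in> rmod_hom A P ?U" "compose (carrier P) ?g h = ?f"
    using P fd g' f' unfolding projective_rmodule_def by blast
  have hx: "\<exists>y\<in>carrier U. h x = \<phi> y" if "x \<in> carrier P" for x
    using rmod_homD(2)[OF h(1) that] by auto
  let ?h = "restrict (\<lambda>x. \<psi> (h x)) (carrier P)"
  have "?h \<in> rmod_hom A P U"
  proof (intro rmod_homI)
    fix x y a assume xy: "x \<in> carrier P" "y \<in> carrier P"
    then obtain x' y' where *: "x' \<in> carrier U" "h x = \<phi> x'" "y' \<in> carrier U" "h y = \<phi> y'"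
      using hx by meson
    then show "?h x \<in> carrier U" using xy \<psi> by auto
    show "?h (x \<oplus>\<^bsub>P\<^esub> y) = ?h x \<oplus>\<^bsub>U\<^esub> ?h y"
      using xy * \<psi> rmod_homD(3)[OF h(1)] by (simp flip: \<psi>_def)
  next
    fix x a assume x: "x \<in> carrier P" "a \<in> carrier A"
    then obtain x' where *: "x' \<in> carrier U" "h x = \<phi> x'"
      using hx by meson
    show "?h (x \<lhd>\<^bsub>P\<^esub> a) = ?h x \<lhd>\<^bsub>U\<^esub> a"
      using x * \<psi> rmod_homD(4)[OF h(1)] by (simp add: P.ract_closed U.ract_closed flip: \<psi>_def)
  qed auto
  moreover have "g (?h x) = f x" if x: "x \<in> carrier P" for x
  proof -
    obtain x' where *: "x' \<in> carrier U" "h x = \<phi> x'" using hx x by meson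
    have "\<chi> (g x') = \<chi> (f x)"
      using h(2)[THEN fun_cong, of x] x * \<psi> by (simp add: compose_def)
    then have "g x' = f x"
      using * x rmod_homD(2)[OF f] rmod_homD(2)[OF g(1)] by (simp add: inj_on_eq_iff[OF inj(2)])
    then show ?thesis using x * \<psi> by simp
  qed
  ultimately show ?thesis by blast
qed

section \<open>Derivations and modules of finite projective dimension\<close>


text \<open>\<open>D x a\<close> is the value at x of the endomorphism attached to a. These are the
  Hochschild 1-cocycles with values in End_K(M): the last clause, combined with the product rule for
  b = c 1, gives K-linearity in the second argument.\<close>

definition derivation :: "('c, 'e, 'r) rmodule_scheme \<Rightarrow> ('e \<Rightarrow> 'c \<Rightarrow> 'e) \<Rightarrow> bool" where
  "derivation M D \<longleftrightarrow>
     (\<forall>a\<in>carrier A. (\<lambda>x. D x a) \<in> linear_maps K A M M) \<and>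
     (\<forall>x\<in>carrier M. \<forall>a\<in>carrier A. \<forall>b\<in>carrier A. D x (a \<oplus>\<^bsub>A\<^esub> b) = D x a \<oplus>\<^bsub>M\<^esub> D x b) \<and>
     (\<forall>x\<in>carrier M. \<forall>a\<in>carrier A. \<forall>b\<in>carrier A.
        D x (a \<otimes>\<^bsub>A\<^esub> b) = (D x a \<lhd>\<^bsub>M\<^esub> b) \<oplus>\<^bsub>M\<^esub> D (x \<lhd>\<^bsub>M\<^esub> a) b) \<and>
     (\<forall>x\<in>carrier M. \<forall>c\<in>carrier K. D x (c \<odot>\<^bsub>A\<^esub> \<one>\<^bsub>A\<^esub>) = \<zero>\<^bsub>M\<^esub>)"

definition traceless_derivations :: "('c, 'e, 'r) rmodule_scheme \<Rightarrow> bool" where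
  "traceless_derivations M \<longleftrightarrow>
     (\<forall>D \<beta> a. derivation M D \<and> dual_system M \<beta> \<and> a \<in> carrier A \<longrightarrow>
        dual_trace \<beta> (\<lambda>x. D x a) = \<zero>\<^bsub>K\<^esub>)"

lemma derivationD:
  assumes "derivation M D"
  shows "\<And>a. a \<in> carrier A \<Longrightarrow> (\<lambda>x. D x a) \<in> linear_maps K A M M"
    and "\<And>x a. x \<in> carrier M \<Longrightarrow> a \<in> carrier A \<Longrightarrow> D x a \<in> carrier M"
    and "\<And>x y a. x \<in> carrier M \<Longrightarrow> y \<in> carrier M \<Longrightarrow> a \<in> carrier A \<Longrightarrow> D (x \<oplus>\<^bsub>M\<^esub> y) a = D x a \<oplus>\<^bsub>M\<^esub> D y a"
    and "\<And>x a b. x \<in> carrier M \<Longrightarrow> a \<in> carrier A \<Longrightarrow> b \<in> carrier A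
      \<Longrightarrow> D x (a \<oplus>\<^bsub>A\<^esub> b) = D x a \<oplus>\<^bsub>M\<^esub> D x b"
    and "\<And>x a b. x \<in> carrier M \<Longrightarrow> a \<in> carrier A \<Longrightarrow> b \<in> carrier A
      \<Longrightarrow> D x (a \<otimes>\<^bsub>A\<^esub> b) = (D x a \<lhd>\<^bsub>M\<^esub> b) \<oplus>\<^bsub>M\<^esub> D (x \<lhd>\<^bsub>M\<^esub> a) b"
    and "\<And>x c. x \<in> carrier M \<Longrightarrow> c \<in> carrier K \<Longrightarrow> D x (c \<odot>\<^bsub>A\<^esub> \<one>\<^bsub>A\<^esub>) = \<zero>\<^bsub>M\<^esub>"
  using assms linear_mapsD(1)[of "\<lambda>x. D x a" K A M M for a] linear_mapsD(2)[of "\<lambda>x. D x a" K A M M for a]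
  by (auto simp: derivation_def)

lemma rmod_hom_linear:
  assumes "f \<in> rmod_hom A M N"
  shows "f \<in> linear_maps K A M N"
  by (intro linear_mapsI) (simp_all add: rmod_homD[OF assms] scal_def)

lemma linear_maps_minus:
  assumes M: "right_module A M" and N: "right_module A N"
    and f: "f \<in> linear_maps K A M N" and g: "g \<in> linear_maps K A M N"
  shows "(\<lambda>x. f x \<ominus>\<^bsub>N\<^esub> g x) \<in> linear_maps K A M N"
proof -
  interpret N: right_module A N by fact
  have "scal A N c (x \<ominus>\<^bsub>N\<^esub> y) = scal A N c x \<ominus>\<^bsub>N\<^esub> scal A N c y"
    if "c \<in> carrier K" "x \<in> carrier N" "y \<in> carrier N" for c x y
    using that by (simp add: scal_def N.minus_ract)
  moreover have "(u \<oplus>\<^bsub>N\<^esub> v) \<ominus>\<^bsub>N\<^esub> (x \<oplus>\<^bsub>N\<^esub> y) = (u \<ominus>\<^bsub>N\<^esub> x) \<oplus>\<^bsub>N\<^esub> (v \<ominus>\<^bsub>N\<^esub> y)"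
    if "u \<in> carrier N" "v \<in> carrier N" "x \<in> carrier N" "y \<in> carrier N" for u v x y
    using that by (simp add: N.M.minus_eq N.M.minus_add N.M.a_ac)
  ultimately show ?thesis
    by (intro linear_mapsI) (simp_all add: linear_mapsD[OF f] linear_mapsD[OF g])
qed

lemma linear_map_minus:
  assumes M: "right_module A M" and N: "right_module A N" and f: "f \<in> linear_maps K A M N"
    and "x \<in> carrier M" "y \<in> carrier M"
  shows "f (x \<ominus>\<^bsub>M\<^esub> y) = f x \<ominus>\<^bsub>N\<^esub> f y"
proof -
  interpret M: right_module A M by fact
  interpret N: right_module A N by fact
  show ?thesis
    using linear_mapsD[OF f] assms(4,5)
    by (intro additive_minus[OF M.M.abelian_group_axioms N.M.abelian_group_axioms]) auto
qed

text \<open>The self-extension \<open>0 \<rightarrow> M \<rightarrow> E \<rightarrow> M \<rightarrow> 0\<close> classified by a derivation.\<close>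

definition extension_rmodule ::
    "('c, 'e, 'r) rmodule_scheme \<Rightarrow> ('e \<Rightarrow> 'c \<Rightarrow> 'e) \<Rightarrow> ('c, 'e \<times> 'e) rmodule" where
  "extension_rmodule M D =
     \<lparr>carrier = carrier M \<times> carrier M, mult = (\<lambda>u v. undefined), one = undefined,
      zero = (\<zero>\<^bsub>M\<^esub>, \<zero>\<^bsub>M\<^esub>), add = (\<lambda>u v. (fst u \<oplus>\<^bsub>M\<^esub> fst v, snd u \<oplus>\<^bsub>M\<^esub> snd v)),
      ract = (\<lambda>u a. (fst u \<lhd>\<^bsub>M\<^esub> a, (snd u \<lhd>\<^bsub>M\<^esub> a) \<oplus>\<^bsub>M\<^esub> D (fst u) a))\<rparr>"

lemma extension_rmodule_sel [simp]:
  "carrier (extension_rmodule M D) = carrier M \<times> carrier M"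
  "\<zero>\<^bsub>extension_rmodule M D\<^esub> = (\<zero>\<^bsub>M\<^esub>, \<zero>\<^bsub>M\<^esub>)"
  "u \<oplus>\<^bsub>extension_rmodule M D\<^esub> v = (fst u \<oplus>\<^bsub>M\<^esub> fst v, snd u \<oplus>\<^bsub>M\<^esub> snd v)"
  "u \<lhd>\<^bsub>extension_rmodule M D\<^esub> a = (fst u \<lhd>\<^bsub>M\<^esub> a, (snd u \<lhd>\<^bsub>M\<^esub> a) \<oplus>\<^bsub>M\<^esub> D (fst u) a)"
  by (simp_all add: extension_rmodule_def)

context
  fixes M :: "('c, 'e, 'r) rmodule_scheme" and D
  assumes M: "right_module A M" and D: "derivation M D"
begin

interpretation M: right_module A M by (fact M)

text \<open>The product rule for \<open>D\<close> is associativity of the action on E, the two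
  additivity clauses are its distributivity, and vanishing on scalars gives D x 1 = 0, hence the
  unit law.\<close>

lemma right_module_extension_rmodule: "right_module A (extension_rmodule M D)"
proof -
  let ?E = "extension_rmodule M D"
  have "abelian_group ?E"
  proof (rule abelian_groupI)
    show "\<exists>v\<in>carrier ?E. v \<oplus>\<^bsub>?E\<^esub> u = \<zero>\<^bsub>?E\<^esub>" if "u \<in> carrier ?E" for u
      using that by (intro bexI[of _ "(\<ominus>\<^bsub>M\<^esub> fst u, \<ominus>\<^bsub>M\<^esub> snd u)"]) (auto simp: M.M.l_neg)
  qed (auto simp: M.M.a_ac)
  moreover have "right_module_axioms A ?E"
  proof
    show "x \<lhd>\<^bsub>?E\<^esub> \<one>\<^bsub>A\<^esub> = x" if "x \<in> carrier ?E" for x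
      using that derivationD(6)[OF D, of "fst x" "\<one>\<^bsub>K\<^esub>"] by (auto simp: M.ract_one)
  qed (auto simp: M.ract_closed M.ract_add M.add_ract M.ract_mult derivationD[OF D] M.M.a_ac)
  ultimately show ?thesis
    by (intro right_module.intro ring_axioms)
qed

text \<open>Because \<open>D\<close> vanishes on scalars, E is the direct sum of two copies of M as
  a vector space. The system makes \<open>projective_lift\<close> applicable to E -> M.\<close>

lemma dual_system_extension_rmodule:
  assumes \<beta>: "dual_system M \<beta>"
  shows "dual_system (extension_rmodule M D)
    (map (\<lambda>p. ((fst p, \<zero>\<^bsub>M\<^esub>), \<lambda>u. snd p (fst u))) \<beta> @ map (\<lambda>p. ((\<zero>\<^bsub>M\<^esub>, fst p), \<lambda>u. snd p (snd u))) \<beta>)"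
    (is "dual_system ?E ?\<beta>")
proof -
  have E: "right_module A ?E" by (rule right_module_extension_rmodule)
  interpret E: right_module A ?E by (fact E)
  have sc: "scal A ?E c (x, y) = (scal A M c x, scal A M c y)"
    if "c \<in> carrier K" "x \<in> carrier M" "y \<in> carrier M" for c x y
    using that by (simp add: scal_def M.ract_closed derivationD(6)[OF D])
  have lin: "fst \<in> linear_maps K A ?E M" "snd \<in> linear_maps K A ?E M"
    by (intro linear_mapsI; auto simp: sc)+
  have inj: "(\<lambda>x. (x, \<zero>\<^bsub>M\<^esub>)) \<in> linear_maps K A M ?E" "(\<lambda>x. (\<zero>\<^bsub>M\<^esub>, x)) \<in> linear_maps K A M ?E"
    by (intro linear_mapsI; auto simp: sc scal_zero_right[OF M])+
  have "lsum ?E (\<lambda>p. scal A ?E (snd p u) (fst p)) ?\<beta> = u" if "u \<in> carrier ?E" for u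
  proof -
    have u: "fst u \<in> carrier M" "snd u \<in> carrier M" using that by auto
    have "lsum ?E (\<lambda>p. scal A ?E (snd p u) (fst p)) ?\<beta>
        = lsum ?E (\<lambda>p. scal A ?E (snd p (fst u)) (fst p, \<zero>\<^bsub>M\<^esub>)) \<beta>
          \<oplus>\<^bsub>?E\<^esub> lsum ?E (\<lambda>p. scal A ?E (snd p (snd u)) (\<zero>\<^bsub>M\<^esub>, fst p)) \<beta>"
      using u dual_systemD[OF \<beta>]
      by (subst E.M.lsum_append) (auto simp: comp_def sc scal_closed[OF M])
    also have "\<dots> = (fst u, \<zero>\<^bsub>M\<^esub>) \<oplus>\<^bsub>?E\<^esub> (\<zero>\<^bsub>M\<^esub>, snd u)"
      using linear_map_expand[OF M E \<beta> inj(1) u(1)] linear_map_expand[OF M E \<beta> inj(2) u(2)] by simp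
    finally show ?thesis using u by (cases u) simp
  qed
  then show ?thesis
    using dual_systemD(1,2)[OF \<beta>] linear_forms_comp[OF lin(1)] linear_forms_comp[OF lin(2)]
    by (auto simp: dual_system_def)
qed

end


section \<open>Linear sections, kernels and additivity of the trace\<close>

lemma linear_maps_id: "(\<lambda>x. x) \<in> linear_maps K A M M"
  by (intro linear_mapsI) auto

lemma dual_trace_independent:
  assumes "right_module A M" "dual_system M \<beta>" "dual_system M \<gamma>" "T \<in> linear_maps K A M M"
  shows "dual_trace \<beta> T = dual_trace \<gamma> T"
  using dual_trace_cyclic[OF assms(1,1,2,3) linear_maps_id assms(4)] by simp

text \<open>Choose preimages of the vectors of \<beta> and recombine them with the forms of \<beta>;
  applying \<pi> recovers the expansion of x, even if the vectors are dependent.\<close>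

lemma linear_section_exists:
  assumes P: "right_module A P" and M: "right_module A M" and \<beta>: "dual_system M \<beta>"
    and \<pi>: "\<pi> \<in> linear_maps K A P M" "\<pi> ` carrier P = carrier M"
  shows "\<exists>\<sigma>\<in>linear_maps K A M P. \<forall>x\<in>carrier M. \<pi> (\<sigma> x) = x"
proof -
  interpret P: right_module A P by fact
  interpret M: right_module A M by fact
  obtain s where s: "\<And>y. y \<in> carrier M \<Longrightarrow> s y \<in> carrier P \<and> \<pi> (s y) = y"
    using \<pi>(2) by (metis (no_types, lifting) image_iff)
  have b: "s (fst p) \<in> carrier P" "\<pi> (s (fst p)) = fst p" if "p \<in> set \<beta>" for p
    using s dual_systemD(1)[OF \<beta> that] by auto
  note b' = b[of "(u, v)" for u v, simplified]
  define \<sigma> where "\<sigma> x = lsum P (\<lambda>p. scal A P (snd p x) (s (fst p))) \<beta>" for x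
  have "\<sigma> \<in> linear_maps K A M P"
  proof (rule linear_mapsI)
    show "\<sigma> x \<in> carrier P" if "x \<in> carrier M" for x
      unfolding \<sigma>_def using that by (intro P.M.lsum_closed scal_closed[OF P] b dual_systemD(3)[OF \<beta>])
    show "\<sigma> (x \<oplus>\<^bsub>M\<^esub> y) = \<sigma> x \<oplus>\<^bsub>P\<^esub> \<sigma> y" if "x \<in> carrier M" "y \<in> carrier M" for x y
    proof -
      have "\<sigma> (x \<oplus>\<^bsub>M\<^esub> y)
          = lsum P (\<lambda>p. scal A P (snd p x) (s (fst p)) \<oplus>\<^bsub>P\<^esub> scal A P (snd p y) (s (fst p))) \<beta>"
        unfolding \<sigma>_def using that
        by (intro lsum_cong)
           (simp add: linear_formsD(2)[OF dual_systemD(2)[OF \<beta>]] add_scal[OF P] b dual_systemD(3)[OF \<beta>])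
      also have "\<dots> = \<sigma> x \<oplus>\<^bsub>P\<^esub> \<sigma> y"
        unfolding \<sigma>_def using that
        by (intro P.M.lsum_add scal_closed[OF P] b dual_systemD(3)[OF \<beta>])
      finally show ?thesis .
    qed
    show "\<sigma> (scal A M c x) = scal A P c (\<sigma> x)" if "c \<in> carrier K" "x \<in> carrier M" for c x
    proof -
      have "\<sigma> (scal A M c x) = lsum P (\<lambda>p. scal A P c (scal A P (snd p x) (s (fst p)))) \<beta>"
        unfolding \<sigma>_def using that
        by (intro lsum_cong)
           (simp add: linear_formsD(3)[OF dual_systemD(2)[OF \<beta>]] scal_mult[OF P] b dual_systemD(3)[OF \<beta>])
      also have "\<dots> = scal A P c (\<sigma> x)"
        unfolding \<sigma>_def using that
        by (intro additive_lsum[symmetric])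
           (auto simp: scal_zero_right[OF P] scal_add[OF P] b' intro: P.M.abelian_monoid_axioms
             intro!: scal_closed[OF P] dual_systemD(3)[OF \<beta>])
      finally show ?thesis .
    qed
  qed
  moreover have "\<pi> (\<sigma> x) = x" if "x \<in> carrier M" for x
  proof -
    have "\<pi> (\<sigma> x) = lsum M (\<lambda>p. \<pi> (scal A P (snd p x) (s (fst p)))) \<beta>"
      unfolding \<sigma>_def using that
      by (intro additive_lsum)
         (auto simp: linear_maps_zero[OF P M \<pi>(1)] linear_mapsD[OF \<pi>(1)] b' intro: P.M.abelian_monoid_axioms
             intro!: scal_closed[OF P] dual_systemD(3)[OF \<beta>])
    also have "\<dots> = lsum M (\<lambda>p. scal A M (snd p x) (fst p)) \<beta>"
      using that by (intro lsum_cong) (simp add: linear_mapsD[OF \<pi>(1)] b dual_systemD(3)[OF \<beta>])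
    finally show ?thesis using dual_systemD(4)[OF \<beta> that] by simp
  qed
  ultimately show ?thesis by blast
qed

lemma right_module_kernel:
  assumes P: "right_module A P" and M: "right_module A M" and \<pi>: "\<pi> \<in> rmod_hom A P M"
  shows "right_module A (P\<lparr>carrier := a_kernel P M \<pi>\<rparr>)"
proof -
  interpret P: right_module A P by fact
  interpret M: right_module A M by fact
  let ?N = "P\<lparr>carrier := a_kernel P M \<pi>\<rparr>"
  note lin = rmod_hom_linear[OF \<pi>]
  have ker: "x \<in> a_kernel P M \<pi> \<longleftrightarrow> x \<in> carrier P \<and> \<pi> x = \<zero>\<^bsub>M\<^esub>" for x
    by (simp add: a_kernel_def')
  have "abelian_group ?N"
  proof (rule abelian_groupI)
    fix x assume x: "x \<in> carrier ?N"
    have "\<pi> (\<zero>\<^bsub>P\<^esub> \<ominus>\<^bsub>P\<^esub> x) = \<zero>\<^bsub>M\<^esub>"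
      using x linear_map_minus[OF P M lin P.M.zero_closed] 
      by (simp add: ker linear_maps_zero[OF P M lin] M.M.minus_eq)
    with x show "\<exists>y\<in>carrier ?N. y \<oplus>\<^bsub>?N\<^esub> x = \<zero>\<^bsub>?N\<^esub>"
      by (intro bexI[of _ "\<zero>\<^bsub>P\<^esub> \<ominus>\<^bsub>P\<^esub> x"]) (auto simp: ker P.M.minus_eq P.M.l_neg)
  qed (auto simp: ker P.M.a_ac linear_mapsD[OF lin] linear_maps_zero[OF P M lin])
  moreover have "right_module_axioms A ?N"
    by (auto simp: right_module_axioms_def ker P.ract_closed P.ract_add P.add_ract P.ract_mult P.ract_one
       rmod_homD[OF \<pi>] M.zero_ract)
  ultimately show ?thesis
    by (intro right_module.intro ring_axioms)
qed

lemma scal_update_carrier [simp]: "scal A (P\<lparr>carrier := N\<rparr>) c x = scal A P c x"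
  by (simp add: scal_def)

context
  fixes P :: "('c, 'e, 'r) rmodule_scheme" and M :: "('c, 'f, 's) rmodule_scheme" and \<pi> \<sigma>
  assumes P: "right_module A P" and M: "right_module A M" and \<pi>: "\<pi> \<in> rmod_hom A P M"
    and \<sigma>: "\<sigma> \<in> linear_maps K A M P" "\<And>x. x \<in> carrier M \<Longrightarrow> \<pi> (\<sigma> x) = x"
begin

interpretation P: right_module A P by (fact P)
interpretation M: right_module A M by (fact M)

abbreviation (input) Ker where "Ker \<equiv> P\<lparr>carrier := a_kernel P M \<pi>\<rparr>"

text \<open>The projection of P onto the kernel along the complement \<sigma>(M).\<close>

lemma linear_retraction: "(\<lambda>x. x \<ominus>\<^bsub>P\<^esub> \<sigma> (\<pi> x)) \<in> linear_maps K A P Ker"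
proof -
  note lin = rmod_hom_linear[OF \<pi>]
  have L: "(\<lambda>x. x \<ominus>\<^bsub>P\<^esub> \<sigma> (\<pi> x)) \<in> linear_maps K A P P"
    by (intro linear_maps_minus P linear_maps_id linear_maps_comp[OF lin \<sigma>(1)])
  have "x \<ominus>\<^bsub>P\<^esub> \<sigma> (\<pi> x) \<in> a_kernel P M \<pi>" if "x \<in> carrier P" for x
    using that linear_map_minus[OF P M lin that, of "\<sigma> (\<pi> x)"] linear_mapsD[OF \<sigma>(1)] linear_mapsD[OF lin]
    by (simp add: a_kernel_def' \<sigma> M.M.minus_eq M.M.r_neg)
  then show ?thesis
    using linear_mapsD[OF L] by (intro linear_mapsI) simp_all
qed

lemma linear_retraction_kernel: "x \<in> carrier Ker \<Longrightarrow> x \<ominus>\<^bsub>P\<^esub> \<sigma> (\<pi> x) = x"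
  by (simp add: a_kernel_def' linear_maps_zero[OF M P \<sigma>(1)] P.M.minus_eq)

lemma linear_inclusion_kernel: "(\<lambda>x. x) \<in> linear_maps K A Ker P"
  by (intro linear_mapsI) (simp_all add: a_kernel_def')

text \<open>Forms restrict to the kernel, and the retraction pushes the vectors into it, which makes
  them dependent in general. This is why a dual system may have dependent vectors.\<close>

lemma dual_system_kernel:
  assumes \<gamma>: "dual_system P \<gamma>"
  shows "dual_system Ker (map (\<lambda>p. (fst p \<ominus>\<^bsub>P\<^esub> \<sigma> (\<pi> (fst p)), snd p)) \<gamma>)"
proof -
  have N: "right_module A Ker" by (rule right_module_kernel[OF P M \<pi>])
  have "lsum P (\<lambda>p. scal A P (snd p x) (fst p \<ominus>\<^bsub>P\<^esub> \<sigma> (\<pi> (fst p)))) \<gamma> = x"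
    if x: "x \<in> a_kernel P M \<pi>" for x
    using linear_map_expand[OF P N \<gamma> linear_retraction, of x] linear_retraction_kernel[of x] x
    by (simp add: a_kernel_def')
  then show ?thesis
    using linear_mapsD(1)[OF linear_retraction dual_systemD(1)[OF \<gamma>]]
      linear_forms_comp[OF linear_inclusion_kernel dual_systemD(2)[OF \<gamma>]]
    by (auto simp: dual_system_def comp_def)
qed

text \<open>The vectors of \<beta> moved by \<sigma>, together with those of \<delta>, form a dual
  system adapted to the decomposition of P into \<sigma>(M) and the kernel. In it \<open>T\<close>
  is block triangular, with diagonal blocks \<open>T'\<close> and the restriction of
  \<open>T\<close>.\<close>

lemma dual_trace_additive:
  assumes \<gamma>: "dual_system P \<gamma>" and \<delta>: "dual_system Ker \<delta>" and \<beta>: "dual_system M \<beta>"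
    and T: "T \<in> linear_maps K A P P" and T': "T' \<in> linear_maps K A M M"
    and comm: "\<And>x. x \<in> carrier P \<Longrightarrow> \<pi> (T x) = T' (\<pi> x)"
  shows "dual_trace \<gamma> T = dual_trace \<beta> T' \<oplus>\<^bsub>K\<^esub> dual_trace \<delta> T"
proof -
  note lin = rmod_hom_linear[OF \<pi>]
  have N: "right_module A Ker" by (rule right_module_kernel[OF P M \<pi>])
  define r where "r x = x \<ominus>\<^bsub>P\<^esub> \<sigma> (\<pi> x)" for x
  have r: "r \<in> linear_maps K A P Ker" using linear_retraction by (simp add: r_def [abs_def])
  define \<gamma>' where "\<gamma>' = map (\<lambda>p. (\<sigma> (fst p), \<lambda>x. snd p (\<pi> x))) \<beta> @ map (\<lambda>p. (fst p, \<lambda>x. snd p (r x))) \<delta>"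
  have mem: "\<sigma> (fst p) \<in> carrier P" if "p \<in> set \<beta>" for p
    using linear_mapsD(1)[OF \<sigma>(1)] dual_systemD(1)[OF \<beta> that] .
  have mem': "fst p \<in> carrier P" if "p \<in> set \<delta>" for p
    using dual_systemD(1)[OF \<delta> that] by (simp add: a_kernel_def')
  have rk: "r x \<in> a_kernel P M \<pi>" if "x \<in> carrier P" for x
    using linear_mapsD(1)[OF r that] by simp
  note pair = mem[of "(u, v)" for u v, simplified] mem'[of "(u, v)" for u v, simplified]
    dual_systemD(3)[OF \<beta>, of "(u, v)" for u v, simplified] dual_systemD(3)[OF \<delta>, of "(u, v)" for u v, simplified]
  have \<gamma>': "dual_system P \<gamma>'"
  proof -
    have "lsum P (\<lambda>p. scal A P (snd p x) (fst p)) \<gamma>' = x" if x: "x \<in> carrier P" for x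
    proof -
      have "lsum P (\<lambda>p. scal A P (snd p x) (fst p)) \<gamma>'
          = lsum P (\<lambda>p. scal A P (snd p (\<pi> x)) (\<sigma> (fst p))) \<beta>
            \<oplus>\<^bsub>P\<^esub> lsum P (\<lambda>p. scal A P (snd p (r x)) (fst p)) \<delta>"
        unfolding \<gamma>'_def
        by (subst P.M.lsum_append)
           (auto simp: comp_def pair rk scal_closed[OF P] linear_mapsD(1)[OF lin] x)
      also have "\<dots> = \<sigma> (\<pi> x) \<oplus>\<^bsub>P\<^esub> r x"
        using linear_map_expand[OF M P \<beta> \<sigma>(1) linear_mapsD(1)[OF lin x]]
          dual_systemD(4)[OF \<delta> linear_mapsD(1)[OF r x]] by simp
      also have "\<dots> = x"
        using x linear_mapsD(1)[OF \<sigma>(1) linear_mapsD(1)[OF lin x]]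
        by (simp add: r_def P.M.minus_eq P.M.a_ac P.M.r_neg)
      finally show ?thesis .
    qed
    then show ?thesis
      using mem mem' linear_forms_comp[OF lin dual_systemD(2)[OF \<beta>]] linear_forms_comp[OF r dual_systemD(2)[OF \<delta>]]
      by (auto simp: dual_system_def \<gamma>'_def)
  qed
  have TN: "T x \<in> carrier Ker" if "x \<in> carrier Ker" for x
    using that comm[of x] by (simp add: a_kernel_def' linear_mapsD[OF T] linear_maps_zero[OF M M T'])
  have "dual_trace \<gamma> T = dual_trace \<gamma>' T"
    by (rule dual_trace_independent[OF P \<gamma> \<gamma>' T])
  also have "\<dots> = lsum K (\<lambda>p. snd p (\<pi> (T (\<sigma> (fst p))))) \<beta> \<oplus>\<^bsub>K\<^esub> lsum K (\<lambda>p. snd p (r (T (fst p)))) \<delta>"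
    unfolding dual_trace_def \<gamma>'_def
    by (subst space.R.lsum_append)
       (auto simp: comp_def pair rk linear_mapsD(1)[OF lin] linear_mapsD(1)[OF T])
  also have "lsum K (\<lambda>p. snd p (\<pi> (T (\<sigma> (fst p))))) \<beta> = dual_trace \<beta> T'"
    unfolding dual_trace_def
    by (intro lsum_cong) (simp add: comm mem \<sigma>(2) dual_systemD(1)[OF \<beta>])
  also have "lsum K (\<lambda>p. snd p (r (T (fst p)))) \<delta> = dual_trace \<delta> T"
    unfolding dual_trace_def
    by (intro lsum_cong) (use linear_retraction_kernel TN dual_systemD(1)[OF \<delta>] in \<open>simp add: r_def\<close>)
  finally show ?thesis .
qed

end

text \<open>
  A lift of \<open>\<pi>\<close> along \<open>E \<rightarrow> M\<close> yields an inner, hence traceless, derivation of \<open>P\<close> that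
  restricts to a derivation of the kernel and induces \<open>D\<close> on \<open>M\<close>.
\<close>

lemma traceless_derivations_projective_cover:
  assumes P: "projective_rmodule K A P" and M: "right_module A M" "dual_system M \<beta>0"
    and \<pi>: "\<pi> \<in> rmod_hom A P M" "\<pi> ` carrier P = carrier M"
    and N: "traceless_derivations (P\<lparr>carrier := a_kernel P M \<pi>\<rparr>)"
  shows "traceless_derivations M"
  unfolding traceless_derivations_def
proof (intro allI impI, elim conjE)
  fix D \<beta> a assume D: "derivation M D" and \<beta>: "dual_system M \<beta>" and a: "a \<in> carrier A"
  let ?N = "P\<lparr>carrier := a_kernel P M \<pi>\<rparr>"
  have fdP: "fd_right_module K A P" using P by (simp add: projective_rmodule_def)
  then have P': "right_module A P" by (simp add: fd_right_module_def)
  interpret P: right_module A P by fact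
  interpret M: right_module A M by fact
  obtain \<gamma> where \<gamma>: "dual_system P \<gamma>" using dual_system_exists[OF fdP] by blast
  note lin = rmod_hom_linear[OF \<pi>(1)]
  obtain \<sigma> where \<sigma>: "\<sigma> \<in> linear_maps K A M P" "\<And>x. x \<in> carrier M \<Longrightarrow> \<pi> (\<sigma> x) = x"
    using linear_section_exists[OF P' M(1) \<beta> lin \<pi>(2)] by blast
  let ?E = "extension_rmodule M D"
  let ?g = "restrict fst (carrier ?E)"
  have g: "?g \<in> rmod_hom A ?E M"
    by (intro rmod_homI) (auto simp: M.ract_closed derivationD[OF D])
  have g_surj: "?g ` carrier ?E = carrier M"
    using M.M.zero_closed by (auto simp: image_def)
  obtain h where h: "h \<in> rmod_hom A P ?E" "\<And>x. x \<in> carrier P \<Longrightarrow> ?g (h x) = \<pi> x"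
    using projective_lift[OF P right_module_extension_rmodule[OF M(1) D]
        dual_system_extension_rmodule[OF M(1) D \<beta>] M(1) \<beta> g g_surj \<pi>(1)] by metis
  have hE: "fst (h x) = \<pi> x" "snd (h x) \<in> carrier M" if "x \<in> carrier P" for x
    using h(2)[OF that] rmod_homD(2)[OF h(1) that] by auto
  \<comment> \<open>The lift \<open>h\<close> has components \<pi> and \<theta>. That
    \<open>h\<close> respects the twisted action on E says that \<theta> fails to be
    \<open>A\<close>-linear exactly by D(\<pi> x, b).\<close>
  define \<theta> where "\<theta> x = snd (h x)" for x
  have \<theta>_ract: "\<theta> (x \<lhd>\<^bsub>P\<^esub> b) = (\<theta> x \<lhd>\<^bsub>M\<^esub> b) \<oplus>\<^bsub>M\<^esub> D (\<pi> x) b"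
    if "x \<in> carrier P" "b \<in> carrier A" for x b
    using that by (simp add: \<theta>_def rmod_homD(4)[OF h(1)] hE)
  have \<theta>: "\<theta> \<in> linear_maps K A P M"
  proof (rule linear_mapsI)
    show "\<theta> (scal A P c x) = scal A M c (\<theta> x)" if "c \<in> carrier K" "x \<in> carrier P" for c x
      using that hE(2)[of x, folded \<theta>_def] derivationD(6)[OF D, of "\<pi> x" c] linear_mapsD(1)[OF lin]
      by (simp add: scal_def \<theta>_ract M.ract_closed)
  qed (simp_all add: \<theta>_def rmod_homD(3)[OF h(1)] hE)
  \<comment> \<open>Composing with \<sigma> turns \<theta> into an endomorphism of P lying over it,
    so that the commutator of \<eta> with the action lies over \<open>D\<close>.\<close>
  define \<eta> where "\<eta> x = \<sigma> (\<theta> x)" for x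
  have \<eta>: "\<eta> \<in> linear_maps K A P P"
    using linear_maps_comp[OF \<theta> \<sigma>(1)] by (simp add: \<eta>_def [abs_def])
  have \<pi>\<eta>: "\<pi> (\<eta> x) = \<theta> x" if "x \<in> carrier P" for x
    using that linear_mapsD(1)[OF \<theta>] by (simp add: \<eta>_def \<sigma>(2))
  define DP where "DP x b = \<eta> (x \<lhd>\<^bsub>P\<^esub> b) \<ominus>\<^bsub>P\<^esub> (\<eta> x \<lhd>\<^bsub>P\<^esub> b)" for x b
  note \<eta>c = linear_mapsD(1)[OF \<eta>]
  have DPlin: "(\<lambda>x. DP x b) \<in> linear_maps K A P P" if "b \<in> carrier A" for b
    unfolding DP_def using that
    by (intro linear_maps_minus P' linear_maps_comp[OF ract_linear[OF P' that] \<eta>]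
        linear_maps_comp[OF \<eta> ract_linear[OF P' that]])
  have \<pi>DP: "\<pi> (DP x b) = D (\<pi> x) b" if "x \<in> carrier P" "b \<in> carrier A" for x b
  proof -
    have "\<pi> (DP x b) = \<theta> (x \<lhd>\<^bsub>P\<^esub> b) \<ominus>\<^bsub>M\<^esub> (\<theta> x \<lhd>\<^bsub>M\<^esub> b)"
      using that by (simp add: DP_def linear_map_minus[OF P' M(1) lin] \<pi>\<eta> P.ract_closed \<eta>c rmod_homD(4)[OF \<pi>(1)])
    also have "\<dots> = D (\<pi> x) b"
      using that linear_mapsD(1)[OF \<theta>] linear_mapsD(1)[OF lin]
      by (simp add: \<theta>_ract M.ract_closed derivationD(2)[OF D] M.M.minus_eq M.M.a_ac M.M.r_neg)
    finally show ?thesis .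
  qed
  have der: "derivation ?N DP"
  proof -
    have ker: "x \<in> a_kernel P M \<pi> \<longleftrightarrow> x \<in> carrier P \<and> \<pi> x = \<zero>\<^bsub>M\<^esub>" for x
      by (simp add: a_kernel_def')
    have DP0: "\<pi> (DP x b) = \<zero>\<^bsub>M\<^esub>" if "x \<in> carrier P" "\<pi> x = \<zero>\<^bsub>M\<^esub>" "b \<in> carrier A" for x b
      using that linear_maps_zero[OF M(1,1) derivationD(1)[OF D]] by (simp add: \<pi>DP)
    have "(\<lambda>x. DP x b) \<in> linear_maps K A ?N ?N" if "b \<in> carrier A" for b
      using linear_mapsD[OF DPlin[OF that]] DP0 that
      by (intro linear_mapsI) (simp_all add: a_kernel_def')
    moreover have "DP x (b \<oplus>\<^bsub>A\<^esub> c) = DP x b \<oplus>\<^bsub>P\<^esub> DP x c"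
      if "x \<in> carrier P" "b \<in> carrier A" "c \<in> carrier A" for x b c
      using that by (simp add: DP_def P.ract_add linear_mapsD[OF \<eta>] P.ract_closed P.M.minus_eq P.M.minus_add P.M.a_ac)
    moreover have "DP x (b \<otimes>\<^bsub>A\<^esub> c) = (DP x b \<lhd>\<^bsub>P\<^esub> c) \<oplus>\<^bsub>P\<^esub> DP (x \<lhd>\<^bsub>P\<^esub> b) c"
      if "x \<in> carrier P" "b \<in> carrier A" "c \<in> carrier A" for x b c
    proof -
      have *: "u \<ominus>\<^bsub>P\<^esub> w = (v \<ominus>\<^bsub>P\<^esub> w) \<oplus>\<^bsub>P\<^esub> (u \<ominus>\<^bsub>P\<^esub> v)"
        if "u \<in> carrier P" "v \<in> carrier P" "w \<in> carrier P" for u v w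
      proof -
        have "(v \<ominus>\<^bsub>P\<^esub> w) \<oplus>\<^bsub>P\<^esub> (u \<ominus>\<^bsub>P\<^esub> v) = (u \<ominus>\<^bsub>P\<^esub> w) \<oplus>\<^bsub>P\<^esub> (v \<oplus>\<^bsub>P\<^esub> \<ominus>\<^bsub>P\<^esub> v)"
          using that by (simp add: P.M.minus_eq P.M.a_ac del: P.M.r_neg)
        then show ?thesis using that by (simp add: P.M.minus_eq P.M.r_neg)
      qed
      show ?thesis
        using that *[of "\<eta> (x \<lhd>\<^bsub>P\<^esub> b \<lhd>\<^bsub>P\<^esub> c)" "\<eta> (x \<lhd>\<^bsub>P\<^esub> b) \<lhd>\<^bsub>P\<^esub> c" "\<eta> x \<lhd>\<^bsub>P\<^esub> b \<lhd>\<^bsub>P\<^esub> c"]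
        by (simp add: DP_def P.ract_mult P.minus_ract \<eta>c P.ract_closed)
    qed
    moreover have "DP x (c \<odot>\<^bsub>A\<^esub> \<one>\<^bsub>A\<^esub>) = \<zero>\<^bsub>P\<^esub>" if "x \<in> carrier P" "c \<in> carrier K" for x c
      using that linear_mapsD(3)[OF \<eta> that(2,1)] scal_closed[OF P' that(2)] \<eta>c
      by (simp add: DP_def scal_def P.M.minus_eq P.M.r_neg)
    ultimately show ?thesis
      by (simp add: derivation_def a_kernel_def')
  qed
  obtain \<delta> where \<delta>: "dual_system ?N \<delta>"
    using dual_system_kernel[OF P' M(1) \<pi>(1) \<sigma> \<gamma>] by blast
  \<comment> \<open>\<open>DP\<close> is the commutator of \<eta> with the action of
    \<open>a\<close>. Cyclicity gives its two terms the same trace, which is then cancelled as a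
    summand.\<close>
  have "dual_trace \<gamma> (\<lambda>x. DP x a) = \<zero>\<^bsub>K\<^esub>"
  proof -
    have cl: "snd p (\<eta> (fst p \<lhd>\<^bsub>P\<^esub> a)) \<in> carrier K" "snd p (\<eta> (fst p) \<lhd>\<^bsub>P\<^esub> a) \<in> carrier K"
      "fst p \<in> carrier P" if "p \<in> set \<gamma>" for p
      using a that \<eta>c P.ract_closed dual_systemD(1)[OF \<gamma>] dual_systemD(3)[OF \<gamma>] by auto
    have "dual_trace \<gamma> (\<lambda>x. DP x a) \<oplus>\<^bsub>K\<^esub> dual_trace \<gamma> (\<lambda>x. \<eta> x \<lhd>\<^bsub>P\<^esub> a)
        = lsum K (\<lambda>p. snd p (DP (fst p) a) \<oplus>\<^bsub>K\<^esub> snd p (\<eta> (fst p) \<lhd>\<^bsub>P\<^esub> a)) \<gamma>"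
      unfolding dual_trace_def using a cl linear_mapsD(1)[OF DPlin[OF a]] dual_systemD(3)[OF \<gamma>]
      by (intro space.R.lsum_add[symmetric]) auto
    also have "\<dots> = dual_trace \<gamma> (\<lambda>x. \<eta> (x \<lhd>\<^bsub>P\<^esub> a))"
      unfolding dual_trace_def
    proof (rule lsum_cong)
      fix p assume p: "p \<in> set \<gamma>"
      have "snd p (DP (fst p) a) \<oplus>\<^bsub>K\<^esub> snd p (\<eta> (fst p) \<lhd>\<^bsub>P\<^esub> a)
          = snd p (DP (fst p) a \<oplus>\<^bsub>P\<^esub> (\<eta> (fst p) \<lhd>\<^bsub>P\<^esub> a))"
        using p cl(3)[OF p] a \<eta>c linear_mapsD(1)[OF DPlin[OF a]] 
        by (simp add: linear_formsD(2)[OF dual_systemD(2)[OF \<gamma> p]] P.ract_closed)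
      also have "\<dots> = snd p (\<eta> (fst p \<lhd>\<^bsub>P\<^esub> a))"
        using cl(3)[OF p] a by (simp add: DP_def \<eta>c P.ract_closed P.M.minus_eq P.M.a_assoc P.M.l_neg)
      finally show "snd p (DP (fst p) a) \<oplus>\<^bsub>K\<^esub> snd p (\<eta> (fst p) \<lhd>\<^bsub>P\<^esub> a) = snd p (\<eta> (fst p \<lhd>\<^bsub>P\<^esub> a))" .
    qed
    also have "\<dots> = dual_trace \<gamma> (\<lambda>x. \<eta> x \<lhd>\<^bsub>P\<^esub> a)"
      by (rule dual_trace_cyclic[OF P' P' \<gamma> \<gamma> \<eta> ract_linear[OF P' a]])
    finally show ?thesis
      using cl linear_mapsD(1)[OF DPlin[OF a]] dual_systemD(3)[OF \<gamma>]
      by (subst (asm) space.R.add.r_cancel_one) (auto simp: dual_trace_def intro!: space.R.lsum_closed)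
  qed
  \<comment> \<open>The traces on M and on the kernel add up to zero, and the latter vanishes by
    \<open>N\<close>.\<close>
  moreover have "dual_trace \<gamma> (\<lambda>x. DP x a) = dual_trace \<beta> (\<lambda>x. D x a) \<oplus>\<^bsub>K\<^esub> dual_trace \<delta> (\<lambda>x. DP x a)"
    by (rule dual_trace_additive[OF P' M(1) \<pi>(1) \<sigma> \<gamma> \<delta> \<beta> DPlin[OF a] derivationD(1)[OF D a] \<pi>DP[OF _ a]])
  moreover have "dual_trace \<delta> (\<lambda>x. DP x a) = \<zero>\<^bsub>K\<^esub>"
    using N der \<delta> a by (auto simp: traceless_derivations_def)
  moreover have "dual_trace \<beta> (\<lambda>x. D x a) \<in> carrier K"
    unfolding dual_trace_def 
    by (intro space.R.lsum_closed dual_systemD(3)[OF \<beta>] derivationD(2)[OF D] dual_systemD(1)[OF \<beta>] a)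
  ultimately show "dual_trace \<beta> (\<lambda>x. D x a) = \<zero>\<^bsub>K\<^esub>" by simp
qed

end

section \<open>Derivations of simple modules\<close>

text \<open>The head of the list is the leading coefficient here, so the assumptions say that the
  degree is at least one; over an algebraically closed field the degree is the number of
  roots.\<close>

lemma (in algebraically_closed) root_exists:
  assumes "set p \<subseteq> carrier L" "hd p \<noteq> \<zero>" "length p \<ge> 2"
  shows "\<exists>r\<in>carrier L. eval p r = \<zero>"
proof -
  have p: "p \<in> carrier (poly_ring L)"
    using assms(1,2) by (auto simp: univ_poly_carrier[symmetric] intro: polynomialI)
  then have "size (roots p) = length p - 1"
    using roots_over_carrier by (auto simp: splitted_def)
  then have "roots p \<noteq> {#}" using assms(3) by auto
  then obtain r where "r \<in># roots p" by auto
  then show ?thesis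
    using roots_mem_iff_is_root[OF p] by (auto simp: is_root_def)
qed

section \<open>Polynomials in an endomorphism and the existence of eigenvectors\<close>

context fd_algebra
begin

text \<open>Coefficient lists start with the constant term, the reverse of the convention behind
  \<open>eval\<close>; hence the \<open>rev\<close> in \<open>horner_eval\<close>, and
  \<open>last\<close> is the leading coefficient.\<close>

primrec horner :: "'a \<Rightarrow> 'a list \<Rightarrow> 'a" where
  "horner r [] = \<zero>\<^bsub>K\<^esub>"
| "horner r (c # p) = (horner r p \<otimes>\<^bsub>K\<^esub> r) \<oplus>\<^bsub>K\<^esub> c"

text \<open>The vector p(\<phi>) v, computed by the Horner scheme instead of powers of
  \<phi>.\<close>

primrec poly_act :: "('c, 'e, 'r) rmodule_scheme \<Rightarrow> ('e \<Rightarrow> 'e) \<Rightarrow> 'e \<Rightarrow> 'a list \<Rightarrow> 'e" where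
  "poly_act M \<phi> v [] = \<zero>\<^bsub>M\<^esub>"
| "poly_act M \<phi> v (c # p) = \<phi> (poly_act M \<phi> v p) \<oplus>\<^bsub>M\<^esub> scal A M c v"

text \<open>Synthetic division by X - r: the intermediate values of the Horner scheme are the
  coefficients of the quotient, and \<open>horner r p\<close> is the remainder.\<close>

fun horner_quotient :: "'a \<Rightarrow> 'a list \<Rightarrow> 'a list" where
  "horner_quotient r (c # d # p) = horner r (d # p) # horner_quotient r (d # p)"
| "horner_quotient r p = []"

lemma horner_closed:
  "r \<in> carrier K \<Longrightarrow> set p \<subseteq> carrier K \<Longrightarrow> horner r p \<in> carrier K"
  by (induction p) auto

lemma horner_eval:
  assumes "r \<in> carrier K"
  shows "set p \<subseteq> carrier K \<Longrightarrow> horner r p = space.R.eval (rev p) r"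
proof (induction p)
  case (Cons c p)
  then show ?case using space.R.eval_append_aux[of "rev p" c r] assms by simp
qed simp

lemma horner_quotient:
  assumes "r \<in> carrier K"
  shows "set p \<subseteq> carrier K \<Longrightarrow> set (horner_quotient r p) \<subseteq> carrier K"
    and "length (horner_quotient r p) = length p - 1"
    and "set p \<subseteq> carrier K \<Longrightarrow> length p \<ge> 2 \<Longrightarrow> last (horner_quotient r p) = last p"
proof -
  show "set (horner_quotient r p) \<subseteq> carrier K" if "set p \<subseteq> carrier K"
    using that assms by (induction r p rule: horner_quotient.induct) (auto simp: horner_closed)
  show "length (horner_quotient r p) = length p - 1"
    by (induction r p rule: horner_quotient.induct) auto
  show "last (horner_quotient r p) = last p" if "set p \<subseteq> carrier K" "length p \<ge> 2"
    using that assms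
  proof (induction r p rule: horner_quotient.induct)
    case (1 r c d p)
    then show ?case by (cases p) auto
  qed auto
qed

context
  fixes M :: "('c, 'e, 'r) rmodule_scheme" and \<phi> v
  assumes M: "right_module A M" and \<phi>: "\<phi> \<in> linear_maps K A M M" and v: "v \<in> carrier M"
begin

interpretation M: right_module A M by (fact M)

lemma poly_act_closed: "set p \<subseteq> carrier K \<Longrightarrow> poly_act M \<phi> v p \<in> carrier M"
  by (induction p) (auto simp: linear_mapsD[OF \<phi>] scal_closed[OF M] v)

lemma poly_act_pad: "set p \<subseteq> carrier K \<Longrightarrow> poly_act M \<phi> v (p @ replicate n \<zero>\<^bsub>K\<^esub>) = poly_act M \<phi> v p"
proof (induction p)
  case Nil
  show ?case by (induction n) (auto simp: linear_maps_zero[OF M M \<phi>] scal_zero[OF M] v)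
qed simp

lemma poly_act_comb:
  assumes "length p = length q" "set p \<subseteq> carrier K" "set q \<subseteq> carrier K" "k \<in> carrier K"
  shows "poly_act M \<phi> v (map2 (\<lambda>c d. c \<oplus>\<^bsub>K\<^esub> (k \<otimes>\<^bsub>K\<^esub> d)) p q)
    = poly_act M \<phi> v p \<oplus>\<^bsub>M\<^esub> scal A M k (poly_act M \<phi> v q)"
  using assms
proof (induction p q rule: list_induct2)
  case Nil
  then show ?case by (simp add: scal_zero_right[OF M])
next
  case (Cons c p d q)
  have cl: "poly_act M \<phi> v p \<in> carrier M" "poly_act M \<phi> v q \<in> carrier M"
    using Cons.prems by (auto intro: poly_act_closed)
  show ?case
    using Cons cl by (simp add: linear_mapsD[OF \<phi>] scal_closed[OF M] v add_scal[OF M] scal_add[OF M]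
      scal_mult[OF M] M.M.a_ac)
qed

text \<open>This is p = (X - r) q + p(r), evaluated at \<phi> and applied to v.\<close>

lemma poly_act_division:
  assumes r: "r \<in> carrier K"
  shows "set p \<subseteq> carrier K \<Longrightarrow> p \<noteq> [] \<Longrightarrow> poly_act M \<phi> v p =
    (\<phi> (poly_act M \<phi> v (horner_quotient r p)) \<ominus>\<^bsub>M\<^esub> scal A M r (poly_act M \<phi> v (horner_quotient r p)))
      \<oplus>\<^bsub>M\<^esub> scal A M (horner r p) v"
  using r
proof (induction r p rule: horner_quotient.induct)
  case (1 r c d p)
  let ?p = "d # p"
  let ?w = "poly_act M \<phi> v (horner_quotient r ?p)" and ?e = "horner r ?p"
  have q: "set (horner_quotient r ?p) \<subseteq> carrier K"
    using 1 by (intro horner_quotient) auto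
  have w: "?w \<in> carrier M" by (rule poly_act_closed[OF q])
  have c: "c \<in> carrier K" and e: "?e \<in> carrier K" and r: "r \<in> carrier K"
    using 1 horner_closed[of r ?p] by auto
  note cl = w c e r v linear_mapsD(1)[OF \<phi>] scal_closed[OF M]
  let ?w' = "\<phi> ?w \<oplus>\<^bsub>M\<^esub> scal A M ?e v"
  have *: "(x \<ominus>\<^bsub>M\<^esub> (y \<oplus>\<^bsub>M\<^esub> z)) \<oplus>\<^bsub>M\<^esub> (z \<oplus>\<^bsub>M\<^esub> u) = (x \<ominus>\<^bsub>M\<^esub> y) \<oplus>\<^bsub>M\<^esub> u"
    if "x \<in> carrier M" "y \<in> carrier M" "z \<in> carrier M" "u \<in> carrier M" for x y z u
  proof -
    have "(x \<ominus>\<^bsub>M\<^esub> (y \<oplus>\<^bsub>M\<^esub> z)) \<oplus>\<^bsub>M\<^esub> (z \<oplus>\<^bsub>M\<^esub> u) = ((x \<ominus>\<^bsub>M\<^esub> y) \<oplus>\<^bsub>M\<^esub> u) \<oplus>\<^bsub>M\<^esub> (z \<oplus>\<^bsub>M\<^esub> \<ominus>\<^bsub>M\<^esub> z)"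
      using that by (simp add: M.M.minus_eq M.M.minus_add M.M.a_ac del: M.M.r_neg)
    then show ?thesis using that by (simp add: M.M.r_neg)
  qed
  have "poly_act M \<phi> v ?p = (\<phi> ?w \<ominus>\<^bsub>M\<^esub> scal A M r ?w) \<oplus>\<^bsub>M\<^esub> scal A M ?e v"
    using 1 by auto
  also have "\<dots> = ?w' \<ominus>\<^bsub>M\<^esub> scal A M r ?w"
    using cl by (simp add: M.M.minus_eq M.M.a_ac)
  finally have "poly_act M \<phi> v (c # ?p) = \<phi> (?w' \<ominus>\<^bsub>M\<^esub> scal A M r ?w) \<oplus>\<^bsub>M\<^esub> scal A M c v"
    by simp
  also have "\<dots> = (\<phi> ?w' \<ominus>\<^bsub>M\<^esub> scal A M r (\<phi> ?w)) \<oplus>\<^bsub>M\<^esub> scal A M c v"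
    using cl by (simp add: linear_map_minus[OF M M \<phi>] linear_mapsD(3)[OF \<phi>])
  \<comment> \<open>Subtract and add back r e v, so that r times the new value \<open>?w'\<close>
    can be collected.\<close>
  also have "\<dots> = (\<phi> ?w' \<ominus>\<^bsub>M\<^esub> (scal A M r (\<phi> ?w) \<oplus>\<^bsub>M\<^esub> scal A M (r \<otimes>\<^bsub>K\<^esub> ?e) v))
      \<oplus>\<^bsub>M\<^esub> (scal A M (r \<otimes>\<^bsub>K\<^esub> ?e) v \<oplus>\<^bsub>M\<^esub> scal A M c v)"
    using cl by (intro *[symmetric]) auto
  also have "\<dots> = (\<phi> ?w' \<ominus>\<^bsub>M\<^esub> scal A M r ?w') \<oplus>\<^bsub>M\<^esub> scal A M ((?e \<otimes>\<^bsub>K\<^esub> r) \<oplus>\<^bsub>K\<^esub> c) v"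
    using cl space.R.m_comm[of ?e r]
    by (simp add: scal_add[OF M] scal_mult[OF M] add_scal[OF M] del: horner.simps)
  finally show ?case by simp
next
  case ("2_1" r)
  then show ?case by simp
next
  case ("2_2" r c)
  have "\<ominus>\<^bsub>M\<^esub> \<zero>\<^bsub>M\<^esub> = \<zero>\<^bsub>M\<^esub>"
    by (rule M.M.minus_equality) auto
  with "2_2" show ?case
    by (simp add: v scal_closed[OF M] linear_maps_zero[OF M M \<phi>] scal_zero_right[OF M] M.M.minus_eq)
qed

text \<open>The \<open>l\<close>s cut the polynomials down to a subspace that still has elements of arbitrarily high degree.\<close>

lemma poly_act_annihilated:
  assumes "set ls \<subseteq> linear_forms K A M"
  shows "\<exists>p. length p > n \<and> set p \<subseteq> carrier K \<and> last p \<noteq> \<zero>\<^bsub>K\<^esub> \<and> (\<forall>l\<in>set ls. l (poly_act M \<phi> v p) = \<zero>\<^bsub>K\<^esub>)"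
  using assms
proof (induction ls arbitrary: n)
  case Nil
  \<comment> \<open>The monomial X^n, a list of length n + 1.\<close>
  show ?case
    by (intro exI[of _ "replicate n \<zero>\<^bsub>K\<^esub> @ [\<one>\<^bsub>K\<^esub>]"]) auto
next
  case (Cons l ls)
  then have l: "l \<in> linear_forms K A M" and ls: "set ls \<subseteq> linear_forms K A M" by auto
  from Cons.IH[OF ls, of n] obtain p where "length p > n \<and> set p \<subseteq> carrier K \<and> last p \<noteq> \<zero>\<^bsub>K\<^esub> \<and>
    (\<forall>l\<in>set ls. l (poly_act M \<phi> v p) = \<zero>\<^bsub>K\<^esub>)" ..
  then have p: "length p > n" "set p \<subseteq> carrier K" "last p \<noteq> \<zero>\<^bsub>K\<^esub>"
    "\<And>l. l \<in> set ls \<Longrightarrow> l (poly_act M \<phi> v p) = \<zero>\<^bsub>K\<^esub>" by auto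
  \<comment> \<open>A second polynomial of larger degree: whatever multiple of p is added to it, its
    leading coefficient survives.\<close>
  from Cons.IH[OF ls, of "length p"] obtain q where "length q > length p \<and> set q \<subseteq> carrier K \<and> last q \<noteq> \<zero>\<^bsub>K\<^esub> \<and>
    (\<forall>l\<in>set ls. l (poly_act M \<phi> v q) = \<zero>\<^bsub>K\<^esub>)" ..
  then have q: "length q > length p" "set q \<subseteq> carrier K" "last q \<noteq> \<zero>\<^bsub>K\<^esub>"
    "\<And>l. l \<in> set ls \<Longrightarrow> l (poly_act M \<phi> v q) = \<zero>\<^bsub>K\<^esub>" by auto
  let ?x = "poly_act M \<phi> v p" and ?y = "poly_act M \<phi> v q"
  have xy: "?x \<in> carrier M" "?y \<in> carrier M" using p q poly_act_closed by auto
  show ?case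
  proof (cases "l ?x = \<zero>\<^bsub>K\<^esub>")
    case True
    with p show ?thesis by (intro exI[of _ p]) auto
  next
    case False
    \<comment> \<open>The solution of l(y) + k l(x) = 0, where x and y are the values of p and
      q.\<close>
    define k where "k = \<ominus>\<^bsub>K\<^esub> (l ?y \<otimes>\<^bsub>K\<^esub> inv\<^bsub>K\<^esub> (l ?x))"
    have lx: "l ?x \<in> Units K" using False linear_formsD(1)[OF l xy(1)] by (simp add: space.field_Units)
    have ly: "l ?y \<in> carrier K" using linear_formsD(1)[OF l xy(2)] .
    have k: "k \<in> carrier K" using lx ly by (simp add: k_def)
    let ?p = "p @ replicate (length q - length p) \<zero>\<^bsub>K\<^esub>"
    let ?q = "map2 (\<lambda>c d. c \<oplus>\<^bsub>K\<^esub> (k \<otimes>\<^bsub>K\<^esub> d)) q ?p"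
    have len: "length q = length ?p" using q(1) by simp
    have p': "set ?p \<subseteq> carrier K" using p(2) by auto
    have act: "poly_act M \<phi> v ?q = ?y \<oplus>\<^bsub>M\<^esub> scal A M k ?x"
      using poly_act_comb[OF len q(2) p' k] poly_act_pad[OF p(2)] by simp
    have lact: "l' (poly_act M \<phi> v ?q) = l' ?y \<oplus>\<^bsub>K\<^esub> k \<otimes>\<^bsub>K\<^esub> l' ?x" if "l' \<in> linear_forms K A M" for l'
      using xy k by (simp add: act linear_formsD[OF that] scal_closed[OF M])
    have "k \<otimes>\<^bsub>K\<^esub> l ?x = \<ominus>\<^bsub>K\<^esub> l ?y"
      using lx ly linear_formsD(1)[OF l xy(1)] by (simp add: k_def space.R.l_minus space.R.m_assoc)
    then have "l (poly_act M \<phi> v ?q) = \<zero>\<^bsub>K\<^esub>"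
      using ly by (simp add: lact[OF l] space.R.r_neg)
    moreover have "l' (poly_act M \<phi> v ?q) = \<zero>\<^bsub>K\<^esub>" if "l' \<in> set ls" for l'
      using lact[of l'] that ls p(4)[OF that] q(4)[OF that] k by auto
    moreover have "set ?q \<subseteq> carrier K"
    proof
      fix x assume "x \<in> set ?q"
      then obtain c d where cd: "(c, d) \<in> set (zip q ?p)" "x = c \<oplus>\<^bsub>K\<^esub> (k \<otimes>\<^bsub>K\<^esub> d)" by auto
      then have "c \<in> carrier K" "d \<in> carrier K"
        using q(2) p' set_zip_leftD[OF cd(1)] set_zip_rightD[OF cd(1)] by auto
      then show "x \<in> carrier K" using cd(2) k by simp
    qed
    moreover have "last ?q = last q"
    proof -
      have ne: "q \<noteq> []" "replicate (length q - length p) \<zero>\<^bsub>K\<^esub> \<noteq> []" using q(1) by auto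
      have "last ?p = \<zero>\<^bsub>K\<^esub>" using ne by (simp add: last_replicate)
      moreover have "last (zip q ?p) = (last q, last ?p)"
        using ne len by (intro last_zip) auto
      moreover have "zip q ?p \<noteq> []" using ne len by (metis length_0_conv length_zip min.idem)
      moreover have "last q \<in> carrier K" using q(2) last_in_set[OF ne(1)] by blast
      ultimately show ?thesis
        using k by (simp add: last_map)
    qed
    ultimately show ?thesis
      using q p(1) by (intro exI[of _ ?q]) auto
  qed
qed

text \<open>Without eigenvectors every \<phi> - r is injective, and dividing off roots one at a time
  shows p(\<phi>) v \<noteq> 0 for every p with nonzero leading coefficient. The finitely many forms
  of \<beta>, however, can be made to vanish at p(\<phi>) v for some such p, which forces p(\<phi>)
  v = 0. This takes the place of a minimal polynomial.\<close>

lemma eigenvector_exists: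
  assumes alg: "algebraically_closed K" and \<beta>: "dual_system M \<beta>" and v0: "v \<noteq> \<zero>\<^bsub>M\<^esub>"
  shows "\<exists>r\<in>carrier K. \<exists>x\<in>carrier M. x \<noteq> \<zero>\<^bsub>M\<^esub> \<and> \<phi> x = scal A M r x"
proof (rule ccontr)
  assume "\<not> ?thesis"
  then have no: "x = \<zero>\<^bsub>M\<^esub>" if "r \<in> carrier K" "x \<in> carrier M" "\<phi> x = scal A M r x" for r x
    using that by blast
  have nz: "poly_act M \<phi> v p \<noteq> \<zero>\<^bsub>M\<^esub>" if "p \<noteq> []" "set p \<subseteq> carrier K" "last p \<noteq> \<zero>\<^bsub>K\<^esub>" for p
    using that
  proof (induction p rule: length_induct)
    case (1 p)
    show ?case
    proof (cases "length p \<ge> 2")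
      case False
      with 1 obtain a where p: "p = [a]" by (cases p) (auto simp: Suc_le_eq)
      have a: "a \<in> Units K" using 1 p by (simp add: space.field_Units)
      have "scal A M a v \<noteq> \<zero>\<^bsub>M\<^esub>"
      proof
        assume 0: "scal A M a v = \<zero>\<^bsub>M\<^esub>"
        have "v = scal A M (inv\<^bsub>K\<^esub> a \<otimes>\<^bsub>K\<^esub> a) v" using a v by (simp add: scal_one[OF M])
        also have "\<dots> = scal A M (inv\<^bsub>K\<^esub> a) (scal A M a v)"
          using a v by (intro scal_mult[OF M]) auto
        finally show False using 0 a v0 by (simp add: scal_zero_right[OF M])
      qed
      then show ?thesis using space.R.Units_closed[OF a] v by (simp add: p linear_maps_zero[OF M M \<phi>] scal_closed[OF M])
    next
      case True
      have "\<exists>r\<in>carrier K. space.R.eval (rev p) r = \<zero>\<^bsub>K\<^esub>"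
        using 1 True by (intro algebraically_closed.root_exists[OF alg]) (auto simp: hd_rev)
      then obtain r where r: "r \<in> carrier K" "horner r p = \<zero>\<^bsub>K\<^esub>"
        using horner_eval 1 by auto
      let ?q = "horner_quotient r p"
      let ?w = "poly_act M \<phi> v ?q"
      have q: "set ?q \<subseteq> carrier K" "length ?q = length p - 1" "last ?q = last p"
        using horner_quotient[OF r(1)] 1 True by auto
      have w: "?w \<in> carrier M" by (rule poly_act_closed[OF q(1)])
      have "?q \<noteq> []" "length ?q < length p" using q(2) True by auto
      then have w0: "?w \<noteq> \<zero>\<^bsub>M\<^esub>"
        using 1 q by (auto simp del: poly_act.simps)
      have "poly_act M \<phi> v p = \<phi> ?w \<ominus>\<^bsub>M\<^esub> scal A M r ?w"
        using poly_act_division[OF r(1) 1(3,2)] r w v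
        by (simp add: scal_zero[OF M] linear_mapsD(1)[OF \<phi>] scal_closed[OF M])
      then show ?thesis
        using no[OF r(1) w] w0 w r(1) linear_mapsD(1)[OF \<phi> w] scal_closed[OF M r(1) w] by auto
    qed
  qed
  have "set (map snd \<beta>) \<subseteq> linear_forms K A M" using dual_systemD(2)[OF \<beta>] by auto
  \<comment> \<open>The bound 0 serves to exclude the empty list.\<close>
  from poly_act_annihilated[OF this, of 0] obtain p where p: "p \<noteq> []" "set p \<subseteq> carrier K" "last p \<noteq> \<zero>\<^bsub>K\<^esub>"
    "\<And>q. q \<in> set \<beta> \<Longrightarrow> snd q (poly_act M \<phi> v p) = \<zero>\<^bsub>K\<^esub>" by auto
  have "lsum M (\<lambda>q. scal A M (snd q (poly_act M \<phi> v p)) (fst q)) \<beta> = \<zero>\<^bsub>M\<^esub>"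
    using p(4) dual_systemD(1)[OF \<beta>] by (intro M.M.lsum_zero) (simp add: scal_zero[OF M])
  then show False
    using nz[OF p(1-3)] dual_systemD(4)[OF \<beta> poly_act_closed[OF p(2)]] by simp
qed

end


section \<open>Schur's lemma and the density theorem\<close>

lemma simple_rmodule_nonzero:
  assumes "right_module A S" "simple_rmodule A S"
  shows "\<exists>x\<in>carrier S. x \<noteq> \<zero>\<^bsub>S\<^esub>"
proof -
  interpret S: right_module A S by fact
  show ?thesis using assms(2) S.M.zero_closed unfolding simple_rmodule_def by blast
qed

text \<open>Negatives come from the action of -1, and z excludes the zero submodule.\<close>

lemma simple_rmodule_submodule_eq:
  assumes S: "right_module A S" "simple_rmodule A S"
    and N: "N \<subseteq> carrier S" "\<And>x y. x \<in> N \<Longrightarrow> y \<in> N \<Longrightarrow> x \<oplus>\<^bsub>S\<^esub> y \<in> N"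
      "\<And>x a. x \<in> N \<Longrightarrow> a \<in> carrier A \<Longrightarrow> x \<lhd>\<^bsub>S\<^esub> a \<in> N"
    and z: "z \<in> N" "z \<noteq> \<zero>\<^bsub>S\<^esub>"
  shows "N = carrier S"
proof -
  interpret S: right_module A S by fact
  have neg: "\<ominus>\<^bsub>S\<^esub> x = x \<lhd>\<^bsub>S\<^esub> (\<ominus>\<^bsub>A\<^esub> \<one>\<^bsub>A\<^esub>)" if "x \<in> carrier S" for x
  proof (rule S.M.minus_equality)
    have "(x \<lhd>\<^bsub>S\<^esub> (\<ominus>\<^bsub>A\<^esub> \<one>\<^bsub>A\<^esub>)) \<oplus>\<^bsub>S\<^esub> x = x \<lhd>\<^bsub>S\<^esub> (\<ominus>\<^bsub>A\<^esub> \<one>\<^bsub>A\<^esub> \<oplus>\<^bsub>A\<^esub> \<one>\<^bsub>A\<^esub>)"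
      using that by (simp add: S.ract_add S.ract_one del: space.M.l_neg)
    also have "\<dots> = scal A S \<zero>\<^bsub>K\<^esub> x"
      using that by (simp add: space.M.l_neg scal_def)
    finally show "(x \<lhd>\<^bsub>S\<^esub> (\<ominus>\<^bsub>A\<^esub> \<one>\<^bsub>A\<^esub>)) \<oplus>\<^bsub>S\<^esub> x = \<zero>\<^bsub>S\<^esub>"
      using that by (simp add: scal_zero[OF S(1)])
  qed (use that in \<open>auto simp: S.ract_closed\<close>)
  have "subgroup N (add_monoid S)"
  proof (rule group.subgroupI[OF S.M.a_group])
    show "inv\<^bsub>add_monoid S\<^esub> x \<in> N" if "x \<in> N" for x
      using that N(1) N(3)[OF that, of "\<ominus>\<^bsub>A\<^esub> \<one>\<^bsub>A\<^esub>"] neg[of x] by (auto simp: a_inv_def)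
  qed (use N z in auto)
  then have "rsubmodule A S N"
    using N(3) by (auto simp: rsubmodule_def additive_subgroup_def)
  then show ?thesis
    using S(2) z unfolding simple_rmodule_def by blast
qed

text \<open>The eigenspace of an eigenvalue is a nonzero submodule, hence all of S.\<close>

lemma schur:
  assumes alg: "algebraically_closed K" and S: "right_module A S" "simple_rmodule A S" "dual_system S \<beta>"
    and \<phi>: "\<phi> \<in> linear_maps K A S S"
      "\<And>x a. x \<in> carrier S \<Longrightarrow> a \<in> carrier A \<Longrightarrow> \<phi> (x \<lhd>\<^bsub>S\<^esub> a) = \<phi> x \<lhd>\<^bsub>S\<^esub> a"
  shows "\<exists>r\<in>carrier K. \<forall>x\<in>carrier S. \<phi> x = scal A S r x"
proof -
  interpret S: right_module A S by fact
  obtain v where v: "v \<in> carrier S" "v \<noteq> \<zero>\<^bsub>S\<^esub>" using simple_rmodule_nonzero[OF S(1,2)] by blast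
  obtain r x where r: "r \<in> carrier K" and x: "x \<in> carrier S" "x \<noteq> \<zero>\<^bsub>S\<^esub>" "\<phi> x = scal A S r x"
    using eigenvector_exists[OF S(1) \<phi>(1) v(1) alg S(3) v(2)] by blast
  have "{x \<in> carrier S. \<phi> x = scal A S r x} = carrier S"
    using r x by (intro simple_rmodule_submodule_eq[OF S(1,2)])
      (auto simp: linear_mapsD[OF \<phi>(1)] \<phi>(2) scal_add[OF S(1)] scal_ract[OF S(1)] S.ract_closed)
  then show ?thesis using r by blast
qed

text \<open>Adjoins one vector at a time, matching the induction on \<open>F\<close> in
  \<open>annihilator_separates\<close>.\<close>

primrec list_span :: "('c, 'e, 'r) rmodule_scheme \<Rightarrow> 'e list \<Rightarrow> 'e set" where
  "list_span M [] = {\<zero>\<^bsub>M\<^esub>}"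
| "list_span M (f # F) = {scal A M c f \<oplus>\<^bsub>M\<^esub> x |c x. c \<in> carrier K \<and> x \<in> list_span M F}"

lemma list_span_closed:
  assumes "right_module A M" "set F \<subseteq> carrier M"
  shows "list_span M F \<subseteq> carrier M"
proof -
  interpret M: right_module A M by fact
  show ?thesis using assms(2) by (induction F) (auto intro!: scal_closed[OF assms(1)])
qed

lemma list_span_subset_Cons:
  assumes M: "right_module A M" and F: "set (f # F) \<subseteq> carrier M"
  shows "list_span M F \<subseteq> list_span M (f # F)"
proof
  interpret M: right_module A M by fact
  fix x assume x: "x \<in> list_span M F"
  then have "x \<in> carrier M" using list_span_closed[OF M, of F] F by auto
  then have "x = scal A M \<zero>\<^bsub>K\<^esub> f \<oplus>\<^bsub>M\<^esub> x" using F by (simp add: scal_zero[OF M])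
  then show "x \<in> list_span M (f # F)" using x by auto
qed

lemma list_span_linear_map:
  assumes M: "right_module A M" and N: "right_module A N" and f: "f \<in> linear_maps K A M N"
    and F: "set F \<subseteq> carrier M" "\<And>x. x \<in> set F \<Longrightarrow> f x = \<zero>\<^bsub>N\<^esub>"
    and x: "x \<in> list_span M F"
  shows "f x = \<zero>\<^bsub>N\<^esub>"
  using F x
proof (induction F arbitrary: x)
  case Nil
  then show ?case by (simp add: linear_maps_zero[OF M N f])
next
  case (Cons y F)
  interpret N: right_module A N by fact
  from Cons.prems obtain c z where cz: "c \<in> carrier K" "z \<in> list_span M F" "x = scal A M c y \<oplus>\<^bsub>M\<^esub> z" by auto
  then have "z \<in> carrier M" using list_span_closed[OF M, of F] Cons.prems by auto
  moreover have "f z = \<zero>\<^bsub>N\<^esub>" using Cons cz by auto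
  ultimately show ?case
    using cz Cons.prems by (simp add: linear_mapsD[OF f] scal_closed[OF M] scal_zero_right[OF N])
qed

text \<open>
  Jacobson density: if every \<open>a\<close> that annihilates \<open>F\<close> and \<open>f\<close> annihilated \<open>s\<close>, then \<open>f a \<mapsto> s a\<close> would
  be a scalar \<open>r\<close>, and \<open>s - r f\<close> would contradict the induction hypothesis.
\<close>

lemma annihilator_separates:
  assumes alg: "algebraically_closed K" and S: "right_module A S" "simple_rmodule A S" "dual_system S \<beta>"
  shows "set F \<subseteq> carrier S \<Longrightarrow> s \<in> carrier S \<Longrightarrow> s \<notin> list_span S F \<Longrightarrow>
    \<exists>a\<in>carrier A. (\<forall>f\<in>set F. f \<lhd>\<^bsub>S\<^esub> a = \<zero>\<^bsub>S\<^esub>) \<and> s \<lhd>\<^bsub>S\<^esub> a \<noteq> \<zero>\<^bsub>S\<^esub>"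
proof (induction F arbitrary: s)
  case Nil
  interpret S: right_module A S by (fact S)
  show ?case using Nil by (intro bexI[of _ "\<one>\<^bsub>A\<^esub>"]) (auto simp: S.ract_one)
next
  case (Cons f F)
  interpret S: right_module A S by (fact S)
  have f: "f \<in> carrier S" and F: "set F \<subseteq> carrier S" and s: "s \<in> carrier S"
    using Cons.prems by auto
  define L where "L = {a \<in> carrier A. \<forall>f\<in>set F. f \<lhd>\<^bsub>S\<^esub> a = \<zero>\<^bsub>S\<^esub>}"
  have L: "L \<subseteq> carrier A" by (auto simp: L_def)
  note LA = subsetD[OF L]
  have minus_act: "x \<lhd>\<^bsub>S\<^esub> (a \<ominus>\<^bsub>A\<^esub> b) = (x \<lhd>\<^bsub>S\<^esub> a) \<ominus>\<^bsub>S\<^esub> (x \<lhd>\<^bsub>S\<^esub> b)"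
    if "x \<in> carrier S" "a \<in> carrier A" "b \<in> carrier A" for x a b
    using that by (intro additive_minus[OF space.M.abelian_group_axioms S.M.abelian_group_axioms])
      (auto simp: S.ract_closed S.ract_add)
  have L_add: "a \<oplus>\<^bsub>A\<^esub> b \<in> L" and L_minus: "a \<ominus>\<^bsub>A\<^esub> b \<in> L" if "a \<in> L" "b \<in> L" for a b
    using that F by (auto simp: L_def S.ract_add minus_act S.M.minus_eq S.M.r_neg subset_iff)
  have L_mult: "a \<otimes>\<^bsub>A\<^esub> b \<in> L" if "a \<in> L" "b \<in> carrier A" for a b
    using that F by (auto simp: L_def S.ract_mult S.zero_ract subset_iff)
  show ?case
  proof (cases "f \<in> list_span S F")
    case True
    \<comment> \<open>Here f is redundant: whatever annihilates \<open>F\<close> annihilates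
      f.\<close>
    have "s \<notin> list_span S F" using Cons.prems list_span_subset_Cons[OF S(1), of f F] by auto
    from Cons.IH[OF F s this] obtain a where a': "a \<in> carrier A"
      "(\<forall>f\<in>set F. f \<lhd>\<^bsub>S\<^esub> a = \<zero>\<^bsub>S\<^esub>) \<and> s \<lhd>\<^bsub>S\<^esub> a \<noteq> \<zero>\<^bsub>S\<^esub>" ..
    then have a: "a \<in> L" "s \<lhd>\<^bsub>S\<^esub> a \<noteq> \<zero>\<^bsub>S\<^esub>" by (simp_all add: L_def)
    have "f \<lhd>\<^bsub>S\<^esub> a = \<zero>\<^bsub>S\<^esub>"
      using list_span_linear_map[OF S(1,1) ract_linear[OF S(1) a'(1)] F _ True] a'(2) by simp
    then show ?thesis using a' by (intro bexI[OF _ a'(1)]) simp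
  next
    case False
    show ?thesis
    proof (rule ccontr)
      assume no: "\<not> ?thesis"
      have kill: "s \<lhd>\<^bsub>S\<^esub> a = \<zero>\<^bsub>S\<^esub>" if "a \<in> L" "f \<lhd>\<^bsub>S\<^esub> a = \<zero>\<^bsub>S\<^esub>" for a
        using that no by (simp add: L_def) blast
      from Cons.IH[OF F f False] obtain a0 where "a0 \<in> carrier A"
        "(\<forall>f\<in>set F. f \<lhd>\<^bsub>S\<^esub> a0 = \<zero>\<^bsub>S\<^esub>) \<and> f \<lhd>\<^bsub>S\<^esub> a0 \<noteq> \<zero>\<^bsub>S\<^esub>" ..
      then have a0: "a0 \<in> L" "f \<lhd>\<^bsub>S\<^esub> a0 \<noteq> \<zero>\<^bsub>S\<^esub>" by (simp_all add: L_def)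
      \<comment> \<open>f L is a submodule because L is a right ideal, and it contains the nonzero
        vector f a0.\<close>
      have "(\<lambda>a. f \<lhd>\<^bsub>S\<^esub> a) ` L = carrier S"
      proof (rule simple_rmodule_submodule_eq[OF S(1,2)])
        show "f \<lhd>\<^bsub>S\<^esub> a0 \<in> (\<lambda>a. f \<lhd>\<^bsub>S\<^esub> a) ` L" using a0 by simp
        show "x \<oplus>\<^bsub>S\<^esub> y \<in> (\<lambda>a. f \<lhd>\<^bsub>S\<^esub> a) ` L" if xy: "x \<in> (\<lambda>a. f \<lhd>\<^bsub>S\<^esub> a) ` L" "y \<in> (\<lambda>a. f \<lhd>\<^bsub>S\<^esub> a) ` L" for x y
        proof -
          obtain a b where "a \<in> L" "b \<in> L" "x = f \<lhd>\<^bsub>S\<^esub> a" "y = f \<lhd>\<^bsub>S\<^esub> b" using xy by auto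
          then show ?thesis using L f L_add by (intro image_eqI[of _ _ "a \<oplus>\<^bsub>A\<^esub> b"]) (auto simp: S.ract_add LA)
        qed
        show "x \<lhd>\<^bsub>S\<^esub> b \<in> (\<lambda>a. f \<lhd>\<^bsub>S\<^esub> a) ` L" if xb: "x \<in> (\<lambda>a. f \<lhd>\<^bsub>S\<^esub> a) ` L" "b \<in> carrier A" for x b
        proof -
          obtain a where "a \<in> L" "x = f \<lhd>\<^bsub>S\<^esub> a" using xb by auto
          then show ?thesis using L f xb L_mult by (intro image_eqI[of _ _ "a \<otimes>\<^bsub>A\<^esub> b"]) (auto simp: S.ract_mult LA)
        qed
      qed (use f a0 in \<open>auto simp: S.ract_closed LA\<close>)
      then have "\<forall>x\<in>carrier S. \<exists>a\<in>L. f \<lhd>\<^bsub>S\<^esub> a = x" by (metis image_iff)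
      then obtain t where t: "\<And>x. x \<in> carrier S \<Longrightarrow> t x \<in> L \<and> f \<lhd>\<^bsub>S\<^esub> t x = x" by metis
      define \<phi> where "\<phi> x = s \<lhd>\<^bsub>S\<^esub> t x" for x
      \<comment> \<open>Independence of the choice of \<open>t\<close>: two elements of L with the
        same value on f differ by an element that kills f and hence, by \<open>kill\<close>, also
        s.\<close>
      have \<phi>: "\<phi> (f \<lhd>\<^bsub>S\<^esub> a) = s \<lhd>\<^bsub>S\<^esub> a" if a: "a \<in> L" for a
      proof -
        have x: "f \<lhd>\<^bsub>S\<^esub> a \<in> carrier S" using a f by (simp add: S.ract_closed LA)
        have tx: "t (f \<lhd>\<^bsub>S\<^esub> a) \<in> L" "f \<lhd>\<^bsub>S\<^esub> t (f \<lhd>\<^bsub>S\<^esub> a) = f \<lhd>\<^bsub>S\<^esub> a" using t[OF x] by auto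
        have AA: "a \<in> carrier A" "t (f \<lhd>\<^bsub>S\<^esub> a) \<in> carrier A" using a tx by (simp_all add: LA)
        have "f \<lhd>\<^bsub>S\<^esub> (t (f \<lhd>\<^bsub>S\<^esub> a) \<ominus>\<^bsub>A\<^esub> a) = \<zero>\<^bsub>S\<^esub>"
          using f AA x tx(2) by (simp add: minus_act S.M.minus_eq S.M.r_neg)
        from kill[OF L_minus[OF tx(1) a] this] show ?thesis
          using AA s by (simp add: minus_act \<phi>_def S.ract_closed)
      qed
      have ex: "\<exists>a\<in>L. a \<in> carrier A \<and> x = f \<lhd>\<^bsub>S\<^esub> a" if "x \<in> carrier S" for x
        using t[OF that] by (intro bexI[of _ "t x"]) (simp_all add: LA)
      have lin: "\<phi> \<in> linear_maps K A S S"
      proof (rule linear_mapsI)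
        fix x y assume "x \<in> carrier S" "y \<in> carrier S"
        then obtain a b where ab: "a \<in> L" "b \<in> L" "a \<in> carrier A" "b \<in> carrier A" "x = f \<lhd>\<^bsub>S\<^esub> a" "y = f \<lhd>\<^bsub>S\<^esub> b"
          using ex by meson
        show "\<phi> x \<in> carrier S" using ab s by (simp add: \<phi> S.ract_closed)
        show "\<phi> (x \<oplus>\<^bsub>S\<^esub> y) = \<phi> x \<oplus>\<^bsub>S\<^esub> \<phi> y"
          using ab s f \<phi>[OF L_add[OF ab(1,2)]] by (simp add: \<phi> S.ract_add)
      next
        fix c x assume c: "c \<in> carrier K" and "x \<in> carrier S"
        then obtain a where a: "a \<in> L" "a \<in> carrier A" "x = f \<lhd>\<^bsub>S\<^esub> a" using ex by meson
        then show "\<phi> (scal A S c x) = scal A S c (\<phi> x)"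
          using c s f \<phi>[OF L_mult[OF a(1), of "c \<odot>\<^bsub>A\<^esub> \<one>\<^bsub>A\<^esub>"]] by (simp add: \<phi> scal_def S.ract_mult)
      qed
      have ract: "\<phi> (x \<lhd>\<^bsub>S\<^esub> b) = \<phi> x \<lhd>\<^bsub>S\<^esub> b" if x: "x \<in> carrier S" and b: "b \<in> carrier A" for x b
      proof -
        obtain a where a: "a \<in> L" "a \<in> carrier A" "x = f \<lhd>\<^bsub>S\<^esub> a" using ex[OF x] by meson
        then show ?thesis
          using b s f \<phi>[OF L_mult[OF a(1) b]] by (simp add: \<phi> S.ract_mult)
      qed
      from schur[OF alg S lin ract] obtain r where r: "r \<in> carrier K" "\<forall>x\<in>carrier S. \<phi> x = scal A S r x" ..
      let ?s = "s \<ominus>\<^bsub>S\<^esub> scal A S r f"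
      have s': "?s \<in> carrier S" using s f r by (simp add: scal_closed[OF S(1)])
      have "?s \<lhd>\<^bsub>S\<^esub> a = \<zero>\<^bsub>S\<^esub>" if a: "a \<in> L" for a
        using LA[OF a] s f r(1) \<phi>[OF a] r(2)[rule_format, of "f \<lhd>\<^bsub>S\<^esub> a"]
        by (simp add: S.minus_ract scal_closed[OF S(1)] scal_ract[OF S(1)] S.ract_closed)
      \<comment> \<open>The contrapositive of the induction hypothesis.\<close>
      then have "?s \<in> list_span S F"
        using Cons.IH[OF F s'] by (auto simp: L_def)
      moreover have "s = scal A S r f \<oplus>\<^bsub>S\<^esub> ?s"
        using s f r by (simp add: S.M.minus_eq scal_closed[OF S(1)] S.M.a_lcomm S.M.r_neg)
      ultimately show False using Cons.prems(3) r(1) by auto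
    qed
  qed
qed


section \<open>Rank one operators and traceless derivations of a simple module\<close>

context
  fixes S :: "('c, 'e, 'r) rmodule_scheme" and \<beta>
  assumes alg: "algebraically_closed K"
    and S: "right_module A S" "simple_rmodule A S" "dual_system S \<beta>"
begin

interpretation S: right_module A S by (fact S)

text \<open>Rescale a form of \<beta> to get l(s) = 1. Density gives an a0 that annihilates ker l
  but not s, so that y a0 = l(y) s a0; as s a0 generates S, multiplying a0 by a suitable b reaches
  every x.\<close>

lemma rank_one_operators:
  assumes s: "s \<in> carrier S" "s \<noteq> \<zero>\<^bsub>S\<^esub>"
  shows "\<exists>l\<in>linear_forms K A S. l s = \<one>\<^bsub>K\<^esub> \<and>
    (\<forall>x\<in>carrier S. \<exists>a\<in>carrier A. \<forall>y\<in>carrier S. y \<lhd>\<^bsub>S\<^esub> a = scal A S (l y) x)"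
proof -
  have "\<exists>p\<in>set \<beta>. snd p s \<noteq> \<zero>\<^bsub>K\<^esub>"
  proof (rule ccontr)
    assume no: "\<not> ?thesis"
    have "lsum S (\<lambda>p. scal A S (snd p s) (fst p)) \<beta> = \<zero>\<^bsub>S\<^esub>"
      using no dual_systemD(1)[OF S(3)] by (intro S.M.lsum_zero) (simp add: scal_zero[OF S(1)])
    then show False using dual_systemD(4)[OF S(3) s(1)] s(2) by simp
  qed
  then obtain p where p: "p \<in> set \<beta>" "snd p s \<noteq> \<zero>\<^bsub>K\<^esub>" by blast
  have u: "snd p s \<in> Units K" using p dual_systemD(3)[OF S(3) p(1) s(1)] by (simp add: space.field_Units)
  define l where "l x = inv\<^bsub>K\<^esub> (snd p s) \<otimes>\<^bsub>K\<^esub> snd p x" for x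
  have l: "l \<in> linear_forms K A S"
    using linear_formsD[OF dual_systemD(2)[OF S(3) p(1)]] u
    by (intro linear_formsI) (auto simp: l_def space.R.r_distr space.R.m_lcomm)
  have ls: "l s = \<one>\<^bsub>K\<^esub>" using u by (simp add: l_def)
  note lc = linear_formsD(1)[OF l]
  \<comment> \<open>The images of the vectors of \<beta> under the projection y \<mapsto> y - l(y)
    s; they span ker l.\<close>
  define F where "F = map (\<lambda>p. fst p \<ominus>\<^bsub>S\<^esub> scal A S (l (fst p)) s) \<beta>"
  have F: "set F \<subseteq> carrier S"
    using dual_systemD(1)[OF S(3)] s(1) lc by (auto simp: F_def intro!: S.M.minus_closed scal_closed[OF S(1)])
  \<comment> \<open>This map kills \<open>F\<close> but not s, which places s outside the span of
    \<open>F\<close>.\<close>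
  have lin: "(\<lambda>x. scal A S (l x) s) \<in> linear_maps K A S S"
    using s(1) lc by (intro linear_mapsI)
      (simp_all add: scal_closed[OF S(1)] linear_formsD[OF l] add_scal[OF S(1)] scal_mult[OF S(1)])
  have "s \<notin> list_span S F"
  proof
    assume "s \<in> list_span S F"
    moreover have "scal A S (l x) s = \<zero>\<^bsub>S\<^esub>" if "x \<in> set F" for x
    proof -
      from that[unfolded F_def set_map] obtain q
        where q: "x = fst q \<ominus>\<^bsub>S\<^esub> scal A S (l (fst q)) s" "q \<in> set \<beta>" by (rule imageE)
      have q1: "fst q \<in> carrier S" using dual_systemD(1)[OF S(3) q(2)] .
      have "l x = l (fst q) \<ominus>\<^bsub>K\<^esub> l (scal A S (l (fst q)) s)"
        unfolding q(1) using s(1) q1 lc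
        by (intro additive_minus[OF S.M.abelian_group_axioms space.R.abelian_group_axioms])
          (auto simp: linear_formsD[OF l] scal_closed[OF S(1)])
      also have "\<dots> = \<zero>\<^bsub>K\<^esub>"
        using s(1) q1 lc[OF q1] by (simp add: linear_formsD(3)[OF l] ls space.R.minus_eq space.R.r_neg)
      finally show ?thesis using s(1) by (simp add: scal_zero[OF S(1)])
    qed
    ultimately have "scal A S (l s) s = \<zero>\<^bsub>S\<^esub>"
      using list_span_linear_map[OF S(1,1) lin F] by simp
    then show False using s by (simp add: ls scal_one[OF S(1)])
  qed
  from annihilator_separates[OF alg S F s(1) this] obtain a0 where a0: "a0 \<in> carrier A"
    "(\<forall>f\<in>set F. f \<lhd>\<^bsub>S\<^esub> a0 = \<zero>\<^bsub>S\<^esub>) \<and> s \<lhd>\<^bsub>S\<^esub> a0 \<noteq> \<zero>\<^bsub>S\<^esub>" ..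
  have surj: "(\<lambda>b. s \<lhd>\<^bsub>S\<^esub> (a0 \<otimes>\<^bsub>A\<^esub> b)) ` carrier A = carrier S" (is "?f ` _ = _")
  proof (rule simple_rmodule_submodule_eq[OF S(1,2)])
    show "?f ` carrier A \<subseteq> carrier S" using s a0 by (auto simp: S.ract_closed)
    show "s \<lhd>\<^bsub>S\<^esub> a0 \<in> ?f ` carrier A" using a0(1) by (intro image_eqI[of _ _ "\<one>\<^bsub>A\<^esub>"]) auto
    show "s \<lhd>\<^bsub>S\<^esub> a0 \<noteq> \<zero>\<^bsub>S\<^esub>" using a0(2) ..
  next
    fix x y assume "x \<in> ?f ` carrier A" "y \<in> ?f ` carrier A"
    then obtain b c where "b \<in> carrier A" "c \<in> carrier A" "x = ?f b" "y = ?f c" by (elim imageE)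
    then show "x \<oplus>\<^bsub>S\<^esub> y \<in> ?f ` carrier A"
      using s a0(1) by (intro image_eqI[of _ _ "b \<oplus>\<^bsub>A\<^esub> c"]) (simp_all add: r_distr S.ract_add)
  next
    fix x c assume "x \<in> ?f ` carrier A" and c: "c \<in> carrier A"
    then obtain b where "b \<in> carrier A" "x = ?f b" by (elim imageE)
    then show "x \<lhd>\<^bsub>S\<^esub> c \<in> ?f ` carrier A"
      using s a0(1) c by (intro image_eqI[of _ _ "b \<otimes>\<^bsub>A\<^esub> c"]) (simp_all add: S.ract_mult S.ract_closed)
  qed
  have "\<exists>a\<in>carrier A. \<forall>y\<in>carrier S. y \<lhd>\<^bsub>S\<^esub> a = scal A S (l y) x" if x: "x \<in> carrier S" for x
  proof -
    from x[folded surj] obtain b where b: "x = s \<lhd>\<^bsub>S\<^esub> (a0 \<otimes>\<^bsub>A\<^esub> b)" "b \<in> carrier A" by (rule imageE)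
    let ?a = "a0 \<otimes>\<^bsub>A\<^esub> b"
    have a: "?a \<in> carrier A" using a0(1) b(2) by simp
    have linx: "(\<lambda>y. scal A S (l y) x) \<in> linear_maps K A S S"
      using x lc by (intro linear_mapsI)
        (simp_all add: scal_closed[OF S(1)] linear_formsD[OF l] add_scal[OF S(1)] scal_mult[OF S(1)])
    have "fst p \<lhd>\<^bsub>S\<^esub> ?a = scal A S (l (fst p)) x" if p: "p \<in> set \<beta>" for p
    proof -
      have p1: "fst p \<in> carrier S" using dual_systemD(1)[OF S(3) p] .
      have "(fst p \<ominus>\<^bsub>S\<^esub> scal A S (l (fst p)) s) \<lhd>\<^bsub>S\<^esub> a0 = \<zero>\<^bsub>S\<^esub>"
        using a0(2) p by (simp add: F_def)
      then have "fst p \<lhd>\<^bsub>S\<^esub> a0 = scal A S (l (fst p)) s \<lhd>\<^bsub>S\<^esub> a0"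
        using p1 s(1) a0(1) lc[OF p1] by (simp add: S.minus_ract scal_closed[OF S(1)] S.ract_closed)
      then show ?thesis
        using p1 s(1) a0(1) b lc[OF p1] by (simp add: S.ract_mult scal_ract[OF S(1)] S.ract_closed)
    qed
    then have eq: "lsum S (\<lambda>p. scal A S (snd p y) (fst p \<lhd>\<^bsub>S\<^esub> ?a)) \<beta>
        = lsum S (\<lambda>p. scal A S (snd p y) (scal A S (l (fst p)) x)) \<beta>" for y
      by (intro lsum_cong) simp
    have "y \<lhd>\<^bsub>S\<^esub> ?a = scal A S (l y) x" if y: "y \<in> carrier S" for y
      using eq[of y] linear_map_expand[OF S(1,1,3) ract_linear[OF S(1) a] y]
        linear_map_expand[OF S(1,1,3) linx y] by simp
    then show ?thesis using a by blast
  qed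
  then show ?thesis using l ls by blast
qed

lemma simple_rmodule_transitive:
  assumes "v \<in> carrier S" "v \<noteq> \<zero>\<^bsub>S\<^esub>" "x \<in> carrier S"
  shows "\<exists>a\<in>carrier A. v \<lhd>\<^bsub>S\<^esub> a = x"
proof -
  from rank_one_operators[OF assms(1,2)] obtain l where l: "l v = \<one>\<^bsub>K\<^esub> \<and>
    (\<forall>x\<in>carrier S. \<exists>b\<in>carrier A. \<forall>y\<in>carrier S. y \<lhd>\<^bsub>S\<^esub> b = scal A S (l y) x)" ..
  note l = conjunct1[OF l] bspec[OF conjunct2[OF l]]
  from l(2)[OF assms(3)] obtain a where "a \<in> carrier A" "\<forall>y\<in>carrier S. y \<lhd>\<^bsub>S\<^esub> a = scal A S (l y) x" ..
  then show ?thesis using assms l(1) by (intro bexI[of _ a]) (simp_all add: scal_one[OF S(1)])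
qed

text \<open>
  Otherwise the image of the annihilator under \<open>D\<close>, a bimodule over the full matrix algebra,
  would contain a rank one idempotent, which has trace one.
\<close>

lemma traceless_derivation_annihilator:
  assumes tr: "traceless_derivations S" and D: "derivation S D"
    and a: "a \<in> carrier A" "\<And>x. x \<in> carrier S \<Longrightarrow> x \<lhd>\<^bsub>S\<^esub> a = \<zero>\<^bsub>S\<^esub>" and s: "s \<in> carrier S"
  shows "D s a = \<zero>\<^bsub>S\<^esub>"
proof (rule ccontr)
  assume nz: "D s a \<noteq> \<zero>\<^bsub>S\<^esub>"
  note Da = derivationD(1)[OF D a(1)]
  note D0 = linear_maps_zero[OF S(1,1) derivationD(1)[OF D]]
  have s0: "s \<noteq> \<zero>\<^bsub>S\<^esub>" using nz D0[OF a(1)] by auto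
  from rank_one_operators[OF s s0] obtain l where l: "l \<in> linear_forms K A S" and l': "l s = \<one>\<^bsub>K\<^esub> \<and>
    (\<forall>x\<in>carrier S. \<exists>b\<in>carrier A. \<forall>y\<in>carrier S. y \<lhd>\<^bsub>S\<^esub> b = scal A S (l y) x)" ..
  note l = l conjunct1[OF l'] bspec[OF conjunct2[OF l']]
  note lc = linear_formsD(1)[OF l(1)]
  \<comment> \<open>b acts as the rank one operator y \<mapsto> l(y) s, and c below carries D(s, a)
    back to s.\<close>
  from l(3)[OF s] obtain b where b: "b \<in> carrier A" "\<forall>y\<in>carrier S. y \<lhd>\<^bsub>S\<^esub> b = scal A S (l y) s" ..
  from simple_rmodule_transitive[OF derivationD(2)[OF D s a(1)] nz s] obtain c
    where c: "c \<in> carrier A" "D s a \<lhd>\<^bsub>S\<^esub> c = s" ..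
  \<comment> \<open>By the product rule D(y, b a) = D(y, b) a + D(y b, a) = l(y) D(s, a), since
    \<open>a\<close> annihilates S. As also y b a = 0, multiplying by c leaves l(y) s, which is
    idempotent because l(s) = 1 and has trace l(s).\<close>
  have "D y ((b \<otimes>\<^bsub>A\<^esub> a) \<otimes>\<^bsub>A\<^esub> c) = scal A S (l y) s" if y: "y \<in> carrier S" for y
  proof -
    have "D y (b \<otimes>\<^bsub>A\<^esub> a) = scal A S (l y) (D s a)"
      using y a b s lc[OF y] linear_mapsD(3)[OF Da]
      by (simp add: derivationD(5)[OF D] derivationD(2)[OF D] scal_closed[OF S(1)])
    moreover have "y \<lhd>\<^bsub>S\<^esub> (b \<otimes>\<^bsub>A\<^esub> a) = \<zero>\<^bsub>S\<^esub>"
      using y a b(1) by (simp add: S.ract_mult S.ract_closed)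
    ultimately show ?thesis
      using y a(1) b(1) c s lc[OF y] D0[OF c(1)] derivationD(2)[OF D s a(1)]
      by (simp add: derivationD(5)[OF D] scal_ract[OF S(1)] scal_closed[OF S(1)])
  qed
  then have "dual_trace \<beta> (\<lambda>y. D y ((b \<otimes>\<^bsub>A\<^esub> a) \<otimes>\<^bsub>A\<^esub> c)) = lsum K (\<lambda>p. snd p s \<otimes>\<^bsub>K\<^esub> l (fst p)) \<beta>"
    unfolding dual_trace_def using dual_systemD[OF S(3)] s lc
    by (intro lsum_cong) (simp add: linear_formsD(3)[OF dual_systemD(2)[OF S(3)]] space.R.m_comm)
  also have "\<dots> = \<one>\<^bsub>K\<^esub>"
    using linear_form_expand[OF S(1,3) l(1) s] l(2) by simp
  finally show False
    using tr D S(3) a(1) b(1) c(1) by (auto simp: traceless_derivations_def)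
qed

text \<open>By \<open>traceless_derivation_annihilator\<close>, D(s, a) depends only on how a acts
  on S. Put h(x) = D(s, t(x)), where t(x) acts as y \<mapsto> l(y) x. Since s t(x) = x and t(x a)
  acts like t(x) a, the product rule becomes h(x a) = h(x) a + D(x, a).\<close>

lemma traceless_derivation_inner:
  assumes tr: "traceless_derivations S" and D: "derivation S D"
  shows "\<exists>h\<in>carrier S \<rightarrow> carrier S. (\<forall>x\<in>carrier S. \<forall>y\<in>carrier S. h (x \<oplus>\<^bsub>S\<^esub> y) = h x \<oplus>\<^bsub>S\<^esub> h y) \<and>
    (\<forall>x\<in>carrier S. \<forall>a\<in>carrier A. h (x \<lhd>\<^bsub>S\<^esub> a) = (h x \<lhd>\<^bsub>S\<^esub> a) \<oplus>\<^bsub>S\<^esub> D x a)"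
proof -
  obtain s where s: "s \<in> carrier S" "s \<noteq> \<zero>\<^bsub>S\<^esub>" using simple_rmodule_nonzero[OF S(1,2)] by blast
  from rank_one_operators[OF s] obtain l where l: "l \<in> linear_forms K A S" and l': "l s = \<one>\<^bsub>K\<^esub> \<and>
    (\<forall>x\<in>carrier S. \<exists>b\<in>carrier A. \<forall>y\<in>carrier S. y \<lhd>\<^bsub>S\<^esub> b = scal A S (l y) x)" ..
  note l = l conjunct1[OF l'] bspec[OF conjunct2[OF l']]
  note lc = linear_formsD(1)[OF l(1)]
  obtain t where t: "\<And>x. x \<in> carrier S \<Longrightarrow> t x \<in> carrier A"
    "\<And>x y. x \<in> carrier S \<Longrightarrow> y \<in> carrier S \<Longrightarrow> y \<lhd>\<^bsub>S\<^esub> t x = scal A S (l y) x"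
    using l(3) by metis
  have D_eq: "D s a = D s b"
    if ab: "a \<in> carrier A" "b \<in> carrier A" "\<And>y. y \<in> carrier S \<Longrightarrow> y \<lhd>\<^bsub>S\<^esub> a = y \<lhd>\<^bsub>S\<^esub> b" for a b
  proof -
    have "y \<lhd>\<^bsub>S\<^esub> (a \<ominus>\<^bsub>A\<^esub> b) = \<zero>\<^bsub>S\<^esub>" if y: "y \<in> carrier S" for y
    proof -
      have "y \<lhd>\<^bsub>S\<^esub> (a \<ominus>\<^bsub>A\<^esub> b) = (y \<lhd>\<^bsub>S\<^esub> a) \<ominus>\<^bsub>S\<^esub> (y \<lhd>\<^bsub>S\<^esub> b)"
        using ab y by (intro additive_minus[OF space.M.abelian_group_axioms S.M.abelian_group_axioms])
          (auto simp: S.ract_closed S.ract_add)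
      then show ?thesis using ab y by (simp add: S.ract_closed S.M.minus_eq S.M.r_neg)
    qed
    then have "D s (a \<ominus>\<^bsub>A\<^esub> b) = \<zero>\<^bsub>S\<^esub>"
      using ab s(1) by (intro traceless_derivation_annihilator[OF tr D]) auto
    moreover have "D s (a \<ominus>\<^bsub>A\<^esub> b) = D s a \<ominus>\<^bsub>S\<^esub> D s b"
      using ab s(1) by (intro additive_minus[OF space.M.abelian_group_axioms S.M.abelian_group_axioms])
        (auto simp: derivationD[OF D])
    ultimately show ?thesis
      using ab s(1) by (simp add: derivationD(2)[OF D])
  qed
  define h where "h x = D s (t x)" for x
  have "h (x \<oplus>\<^bsub>S\<^esub> y) = h x \<oplus>\<^bsub>S\<^esub> h y" if "x \<in> carrier S" "y \<in> carrier S" for x y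
  proof -
    have "h (x \<oplus>\<^bsub>S\<^esub> y) = D s (t x \<oplus>\<^bsub>A\<^esub> t y)"
      unfolding h_def using that t lc by (intro D_eq) (simp_all add: S.ract_add scal_add[OF S(1)])
    then show ?thesis using that t s(1) by (simp add: h_def derivationD(4)[OF D])
  qed
  moreover have "h (x \<lhd>\<^bsub>S\<^esub> a) = (h x \<lhd>\<^bsub>S\<^esub> a) \<oplus>\<^bsub>S\<^esub> D x a" if "x \<in> carrier S" "a \<in> carrier A" for x a
  proof -
    have "h (x \<lhd>\<^bsub>S\<^esub> a) = D s (t x \<otimes>\<^bsub>A\<^esub> a)"
      unfolding h_def using that t lc
      by (intro D_eq) (simp_all add: S.ract_mult S.ract_closed scal_ract[OF S(1)])
    then show ?thesis
      using that t s(1) l(2) by (simp add: h_def derivationD(5)[OF D] scal_one[OF S(1)])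
  qed
  moreover have "h \<in> carrier S \<rightarrow> carrier S"
    using t s(1) by (auto simp: h_def derivationD(2)[OF D])
  ultimately show ?thesis by blast
qed

end

end

section \<open>Resolutions and self-extensions\<close>

lemma (in group) trivial_group_FactGroup_carrier: "trivial_group (G Mod carrier G)"
proof -
  have carr: "carrier (G Mod carrier G) = {carrier G}"
    using coset_join2[OF _ subgroup_self] one_closed by (auto simp: FactGroup_def RCOSETS_def)
  have "carrier G \<lhd> G"
    by (rule normal_invI[OF subgroup_self]) auto
  from normal.factorgroup_is_group[OF this] show ?thesis
    unfolding trivial_group_def carr by (simp add: FactGroup_def)
qed

context fd_algebra
begin

lemma traceless_derivations_zero:
  assumes M: "right_module A M" and 0: "carrier M \<subseteq> {\<zero>\<^bsub>M\<^esub>}"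
  shows "traceless_derivations M"
  unfolding traceless_derivations_def
proof (intro allI impI, elim conjE)
  fix D \<beta> a assume D: "derivation M D" and \<beta>: "dual_system M \<beta>" and a: "a \<in> carrier A"
  have "D (fst p) a = \<zero>\<^bsub>M\<^esub>" if "p \<in> set \<beta>" for p
    using derivationD(2)[OF D dual_systemD(1)[OF \<beta> that] a] 0 by auto
  then show "dual_trace \<beta> (\<lambda>x. D x a) = \<zero>\<^bsub>K\<^esub>"
    unfolding dual_trace_def
    using linear_forms_zero[OF M dual_systemD(2)[OF \<beta>]] by (intro space.R.lsum_zero) simp
qed

lemma dual_system_kernel_exists:
  assumes P: "fd_right_module K A P" and M: "right_module A M" "dual_system M \<beta>"
    and \<pi>: "\<pi> \<in> rmod_hom A P M" "\<pi> ` carrier P = carrier M"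
  shows "\<exists>\<gamma>. dual_system (P\<lparr>carrier := a_kernel P M \<pi>\<rparr>) \<gamma>"
proof -
  have P': "right_module A P" using P by (simp add: fd_right_module_def)
  from linear_section_exists[OF P' M rmod_hom_linear[OF \<pi>(1)] \<pi>(2)] obtain \<sigma>
    where \<sigma>: "\<sigma> \<in> linear_maps K A M P" "\<forall>x\<in>carrier M. \<pi> (\<sigma> x) = x" ..
  from dual_system_exists[OF P] obtain \<gamma> where "dual_system P \<gamma>" ..
  then show ?thesis
    using dual_system_kernel[OF P' M(1) \<pi>(1) \<sigma>(1) bspec[OF \<sigma>(2)]] by blast
qed

lemma projective_resolutionD:
  assumes "projective_resolution K A M (P, d, e)"
  shows "projective_rmodule K A (P i)" "d i \<in> rmod_hom A (P (Suc i)) (P i)"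
    and "e \<in> rmod_hom A (P 0) M" "e ` carrier (P 0) = carrier M"
    and "d 0 ` carrier (P (Suc 0)) = a_kernel (P 0) M e"
    and "d (Suc i) ` carrier (P (Suc (Suc i))) = a_kernel (P (Suc i)) (P i) (d i)"
  using assms by (auto simp: projective_resolution_def)

text \<open>A late enough syzygy is zero and has only traceless derivations;
  \<open>traceless_derivations_projective_cover\<close> carries this from each syzygy to the
  preceding one and finally to M.\<close>

lemma traceless_derivations_finite_projective_dimension:
  assumes M: "fd_right_module K A M" and pd: "projective_dimension K A M < \<infinity>"
  shows "traceless_derivations M"
proof -
  have M': "right_module A M" using M by (simp add: fd_right_module_def)
  from dual_system_exists[OF M] obtain \<beta> where \<beta>: "dual_system M \<beta>" ..
  obtain n P d e where R: "projective_resolution K A M (P, d, e)"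
    and n: "\<forall>i>n. carrier (P i) = {\<zero>\<^bsub>P i\<^esub>}"
  proof -
    \<comment> \<open>In \<open>enat\<close> the infimum of the empty set is \<infinity>, so a
      finite value provides a resolution of finite length.\<close>
    have "{enat n |n. \<exists>P d e. projective_resolution K A M (P, d, e) \<and> (\<forall>i>n. carrier (P i) = {\<zero>\<^bsub>P i\<^esub>})} \<noteq> {}"
    proof
      assume "{enat n |n. \<exists>P d e. projective_resolution K A M (P, d, e) \<and> (\<forall>i>n. carrier (P i) = {\<zero>\<^bsub>P i\<^esub>})} = {}"
      with pd show False unfolding projective_dimension_def by (simp only: Inf_enat_def) simp
    qed
    with that show ?thesis by blast
  qed
  note R = projective_resolutionD[OF R]
  have fdP: "fd_right_module K A (P i)" for i using R(1) by (simp add: projective_rmodule_def)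
  have P: "right_module A (P i)" for i using fdP by (simp add: fd_right_module_def)
  \<comment> \<open>Z i is the image of \<open>d i\<close> inside P i, that is, the syzygy of order
    i + 1 of M.\<close>
  define Z where "Z i = (P i)\<lparr>carrier := (case i of 0 \<Rightarrow> a_kernel (P 0) M e
    | Suc j \<Rightarrow> a_kernel (P (Suc j)) (P j) (d j))\<rparr>" for i
  have ZP: "\<zero>\<^bsub>Z i\<^esub> = \<zero>\<^bsub>P i\<^esub>" "add (Z i) = add (P i)" "ract (Z i) = ract (P i)" for i
    by (simp_all add: Z_def)
  have im: "d i ` carrier (P (Suc i)) = carrier (Z i)" for i
    using R(5,6) by (cases i) (simp_all add: Z_def)
  have hom: "d i \<in> rmod_hom A (P (Suc i)) (Z i)" for i
    using rmod_homD[OF R(2)[of i]] im[of i] by (intro rmod_homI) (auto simp: ZP)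
  have ker: "(P (Suc i))\<lparr>carrier := a_kernel (P (Suc i)) (Z i) (d i)\<rparr> = Z (Suc i)" for i
    by (simp add: Z_def a_kernel_def')
  have Z0: "(P 0)\<lparr>carrier := a_kernel (P 0) M e\<rparr> = Z 0" by (simp add: Z_def)
  have Z: "right_module A (Z i) \<and> (\<exists>\<gamma>. dual_system (Z i) \<gamma>)" for i
  proof (induction i)
    case 0
    show ?case
      using right_module_kernel[OF P M' R(3)] dual_system_kernel_exists[OF fdP M' \<beta> R(3,4)] by (simp add: Z0)
  next
    case (Suc i)
    then have Zi: "right_module A (Z i)" and "\<exists>\<gamma>. dual_system (Z i) \<gamma>" by auto
    from this(2) obtain \<gamma> where "dual_system (Z i) \<gamma>" ..
    from dual_system_kernel_exists[OF fdP Zi this hom im] right_module_kernel[OF P Zi hom]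
    show ?case by (simp add: ker)
  qed
  \<comment> \<open>Downward induction from Z (n + 1), which lies in P (n + 1) = 0.\<close>
  have "traceless_derivations (Z (n + 1 - i))" if "i \<le> n + 1" for i
    using that
  proof (induction i)
    case 0
    have "carrier (Z (Suc n)) \<subseteq> {\<zero>\<^bsub>Z (Suc n)\<^esub>}"
      using n by (auto simp: Z_def a_kernel_def')
    then show ?case using traceless_derivations_zero[OF conjunct1[OF Z]] by simp
  next
    case (Suc i)
    then have eq: "n + 1 - i = Suc (n + 1 - Suc i)" by simp
    let ?j = "n + 1 - Suc i"
    from conjunct2[OF Z] obtain \<gamma> where "dual_system (Z ?j) \<gamma>" ..
    from traceless_derivations_projective_cover[OF R(1) conjunct1[OF Z] this hom im]
    show ?case using Suc unfolding eq ker by simp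
  qed
  from this[of "n + 1"] have "traceless_derivations (Z 0)" by simp
  then show ?thesis
    using traceless_derivations_projective_cover[OF R(1) M' \<beta> R(3,4)] by (simp add: Z0)
qed

section \<open>From inner derivations to the vanishing of Ext\<close>

text \<open>
  The derivation is \<open>k\<close> applied to the failure of a linear section \<open>\<sigma>\<close> of \<open>\<pi>\<close> to be \<open>A\<close>-linear.
\<close>

lemma homomorphism_extends:
  assumes alg: "algebraically_closed K"
    and S: "right_module A S" "simple_rmodule A S" "dual_system S \<beta>" "traceless_derivations S"
    and P: "right_module A P" and \<pi>: "\<pi> \<in> rmod_hom A P S" "\<pi> ` carrier P = carrier S"
    and k: "k \<in> linear_maps K A (P\<lparr>carrier := a_kernel P S \<pi>\<rparr>) S"
    and k_ract: "\<And>x a. x \<in> a_kernel P S \<pi> \<Longrightarrow> a \<in> carrier A \<Longrightarrow> k (x \<lhd>\<^bsub>P\<^esub> a) = k x \<lhd>\<^bsub>S\<^esub> a"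
  shows "\<exists>g\<in>rmod_hom A P S. \<forall>x\<in>a_kernel P S \<pi>. g x = k x"
proof -
  interpret S: right_module A S by (fact S)
  interpret P: right_module A P by (fact P)
  let ?N = "P\<lparr>carrier := a_kernel P S \<pi>\<rparr>"
  note lin = rmod_hom_linear[OF \<pi>(1)]
  from linear_section_exists[OF P S(1,3) lin \<pi>(2)] obtain \<sigma>
    where \<sigma>: "\<sigma> \<in> linear_maps K A S P" and "\<forall>x\<in>carrier S. \<pi> (\<sigma> x) = x" ..
  note \<pi>\<sigma> = bspec[OF this(2)]
  note cl = linear_mapsD(1)[OF \<sigma>] linear_mapsD(1)[OF lin] P.ract_closed S.ract_closed
  have ker: "x \<in> a_kernel P S \<pi> \<longleftrightarrow> x \<in> carrier P \<and> \<pi> x = \<zero>\<^bsub>S\<^esub>" for x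
    by (simp add: a_kernel_def')
  have k_closed: "k x \<in> carrier S" if "x \<in> a_kernel P S \<pi>" for x
    using linear_mapsD(1)[OF k] that by simp
  have k_add: "k (x \<oplus>\<^bsub>P\<^esub> y) = k x \<oplus>\<^bsub>S\<^esub> k y" if "x \<in> a_kernel P S \<pi>" "y \<in> a_kernel P S \<pi>" for x y
    using linear_mapsD(2)[OF k] that by simp
  have k0: "k \<zero>\<^bsub>P\<^esub> = \<zero>\<^bsub>S\<^esub>"
    using linear_maps_zero[OF right_module_kernel[OF P S(1) \<pi>(1)] S(1) k] by simp
  \<comment> \<open>Its values lie in the kernel because \<pi> is \<open>A\<close>-linear and
    \<sigma> is a section of it, so \<open>k\<close> can be applied to them.\<close>
  define u where "u x a = \<sigma> (x \<lhd>\<^bsub>S\<^esub> a) \<ominus>\<^bsub>P\<^esub> (\<sigma> x \<lhd>\<^bsub>P\<^esub> a)" for x a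
  have u: "u x a \<in> a_kernel P S \<pi>" if "x \<in> carrier S" "a \<in> carrier A" for x a
    using that by (simp add: ker u_def cl linear_map_minus[OF P S(1) lin] \<pi>\<sigma> rmod_homD(4)[OF \<pi>(1)]
      S.M.minus_eq S.M.r_neg)
  have u_lin: "(\<lambda>x. u x a) \<in> linear_maps K A S ?N" if a: "a \<in> carrier A" for a
  proof -
    have "(\<lambda>x. u x a) \<in> linear_maps K A S P"
      unfolding u_def
      by (intro linear_maps_minus[OF S(1) P] linear_maps_comp[OF ract_linear[OF S(1) a] \<sigma>]
          linear_maps_comp[OF \<sigma> ract_linear[OF P a]])
    from linear_mapsD[OF this] show ?thesis
      using u a by (intro linear_mapsI) simp_all
  qed
  define D where "D x a = k (u x a)" for x a
  have D: "derivation S D"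
    unfolding derivation_def
  proof (intro conjI ballI)
    show "(\<lambda>x. D x a) \<in> linear_maps K A S S" if "a \<in> carrier A" for a
      unfolding D_def by (rule linear_maps_comp[OF u_lin[OF that] k])
  next
    fix x a b assume x: "x \<in> carrier S" and ab: "a \<in> carrier A" "b \<in> carrier A"
    have "u x (a \<oplus>\<^bsub>A\<^esub> b) = u x a \<oplus>\<^bsub>P\<^esub> u x b"
      using x ab by (simp add: u_def cl S.ract_add P.ract_add linear_mapsD(2)[OF \<sigma>] P.M.minus_eq
        P.M.minus_add P.M.a_ac)
    then show "D x (a \<oplus>\<^bsub>A\<^esub> b) = D x a \<oplus>\<^bsub>S\<^esub> D x b"
      using x ab by (simp add: D_def k_add u)
    \<comment> \<open>Telescope through \<sigma>(x a) b, the middle term between \<sigma>(x a b) and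
      \<sigma>(x) a b.\<close>
    have "u x (a \<otimes>\<^bsub>A\<^esub> b) = (u x a \<lhd>\<^bsub>P\<^esub> b) \<oplus>\<^bsub>P\<^esub> u (x \<lhd>\<^bsub>S\<^esub> a) b"
    proof -
      have *: "p \<ominus>\<^bsub>P\<^esub> r = (q \<ominus>\<^bsub>P\<^esub> r) \<oplus>\<^bsub>P\<^esub> (p \<ominus>\<^bsub>P\<^esub> q)"
        if "p \<in> carrier P" "q \<in> carrier P" "r \<in> carrier P" for p q r
      proof -
        have "(q \<ominus>\<^bsub>P\<^esub> r) \<oplus>\<^bsub>P\<^esub> (p \<ominus>\<^bsub>P\<^esub> q) = (p \<ominus>\<^bsub>P\<^esub> r) \<oplus>\<^bsub>P\<^esub> (q \<oplus>\<^bsub>P\<^esub> \<ominus>\<^bsub>P\<^esub> q)"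
          using that by (simp add: P.M.minus_eq P.M.a_ac del: P.M.r_neg)
        then show ?thesis using that by (simp add: P.M.minus_eq P.M.r_neg)
      qed
      show ?thesis
        using x ab *[of "\<sigma> (x \<lhd>\<^bsub>S\<^esub> a \<lhd>\<^bsub>S\<^esub> b)" "\<sigma> (x \<lhd>\<^bsub>S\<^esub> a) \<lhd>\<^bsub>P\<^esub> b" "\<sigma> x \<lhd>\<^bsub>P\<^esub> a \<lhd>\<^bsub>P\<^esub> b"]
        by (simp add: u_def cl S.ract_mult P.ract_mult P.minus_ract)
    qed
    moreover have "u x a \<lhd>\<^bsub>P\<^esub> b \<in> a_kernel P S \<pi>"
      using u[OF x ab(1)] ab by (simp add: ker cl rmod_homD(4)[OF \<pi>(1)] S.zero_ract)
    ultimately show "D x (a \<otimes>\<^bsub>A\<^esub> b) = (D x a \<lhd>\<^bsub>S\<^esub> b) \<oplus>\<^bsub>S\<^esub> D (x \<lhd>\<^bsub>S\<^esub> a) b"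
      using x ab by (simp add: D_def k_add u cl k_ract)
  next
    fix x c assume "x \<in> carrier S" "c \<in> carrier K"
    then have "u x (c \<odot>\<^bsub>A\<^esub> \<one>\<^bsub>A\<^esub>) = \<zero>\<^bsub>P\<^esub>"
      using linear_mapsD(3)[OF \<sigma>, of c x] by (simp add: u_def scal_def cl P.M.minus_eq P.M.r_neg)
    then show "D x (c \<odot>\<^bsub>A\<^esub> \<one>\<^bsub>A\<^esub>) = \<zero>\<^bsub>S\<^esub>" by (simp add: D_def k0)
  qed
  from traceless_derivation_inner[OF alg S(1,2,3,4) D] obtain h where h: "h \<in> carrier S \<rightarrow> carrier S"
    and h': "(\<forall>x\<in>carrier S. \<forall>y\<in>carrier S. h (x \<oplus>\<^bsub>S\<^esub> y) = h x \<oplus>\<^bsub>S\<^esub> h y) \<and>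
      (\<forall>x\<in>carrier S. \<forall>a\<in>carrier A. h (x \<lhd>\<^bsub>S\<^esub> a) = (h x \<lhd>\<^bsub>S\<^esub> a) \<oplus>\<^bsub>S\<^esub> D x a)" ..
  have hc: "h x \<in> carrier S" if "x \<in> carrier S" for x using h that by auto
  have h_add: "h (x \<oplus>\<^bsub>S\<^esub> y) = h x \<oplus>\<^bsub>S\<^esub> h y" if "x \<in> carrier S" "y \<in> carrier S" for x y
    using h' that by simp
  have h_ract: "h (x \<lhd>\<^bsub>S\<^esub> a) = (h x \<lhd>\<^bsub>S\<^esub> a) \<oplus>\<^bsub>S\<^esub> D x a" if "x \<in> carrier S" "a \<in> carrier A" for x a
    using h' that by simp
  have h0: "h \<zero>\<^bsub>S\<^esub> = \<zero>\<^bsub>S\<^esub>"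
    using additive_zero[OF S.M.abelian_group_axioms S.M.abelian_group_axioms h h_add] .
  define r where "r x = x \<ominus>\<^bsub>P\<^esub> \<sigma> (\<pi> x)" for x
  have r_lin: "r \<in> linear_maps K A P ?N"
    using linear_retraction[OF P S(1) \<pi>(1) \<sigma> \<pi>\<sigma>] by (simp add: r_def [abs_def])
  have r: "r x \<in> a_kernel P S \<pi>" if "x \<in> carrier P" for x using linear_mapsD(1)[OF r_lin that] by simp
  \<comment> \<open>The composite of k with the retraction r extends k, but k(r(x a)) differs from
    k(r x) a by -D(\<pi> x, a). The composite of h with \<pi> has the opposite defect and vanishes
    on the kernel.\<close>
  define g where "g = restrict (\<lambda>x. k (r x) \<oplus>\<^bsub>S\<^esub> h (\<pi> x)) (carrier P)"
  have "g \<in> rmod_hom A P S"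
  proof (rule rmod_homI)
    show "g x \<in> carrier S" if "x \<in> carrier P" for x
      using that by (simp add: g_def k_closed r hc cl)
    show "g (x \<oplus>\<^bsub>P\<^esub> y) = g x \<oplus>\<^bsub>S\<^esub> g y" if "x \<in> carrier P" "y \<in> carrier P" for x y
      using that linear_mapsD(2)[OF r_lin that]
      by (simp add: g_def k_add r linear_mapsD(2)[OF lin] h_add k_closed hc cl S.M.a_ac)
    show "g (x \<lhd>\<^bsub>P\<^esub> a) = g x \<lhd>\<^bsub>S\<^esub> a" if x: "x \<in> carrier P" and a: "a \<in> carrier A" for x a
    proof -
      have p: "\<pi> x \<in> carrier S" using x by (simp add: cl)
      have "r x \<lhd>\<^bsub>P\<^esub> a = r (x \<lhd>\<^bsub>P\<^esub> a) \<oplus>\<^bsub>P\<^esub> u (\<pi> x) a"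
        using x a by (simp add: r_def u_def P.minus_ract cl rmod_homD(4)[OF \<pi>(1)])
          (simp add: P.M.minus_eq cl P.M.a_assoc P.M.r_neg2 P.M.r_neg1)
      then have "k (r x) \<lhd>\<^bsub>S\<^esub> a = k (r (x \<lhd>\<^bsub>P\<^esub> a)) \<oplus>\<^bsub>S\<^esub> D (\<pi> x) a"
        using x a p by (simp add: D_def k_add r u cl flip: k_ract)
      moreover have "g (x \<lhd>\<^bsub>P\<^esub> a) = k (r (x \<lhd>\<^bsub>P\<^esub> a)) \<oplus>\<^bsub>S\<^esub> ((h (\<pi> x) \<lhd>\<^bsub>S\<^esub> a) \<oplus>\<^bsub>S\<^esub> D (\<pi> x) a)"
        using x a p by (simp add: g_def cl rmod_homD(4)[OF \<pi>(1)] h_ract)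
      moreover have "g x \<lhd>\<^bsub>S\<^esub> a = (k (r x) \<lhd>\<^bsub>S\<^esub> a) \<oplus>\<^bsub>S\<^esub> (h (\<pi> x) \<lhd>\<^bsub>S\<^esub> a)"
        using x a p by (simp add: g_def S.add_ract k_closed r hc)
      ultimately show ?thesis
        using x a p derivationD(2)[OF D p a] by (simp add: k_closed r hc cl S.M.a_ac)
    qed
  qed (simp add: g_def)
  moreover have "g x = k x" if x: "x \<in> a_kernel P S \<pi>" for x
  proof -
    have "r x = x"
      using x linear_retraction_kernel[OF P S(1) \<pi>(1) \<sigma> \<pi>\<sigma>, of x] by (simp add: r_def)
    then show ?thesis using x k_closed[OF x] by (simp add: g_def ker h0)
  qed
  ultimately show ?thesis by blast
qed

text \<open>The coboundaries will turn out to be all cocycles; the quotient of this group by itself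
  is then trivial.\<close>

lemma comm_group_cocycles:
  assumes R: "projective_resolution K A M (P, d, e)" and N: "right_module A N"
  shows "comm_group ((hom_group A (P n) N)\<lparr>carrier := cocycles A (P, d, e) N n\<rparr>)"
proof (rule comm_groupI)
  interpret N: right_module A N by fact
  let ?G = "(hom_group A (P n) N)\<lparr>carrier := cocycles A (P, d, e) N n\<rparr>"
  note R = projective_resolutionD[OF R]
  interpret P: right_module A "P n"
    using R(1)[of n] by (simp add: projective_rmodule_def fd_right_module_def)
  have coc: "f \<in> carrier ?G \<longleftrightarrow> f \<in> rmod_hom A (P n) N \<and> (\<forall>x\<in>carrier (P (Suc n)). f (d n x) = \<zero>\<^bsub>N\<^esub>)" for f
    by (auto simp: cocycles_def hom_group_def compose_def fun_eq_iff restrict_def)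
  have dc: "d n x \<in> carrier (P n)" if "x \<in> carrier (P (Suc n))" for x
    using rmod_homD(2)[OF R(2) that] .
  have mult: "f \<otimes>\<^bsub>?G\<^esub> g = (\<lambda>x\<in>carrier (P n). f x \<oplus>\<^bsub>N\<^esub> g x)" for f g
    by (simp add: hom_group_def)
  have one: "\<one>\<^bsub>?G\<^esub> = (\<lambda>x\<in>carrier (P n). \<zero>\<^bsub>N\<^esub>)" by (simp add: hom_group_def)
  have eqI: "f = g" if "f \<in> extensional (carrier (P n))" "g \<in> extensional (carrier (P n))"
    "\<And>x. x \<in> carrier (P n) \<Longrightarrow> f x = g x" for f g :: "'a list \<Rightarrow> 'g"
    using that by (rule extensionalityI)
  show "f \<otimes>\<^bsub>?G\<^esub> g \<in> carrier ?G" if "f \<in> carrier ?G" "g \<in> carrier ?G" for f g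
    using that rmod_homD[of f A "P n" N] rmod_homD[of g A "P n" N] unfolding coc mult
    by (auto simp: dc N.M.a_ac N.add_ract P.ract_closed intro!: rmod_homI)
  show "\<one>\<^bsub>?G\<^esub> \<in> carrier ?G"
    unfolding coc one by (auto simp: dc N.zero_ract P.ract_closed intro!: rmod_homI)
  show "f \<otimes>\<^bsub>?G\<^esub> g \<otimes>\<^bsub>?G\<^esub> h = f \<otimes>\<^bsub>?G\<^esub> (g \<otimes>\<^bsub>?G\<^esub> h)"
    if "f \<in> carrier ?G" "g \<in> carrier ?G" "h \<in> carrier ?G" for f g h
    using that rmod_homD(2)[of _ A "P n" N] unfolding coc mult by (intro eqI) (auto simp: N.M.a_assoc)
  show "f \<otimes>\<^bsub>?G\<^esub> g = g \<otimes>\<^bsub>?G\<^esub> f" if "f \<in> carrier ?G" "g \<in> carrier ?G" for f g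
    using that rmod_homD(2)[of _ A "P n" N] unfolding coc mult by (intro eqI) (auto simp: N.M.a_comm)
  show "\<one>\<^bsub>?G\<^esub> \<otimes>\<^bsub>?G\<^esub> f = f" if "f \<in> carrier ?G" for f
    using that rmod_homD(1,2)[of f A "P n" N] unfolding coc mult one by (intro eqI) auto
  show "\<exists>g\<in>carrier ?G. g \<otimes>\<^bsub>?G\<^esub> f = \<one>\<^bsub>?G\<^esub>" if f: "f \<in> carrier ?G" for f
  proof
    note f' = rmod_homD[of f A "P n" N] f[unfolded coc]
    let ?g = "\<lambda>x\<in>carrier (P n). \<zero>\<^bsub>N\<^esub> \<ominus>\<^bsub>N\<^esub> f x"
    show "?g \<otimes>\<^bsub>?G\<^esub> f = \<one>\<^bsub>?G\<^esub>"
      unfolding mult one using f' by (intro eqI) (auto simp: N.M.minus_eq N.M.l_neg)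
    have "(\<ominus>\<^bsub>N\<^esub> y) \<lhd>\<^bsub>N\<^esub> a = \<ominus>\<^bsub>N\<^esub> (y \<lhd>\<^bsub>N\<^esub> a)" if "y \<in> carrier N" "a \<in> carrier A" for y a
      using that N.minus_ract[of "\<zero>\<^bsub>N\<^esub>" y a] by (simp add: N.zero_ract N.M.minus_eq N.ract_closed)
    then have "?g \<in> rmod_hom A (P n) N"
      using f' by (intro rmod_homI)
        (auto simp: P.ract_closed N.ract_closed N.M.minus_eq N.M.minus_add)
    then show "?g \<in> carrier ?G"
      unfolding coc using f' dc by (auto simp: N.M.minus_eq N.M.r_neg)
  qed
qed

end

theorem corollary1p2:
  fixes K :: "('k, 'n) ring_scheme"
    and A :: "('k, 'a, 'm) module_scheme"
    and S :: "('a, 'b, 'r) rmodule_scheme"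
  assumes "algebraically_closed K"
    and "fd_algebra K A"
    and "mild_algebra K A"
    and "fd_right_module K A S"
    and "simple_rmodule A S"
    and "projective_dimension K A S < \<infinity>"
  shows "trivial_group (Ext K A 1 S S)"
proof -
  interpret fd_algebra K A by fact
  have S: "right_module A S" using assms(4) by (simp add: fd_right_module_def)
  interpret S: right_module A S by fact
  from dual_system_exists[OF assms(4)] obtain \<beta> where \<beta>: "dual_system S \<beta>" ..
  have tr: "traceless_derivations S"
    by (rule traceless_derivations_finite_projective_dimension[OF assms(4,6)])
  \<comment> \<open>\<open>Ext\<close> is formed with a resolution picked by \<open>SOME\<close>.
    One exists, since otherwise the projective dimension would be the infimum of the empty
    set.\<close>
  obtain R where "projective_resolution K A S R"
  proof -
    have "\<exists>R. projective_resolution K A S R"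
    proof (rule ccontr)
      assume "\<not> ?thesis"
      then have "projective_dimension K A S = \<infinity>"
        unfolding projective_dimension_def by (simp add: Inf_enat_def)
      with assms(6) show False by simp
    qed
    with that show ?thesis by blast
  qed
  then have "projective_resolution K A S (SOME R. projective_resolution K A S R)" by (rule someI)
  moreover obtain P d e where Pde: "(SOME R. projective_resolution K A S R) = (P, d, e)"
    by (metis surj_pair)
  ultimately have R: "projective_resolution K A S (P, d, e)" by simp
  note res = projective_resolutionD[OF R]
  have P: "right_module A (P i)" for i
    using res(1)[of i] by (simp add: projective_rmodule_def fd_right_module_def)
  interpret P0: right_module A "P 0" by (rule P)
  interpret P1: right_module A "P (Suc 0)" by (rule P)
  let ?P = "P (Suc 0)" and ?Z = "cocycles A (P, d, e) S (Suc 0)" and ?B = "coboundaries A (P, d, e) S (Suc 0)"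
  note d0 = rmod_homD[OF res(2)[of 0]]
  have coc: "f \<in> ?Z \<longleftrightarrow> f \<in> rmod_hom A ?P S \<and> (\<forall>x\<in>carrier (P (Suc (Suc 0))). f (d (Suc 0) x) = \<zero>\<^bsub>S\<^esub>)" for f
    by (auto simp: cocycles_def hom_group_def compose_def fun_eq_iff restrict_def)
  have "?B \<subseteq> ?Z"
  proof
    fix f assume "f \<in> ?B"
    then obtain g where g: "g \<in> rmod_hom A (P 0) S" "f = compose (carrier ?P) g (d 0)"
      by (auto simp: coboundaries_def)
    note g' = rmod_homD[OF g(1)]
    have "f \<in> rmod_hom A ?P S"
      unfolding g(2) using g' d0 by (intro rmod_homI) (auto simp: compose_def P1.ract_closed)
    moreover have "f (d (Suc 0) x) = \<zero>\<^bsub>S\<^esub>" if x: "x \<in> carrier (P (Suc (Suc 0)))" for x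
    proof -
      have "d (Suc 0) x \<in> a_kernel ?P (P 0) (d 0)" using x res(6)[of 0] by auto
      then show ?thesis
        using linear_maps_zero[OF P S rmod_hom_linear[OF g(1)]] by (simp add: g(2) compose_def a_kernel_def')
    qed
    ultimately show "f \<in> ?Z" by (simp add: coc)
  qed
  \<comment> \<open>A 1-cocycle f kills the image of \<open>d 1\<close>, which is the kernel of
    \<open>d 0\<close>. Hence it induces a homomorphism k on the image of \<open>d 0\<close>, which
    is the kernel of \<open>e\<close>. An extension g of k to P 0, provided by
    \<open>homomorphism_extends\<close>, satisfies f = g \<circ> \<open>d 0\<close>.\<close>
  moreover have "?Z \<subseteq> ?B"
  proof
    fix f assume f: "f \<in> ?Z"
    then have fh: "f \<in> rmod_hom A ?P S" by (simp add: coc)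
    note f' = rmod_homD[OF fh]
    have f_ker: "f x = \<zero>\<^bsub>S\<^esub>" if "x \<in> carrier ?P" "d 0 x = \<zero>\<^bsub>P 0\<^esub>" for x
    proof -
      have "x \<in> d (Suc 0) ` carrier (P (Suc (Suc 0)))"
        using that res(6)[of 0] by (simp add: a_kernel_def')
      then show ?thesis using f by (auto simp: coc)
    qed
    have "\<forall>z\<in>a_kernel (P 0) S e. \<exists>y\<in>carrier ?P. d 0 y = z"
      using res(5) by (metis imageE)
    then obtain t where t: "\<And>z. z \<in> a_kernel (P 0) S e \<Longrightarrow> t z \<in> carrier ?P"
      "\<And>z. z \<in> a_kernel (P 0) S e \<Longrightarrow> d 0 (t z) = z" by metis
    define k where "k z = f (t z)" for z
    have im: "d 0 y \<in> a_kernel (P 0) S e" if "y \<in> carrier ?P" for y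
      using that res(5) by auto
    \<comment> \<open>Independence of the chosen preimage: two preimages differ by an element of the
      kernel of \<open>d 0\<close>.\<close>
    have k: "k (d 0 y) = f y" if y: "y \<in> carrier ?P" for y
    proof -
      let ?y = "t (d 0 y)"
      have "d 0 (?y \<ominus>\<^bsub>?P\<^esub> y) = \<zero>\<^bsub>P 0\<^esub>"
        using y t[OF im[OF y]] d0(2)[OF y]
        by (simp add: linear_map_minus[OF P P rmod_hom_linear[OF res(2)]] P0.M.minus_eq P0.M.r_neg)
      then have "f (?y \<ominus>\<^bsub>?P\<^esub> y) = \<zero>\<^bsub>S\<^esub>"
        using y t(1)[OF im[OF y]] by (intro f_ker) auto
      then show ?thesis
        using y t(1)[OF im[OF y]] f'(2) by (simp add: k_def linear_map_minus[OF P S rmod_hom_linear[OF fh]])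
    qed
    have ex: "\<exists>y\<in>carrier ?P. z = d 0 y" if "z \<in> a_kernel (P 0) S e" for z
      using t[OF that] by (intro bexI[of _ "t z"]) simp_all
    have k_lin: "k \<in> linear_maps K A ((P 0)\<lparr>carrier := a_kernel (P 0) S e\<rparr>) S"
    proof (rule linear_mapsI)
      fix x y assume "x \<in> carrier ((P 0)\<lparr>carrier := a_kernel (P 0) S e\<rparr>)" "y \<in> carrier ((P 0)\<lparr>carrier := a_kernel (P 0) S e\<rparr>)"
      then have mem: "x \<in> a_kernel (P 0) S e" "y \<in> a_kernel (P 0) S e" by simp_all
      from ex[OF mem(1)] obtain x' where x: "x' \<in> carrier ?P" "x = d 0 x'" ..
      from ex[OF mem(2)] obtain y' where y: "y' \<in> carrier ?P" "y = d 0 y'" ..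
      note xy = x y
      show "k x \<in> carrier S" using xy by (simp add: k f')
      show "k (x \<oplus>\<^bsub>(P 0)\<lparr>carrier := a_kernel (P 0) S e\<rparr>\<^esub> y) = k x \<oplus>\<^bsub>S\<^esub> k y"
        using xy k[of "x' \<oplus>\<^bsub>?P\<^esub> y'"] by (simp add: k f' d0)
    next
      fix c x assume c: "c \<in> carrier K" and "x \<in> carrier ((P 0)\<lparr>carrier := a_kernel (P 0) S e\<rparr>)"
      then have "x \<in> a_kernel (P 0) S e" by simp
      from ex[OF this] obtain x' where x: "x' \<in> carrier ?P" "x = d 0 x'" ..
      show "k (scal A ((P 0)\<lparr>carrier := a_kernel (P 0) S e\<rparr>) c x) = scal A S c (k x)"
        using c x k[of "scal A ?P c x'"] by (simp add: k f' d0 scal_def P1.ract_closed)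
    qed
    have "k (x \<lhd>\<^bsub>P 0\<^esub> a) = k x \<lhd>\<^bsub>S\<^esub> a" if x: "x \<in> a_kernel (P 0) S e" and a: "a \<in> carrier A" for x a
    proof -
      from ex[OF x] obtain x' where "x' \<in> carrier ?P" "x = d 0 x'" ..
      then show ?thesis using a k[of "x' \<lhd>\<^bsub>?P\<^esub> a"] by (simp add: k f' d0 P1.ract_closed)
    qed
    from homomorphism_extends[OF assms(1) S assms(5) \<beta> tr P res(3,4) k_lin this] obtain g
      where g: "g \<in> rmod_hom A (P 0) S" "\<forall>x\<in>a_kernel (P 0) S e. g x = k x" ..
    have "f = compose (carrier ?P) g (d 0)"
      using f'(1) g(2) im k by (intro extensionalityI[of _ "carrier ?P"]) (auto simp: compose_def)
    then show "f \<in> ?B" using g(1) by (auto simp: coboundaries_def)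
  qed
  ultimately have BZ: "?B = ?Z" by blast
  let ?G = "(hom_group A ?P S)\<lparr>carrier := ?Z\<rparr>"
  interpret G: comm_group ?G
    by (rule comm_group_cocycles[OF R S])
  have "trivial_group (?G Mod carrier ?G)" by (rule G.trivial_group_FactGroup_carrier)
  then show ?thesis
    by (simp add: Ext_def cohomology_group_def Pde BZ)
qed

end
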